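(* Let $\phi_1,\phi_2\in L^2(\mathbb{R})$ with $\|\phi_1\|_2=\|\phi_2\|_2=1$. Let $\{\eta_{\gamma_1}\mid\gamma_1\in\Gamma_1\}\cup\{\eta_{\gamma_2}\mid\gamma_2\in\Gamma_2\}$ be a well-spread family of non-negative symbols on $\mathbb{R}^2$ with $\sum_{i=1}^2\sum_{\gamma_i\in\Gamma_i}\eta_{\gamma_i}\approx1$. If $\|\phi_1-\phi_2\|_2<\frac12$, then there exist constants $0<A\le B<\infty$ such that for all $f\in L^2(\mathbb{R})$ $$A\|f\|_2^2\le\sum_{i=1}^2\sum_{\gamma_i\in\Gamma_i}\|H_{\eta_{\gamma_i},\phi_i}f\|_2^2\le B\|f\|_2^2.$$
   Context: For $\gamma=(x,\omega)\in\mathbb{R}\times\mathbb{R}$, the time-frequency shift is $\pi(\gamma)\phi(t)=e^{2\pi i\omega t}\phi(t-x)$. For $\phi,f\in L^2(\mathbb{R})$ the short-time Fourier transform is $\mathcal{V}_\phi f(\gamma)=\langle f,\pi(\gamma)\phi\rangle$. For a symbol $m\colon\mathbb{R}^2\to\mathbb{R}$ the time-frequency localization operator is $H_{m,\phi}f(t)=\int_{\mathbb{R}^2}\mathcal{V}_\phi f(\gamma)\,m(\gamma)\,\pi(\gamma)\phi(t)\,d\gamma$, formally $H_{m,\phi}f=\mathcal{V}_\phi^*(m\,\mathcal{V}_\phi f)$. A family of symbols $\{\eta_\gamma\colon\mathbb{R}^2\to\mathbb{R}\mid\gamma\in\Gamma\}$ with $\eta_\gamma\in L^1(\mathbb{R}^2)$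 is called well-spread if $\Gamma\subset\mathbb{R}^2$ is a discrete set without accumulation points and there exists a continuous function $g\in L^2(\mathbb{R}^2)$ with polynomial decay such that $|\eta_\gamma(\xi)|\le g(\xi-\gamma)$ for all $\xi\in\mathbb{R}^2$, $\gamma\in\Gamma$. Here the family is indexed by $\Gamma_1$ and $\Gamma_2$ together. The notation $f\approx g$ means that there are constants $0<A\le B<\infty$ with $Ag\le f\le Bg$.
   Formalization: The index set is assumed, besides having no accumulation points, to have a bounded number of points in each unit disc, and polynomial decay of g means order greater than 2; without either condition the lower bound can fail. *)

theory Defs
  imports "HOL-Analysis.Analysis"
begin

text \<open>Elements of \<open>L\<^sup>2\<close> are represented by Borel functions; functions that agree almost everywhere are
  not identified.\<close>

definition square_integrable :: "('a::euclidean_space \<Rightarrow> 'b::real_normed_vector) \<Rightarrow> bool" where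
  "square_integrable f \<longleftrightarrow>
     f \<in> borel_measurable lborel \<and> integrable lborel (\<lambda>x. (norm (f x))\<^sup>2)"

definition L2_norm :: "('a::euclidean_space \<Rightarrow> 'b::real_normed_vector) \<Rightarrow> real" where
  "L2_norm f = sqrt (\<integral>x. (norm (f x))\<^sup>2 \<partial>lborel)"

definition L2_inner :: "(real \<Rightarrow> complex) \<Rightarrow> (real \<Rightarrow> complex) \<Rightarrow> complex" where
  "L2_inner f g = (\<integral>t. f t * cnj (g t) \<partial>lborel)"

definition tf_shift :: "real \<times> real \<Rightarrow> (real \<Rightarrow> complex) \<Rightarrow> real \<Rightarrow> complex" where
  "tf_shift \<gamma> \<phi> t = exp (2 * of_real pi * \<i> * of_real (snd \<gamma> * t)) * \<phi> (t - fst \<gamma>)"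

definition STFT :: "(real \<Rightarrow> complex) \<Rightarrow> (real \<Rightarrow> complex) \<Rightarrow> real \<times> real \<Rightarrow> complex" where
  "STFT \<phi> f \<gamma> = L2_inner f (tf_shift \<gamma> \<phi>)"

text \<open>For \<open>m \<in> L\<^sup>1\<close> and \<open>\<phi>, f \<in> L\<^sup>2\<close> the integral below converges absolutely for almost every \<open>t\<close>,
  because \<open>STFT \<phi> f\<close> is bounded; on the exceptional null set the Bochner integral is 0 by
  convention.\<close>

definition loc_op ::
  "(real \<times> real \<Rightarrow> real) \<Rightarrow> (real \<Rightarrow> complex) \<Rightarrow> (real \<Rightarrow> complex) \<Rightarrow> real \<Rightarrow> complex" where
  "loc_op m \<phi> f t = (\<integral>\<gamma>. STFT \<phi> f \<gamma> * of_real (m \<gamma>) * tf_shift \<gamma> \<phi> t \<partial>lborel)"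

text \<open>Discreteness is understood uniformly over the plane: besides having no accumulation point, the
  set has a bounded number of points in each unit disc (it is relatively separated). Having no
  accumulation point alone would allow the number of points per unit disc to grow without bound;
  cutting an indicator of a unit cell into ever more equal parts then makes
  \<open>\<Sum>\<^sub>\<gamma> \<eta>\<^sub>\<gamma>(\<xi>)\<^sup>2\<close> tend to 0 as \<open>\<xi>\<close> tends to infinity while \<open>\<Sum>\<^sub>\<gamma> \<eta>\<^sub>\<gamma> = 1\<close>, so the operators
  \<open>loc_op \<eta>\<^sub>\<gamma> \<phi>\<close> cannot satisfy a lower bound.\<close>

definition discrete_set :: "(real \<times> real) set \<Rightarrow> bool" where
  "discrete_set \<Gamma> \<longleftrightarrow>
     (\<forall>z. \<not> z islimpt \<Gamma>) \<and> (\<exists>N. \<forall>z. card (\<Gamma> \<inter> cball z 1) \<le> N)"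

text \<open>The order of decay exceeds the dimension 2 of the plane, which makes the translates of \<open>g\<close>
  along a relatively separated set uniformly summable.\<close>

definition polynomial_decay :: "(real \<times> real \<Rightarrow> real) \<Rightarrow> bool" where
  "polynomial_decay g \<longleftrightarrow> (\<exists>C s. s > 2 \<and> (\<forall>\<xi>. \<bar>g \<xi>\<bar> \<le> C * (1 + norm \<xi>) powr (- s)))"

text \<open>The family is indexed by the pairs \<open>(i, \<gamma>)\<close> with \<open>i \<in> I\<close> and \<open>\<gamma> \<in> \<Gamma> i\<close>, so the sets \<open>\<Gamma> i\<close> may
  overlap; one envelope \<open>g\<close> serves all of them.\<close>

definition well_spread ::
  "'i set \<Rightarrow> ('i \<Rightarrow> (real \<times> real) set) \<Rightarrow> ('i \<Rightarrow> real \<times> real \<Rightarrow> real \<times> real \<Rightarrow> real) \<Rightarrow> bool" where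
  "well_spread I \<Gamma> \<eta> \<longleftrightarrow>
     discrete_set (\<Union>i\<in>I. \<Gamma> i) \<and>
     (\<forall>i\<in>I. \<forall>\<gamma>\<in>\<Gamma> i. integrable lborel (\<eta> i \<gamma>)) \<and>
     (\<exists>g. continuous_on UNIV g \<and> square_integrable g \<and> polynomial_decay g \<and>
          (\<forall>i\<in>I. \<forall>\<gamma>\<in>\<Gamma> i. \<forall>\<xi>. \<bar>\<eta> i \<gamma> \<xi>\<bar> \<le> g (\<xi> - \<gamma>)))"

definition comparable :: "('a \<Rightarrow> real) \<Rightarrow> ('a \<Rightarrow> real) \<Rightarrow> bool" where
  "comparable f g \<longleftrightarrow> (\<exists>A B. 0 < A \<and> A \<le> B \<and> (\<forall>x. A * g x \<le> f x \<and> f x \<le> B * g x))"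

end

theory Submission
  imports Defs "HOL-Probability.Characteristic_Functions"
begin

text \<open>The STFT with a normalized window is an isometry, so \<open>H = loc_op \<eta> \<phi>\<close> satisfies
  \<open>\<langle>H f, f\<rangle> = \<integral> \<eta> |V f|\<^sup>2\<close> and \<open>\<parallel>H f\<parallel>\<^sup>2 \<le> \<integral> \<eta>\<^sup>2 |V f|\<^sup>2\<close>. The second relation gives the upper bound.
  Since \<open>V\<^sub>1 f - V\<^sub>2 f = STFT (\<phi>\<^sub>1 - \<phi>\<^sub>2) f\<close> has norm at most \<open>\<parallel>f\<parallel> / 2\<close> and at every point one of the two
  symbol sums is bounded below, the total energy \<open>\<Sum> \<langle>H f, f\<rangle>\<close> dominates \<open>\<parallel>f\<parallel>\<^sup>2\<close>.

  To pass from \<open>\<Sum> \<langle>H f, f\<rangle>\<close> to \<open>\<Sum> \<parallel>H f\<parallel>\<^sup>2\<close>, write \<open>f = L f + (f - L f)\<close> in the second slot, where \<open>L = L\<^sub>\<gamma>\<close>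
  localizes near \<open>\<gamma>\<close> and \<open>\<Sum> \<parallel>L f\<parallel>\<^sup>2 \<le> C \<parallel>f\<parallel>\<^sup>2\<close>. The windows are merely in \<open>L\<^sup>2\<close>, so no off-diagonal decay
  of the reproducing kernel is available. Instead \<open>L\<^sub>\<gamma>\<close> is an average of the shifts \<open>\<pi>(\<xi>)\<close>, twisted by a
  character depending on \<open>\<gamma>\<close>, over a small square of \<open>\<xi>\<close>. Moving \<open>\<pi>(\<xi>)\<close> onto the window shows that the
  remainder \<open>f - L f\<close> contributes little: \<open>\<xi> \<mapsto> \<pi>(\<xi>) \<phi>\<close> is continuous in \<open>L\<^sup>2\<close>, and the character is
  close to 1 where \<open>\<eta>\<^sub>\<gamma>\<close> is concentrated.\<close>

subsection \<open>Square-integrable functions and the STFT\<close>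

text \<open>The symbols decay with an order \<open>r > 1\<close> that may be close to 1, so the
  phase error of a localizer can be charged with only a small power \<open>\<sigma>\<close> of the
  distance to \<gamma>; a quadratic bound could destroy summability over \<gamma>. The averaging
  density is constant in the modulation variable and Gaussian in the translation variable. Averaging
  modulations over an interval gives a sinc multiplier in time, whose square has summable
  translates. Averaging translations with a constant weight would give one value of an STFT at the
  frequency of \<gamma>; the Gaussian replaces it by a mean over nearby frequencies, which integrals
  control. The tolerance for the remainders fixes \<open>\<delta>\<close>, and only
  \<open>\<delta>\<close> determines the summability constant of the localizers, hence the weight
  \<open>K\<close> of the norms of \<open>H f\<close>. If \<open>a\<close> is a lower bound of the
  total symbol sum, the inequality \<open>|V1|^2 <= 2 |V2|^2 + 2 |V1 - V2|^2\<close> leaves the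
  energy \<open>a (1/2 - ||\<phi>1 - \<phi>2||^2) ||f||^2\<close>, at least a quarter of
  \<open>a ||f||^2\<close>; half of that quarter pays for the remainders of the two windows.\<close>

lemma borel_measurable_cnj [measurable (raw)]:
  "f \<in> borel_measurable M \<Longrightarrow> (\<lambda>x. cnj (f x)) \<in> borel_measurable M"
  by (rule borel_measurable_continuous_on) (auto intro: continuous_intros)

lemma borel_measurable_cis [measurable (raw)]:
  "f \<in> borel_measurable M \<Longrightarrow> (\<lambda>x. cis (f x)) \<in> borel_measurable M"
  by (rule borel_measurable_continuous_on[of cis]) (auto intro!: continuous_intros)

lemma square_integrable_measurable [measurable_dest]:
  "square_integrable f \<Longrightarrow> f \<in> borel_measurable borel"
  by (simp add: square_integrable_def)

lemma L2_norm_nonneg [simp]: "0 \<le> L2_norm f"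
  by (simp add: L2_norm_def)

lemma L2_norm_squared: "(L2_norm f)\<^sup>2 = (\<integral>x. (norm (f x))\<^sup>2 \<partial>lborel)"
  by (simp add: L2_norm_def)

lemma nn_integral_square:
  "square_integrable f \<Longrightarrow> (\<integral>\<^sup>+x. ennreal ((norm (f x))\<^sup>2) \<partial>lborel) = ennreal ((L2_norm f)\<^sup>2)"
  by (simp add: square_integrable_def L2_norm_squared nn_integral_eq_integral)

text \<open>Tonelli estimates of a squared modulus live in \<open>ennreal\<close>; this turns such
  an estimate into membership in L2 and a real bound at once, with no integrability known
  beforehand.\<close>

lemma square_integrableI:
  assumes [measurable]: "f \<in> borel_measurable borel"
    and "0 \<le> C" and *: "(\<integral>\<^sup>+x. ennreal ((norm (f x))\<^sup>2) \<partial>lborel) \<le> ennreal C"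
  shows "square_integrable f" and "(L2_norm f)\<^sup>2 \<le> C"
proof -
  show f: "square_integrable f"
    unfolding square_integrable_def
    using * by (auto intro!: integrableI_bounded simp: less_top[symmetric] top_unique)
  show "(L2_norm f)\<^sup>2 \<le> C"
    using * \<open>0 \<le> C\<close> by (simp add: nn_integral_square[OF f])
qed

lemma ennreal_power2_le_imp_le:
  fixes x :: ennreal
  assumes "x\<^sup>2 \<le> (ennreal c)\<^sup>2" "0 \<le> c"
  shows "x \<le> ennreal c"
proof (cases x)
  case (real r)
  then show ?thesis
    using assms by (simp add: ennreal_power power2_le_iff_abs_le)
next
  case top
  then show ?thesis
    using assms by (simp add: ennreal_power ennreal_top_eq_mult_iff power2_eq_square top_unique ennreal_mult[symmetric])
qed

text \<open>Cauchy-Schwarz is kept in \<open>ennreal\<close> form because the same bound also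
  supplies the finiteness hypotheses of Fubini below.\<close>

lemma nn_integral_mult_le_L2_norm:
  fixes f :: "'a::euclidean_space \<Rightarrow> 'b::real_normed_vector" and g :: "'a \<Rightarrow> 'c::real_normed_vector"
  assumes "square_integrable f" "square_integrable g"
  shows "(\<integral>\<^sup>+x. ennreal (norm (f x) * norm (g x)) \<partial>lborel) \<le> ennreal (L2_norm f * L2_norm g)"
proof -
  have [measurable]: "f \<in> borel_measurable borel" "g \<in> borel_measurable borel"
    using assms by auto
  have "(\<integral>\<^sup>+x. ennreal (norm (f x)) * ennreal (norm (g x)) \<partial>lborel)\<^sup>2
      \<le> (\<integral>\<^sup>+x. ennreal (norm (f x)) ^ 2 \<partial>lborel) * (\<integral>\<^sup>+x. ennreal (norm (g x)) ^ 2 \<partial>lborel)"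
    by (rule Cauchy_Schwarz_nn_integral) auto
  also have "\<dots> = (ennreal (L2_norm f * L2_norm g))\<^sup>2"
    using assms by (simp add: ennreal_power nn_integral_square power_mult_distrib ennreal_mult)
  finally show ?thesis
    by (intro ennreal_power2_le_imp_le) (simp_all add: ennreal_mult)
qed

lemma integrable_mult_square_integrable:
  fixes f g :: "'a::euclidean_space \<Rightarrow> complex"
  assumes "square_integrable f" "square_integrable g"
  shows "integrable lborel (\<lambda>x. f x * g x)"
proof (rule integrableI_bounded)
  have [measurable]: "f \<in> borel_measurable borel" "g \<in> borel_measurable borel"
    using assms by auto
  show "(\<lambda>x. f x * g x) \<in> borel_measurable lborel"
    by measurable
  show "(\<integral>\<^sup>+x. ennreal (norm (f x * g x)) \<partial>lborel) < \<infinity>"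
    using nn_integral_mult_le_L2_norm[OF assms]
    by (auto simp: norm_mult less_top[symmetric] top_unique)
qed

lemma norm_integral_mult_le:
  fixes f g :: "'a::euclidean_space \<Rightarrow> complex"
  assumes "square_integrable f" "square_integrable g"
  shows "norm (\<integral>x. f x * g x \<partial>lborel) \<le> L2_norm f * L2_norm g"
proof -
  have "ennreal (norm (\<integral>x. f x * g x \<partial>lborel)) \<le> (\<integral>\<^sup>+x. ennreal (norm (f x * g x)) \<partial>lborel)"
    using integrable_mult_square_integrable[OF assms] by (rule integral_norm_bound_ennreal)
  also have "\<dots> \<le> ennreal (L2_norm f * L2_norm g)"
    using nn_integral_mult_le_L2_norm[OF assms] by (simp add: norm_mult)
  finally show ?thesis
    by simp
qed

lemma square_integrable_cnj:
  "square_integrable f \<Longrightarrow> square_integrable (\<lambda>x. cnj (f x))"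
  by (auto simp: square_integrable_def)

lemma L2_norm_cnj: "L2_norm (\<lambda>x. cnj (f x)) = L2_norm f"
  by (simp add: L2_norm_def)

lemma norm_L2_inner_le:
  assumes "square_integrable f" "square_integrable g"
  shows "norm (L2_inner f g) \<le> L2_norm f * L2_norm g"
  using norm_integral_mult_le[OF assms(1) square_integrable_cnj[OF assms(2)]]
  by (simp add: L2_inner_def L2_norm_cnj)

text \<open>The cross term is absorbed by the square of \<open>norm a - norm b\<close>. The factor 2
  returns in the lower frame bound, where it fixes the share of the energy that survives the passage
  from one window to the other.\<close>

lemma norm_add_squared_le:
  fixes a b :: "'a::real_normed_vector"
  shows "(norm (a + b))\<^sup>2 \<le> 2 * (norm a)\<^sup>2 + 2 * (norm b)\<^sup>2"
proof -
  have "(norm (a + b))\<^sup>2 \<le> (norm a + norm b)\<^sup>2"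
    by (intro power_mono norm_triangle_ineq) auto
  also have "\<dots> \<le> 2 * (norm a)\<^sup>2 + 2 * (norm b)\<^sup>2"
    using zero_le_power2[of "norm a - norm b"] by (simp add: power2_sum power2_diff)
  finally show ?thesis .
qed

lemma
  fixes f g :: "'a::euclidean_space \<Rightarrow> complex"
  assumes f: "square_integrable f" and g: "square_integrable g"
  shows square_integrable_add: "square_integrable (\<lambda>x. f x + g x)"
    and L2_norm_add_squared_le:
      "(L2_norm (\<lambda>x. f x + g x))\<^sup>2 \<le> 2 * (L2_norm f)\<^sup>2 + 2 * (L2_norm g)\<^sup>2"
proof -
  have [measurable]: "f \<in> borel_measurable borel" "g \<in> borel_measurable borel"
    using assms by auto
  have "(\<integral>\<^sup>+x. ennreal ((norm (f x + g x))\<^sup>2) \<partial>lborel)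
      \<le> (\<integral>\<^sup>+x. 2 * ennreal ((norm (f x))\<^sup>2) + 2 * ennreal ((norm (g x))\<^sup>2) \<partial>lborel)"
  proof (rule nn_integral_mono)
    fix x
    have "ennreal ((norm (f x + g x))\<^sup>2) \<le> ennreal (2 * (norm (f x))\<^sup>2 + 2 * (norm (g x))\<^sup>2)"
      by (intro ennreal_leI norm_add_squared_le)
    then show "ennreal ((norm (f x + g x))\<^sup>2) \<le> 2 * ennreal ((norm (f x))\<^sup>2) + 2 * ennreal ((norm (g x))\<^sup>2)"
      by (simp add: ennreal_plus ennreal_mult)
  qed
  also have "\<dots> = ennreal (2 * (L2_norm f)\<^sup>2 + 2 * (L2_norm g)\<^sup>2)"
    by (simp add: nn_integral_add nn_integral_cmult nn_integral_square f g ennreal_plus ennreal_mult)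
  finally have *: "(\<integral>\<^sup>+x. ennreal ((norm (f x + g x))\<^sup>2) \<partial>lborel)
      \<le> ennreal (2 * (L2_norm f)\<^sup>2 + 2 * (L2_norm g)\<^sup>2)" .
  show "square_integrable (\<lambda>x. f x + g x)"
    by (rule square_integrableI(1)[OF _ _ *]) auto
  show "(L2_norm (\<lambda>x. f x + g x))\<^sup>2 \<le> 2 * (L2_norm f)\<^sup>2 + 2 * (L2_norm g)\<^sup>2"
    by (rule square_integrableI(2)[OF _ _ *]) auto
qed

lemma square_integrable_diff:
  fixes f g :: "'a::euclidean_space \<Rightarrow> complex"
  assumes "square_integrable f" "square_integrable g"
  shows "square_integrable (\<lambda>x. f x - g x)"
proof -
  have "square_integrable (\<lambda>x. - g x)"
    using assms(2) by (auto simp: square_integrable_def)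
  from square_integrable_add[OF assms(1) this] show ?thesis
    by simp
qed

section \<open>Time-frequency shifts as isometries, boundedness and measurability of the
  STFT\<close>

lemma tf_shift_cis: "tf_shift \<gamma> \<phi> t = cis (2 * pi * (snd \<gamma> * t)) * \<phi> (t - fst \<gamma>)"
  by (simp add: tf_shift_def cis_conv_exp algebra_simps)

lemma norm_tf_shift: "norm (tf_shift \<gamma> \<phi> t) = norm (\<phi> (t - fst \<gamma>))"
  by (simp add: tf_shift_cis norm_mult)

lemma nn_integral_shift:
  fixes f :: "real \<Rightarrow> ennreal"
  assumes "f \<in> borel_measurable borel"
  shows "(\<integral>\<^sup>+t. f (t - x) \<partial>lborel) = (\<integral>\<^sup>+t. f t \<partial>lborel)"
  using nn_integral_real_affine[OF assms, of 1 "-x"] by simp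

lemma
  assumes "square_integrable \<phi>"
  shows square_integrable_tf_shift: "square_integrable (tf_shift \<gamma> \<phi>)"
    and L2_norm_tf_shift: "L2_norm (tf_shift \<gamma> \<phi>) = L2_norm \<phi>"
proof -
  have [measurable]: "\<phi> \<in> borel_measurable borel"
    using assms by auto
  have m: "tf_shift \<gamma> \<phi> \<in> borel_measurable borel"
    unfolding tf_shift_cis[abs_def] by measurable
  have eq: "(\<integral>\<^sup>+t. ennreal ((norm (tf_shift \<gamma> \<phi> t))\<^sup>2) \<partial>lborel) = ennreal ((L2_norm \<phi>)\<^sup>2)"
    using nn_integral_shift[of "\<lambda>t. ennreal ((norm (\<phi> t))\<^sup>2)" "fst \<gamma>"]
    by (simp add: norm_tf_shift nn_integral_square assms)
  show *: "square_integrable (tf_shift \<gamma> \<phi>)"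
    by (rule square_integrableI(1)[OF m _ eq_refl[OF eq]]) simp
  have "ennreal ((L2_norm (tf_shift \<gamma> \<phi>))\<^sup>2) = ennreal ((L2_norm \<phi>)\<^sup>2)"
    using eq nn_integral_square[OF *] by simp
  then show "L2_norm (tf_shift \<gamma> \<phi>) = L2_norm \<phi>"
    by simp
qed

text \<open>Boundedness makes the product of the STFT with an integrable symbol integrable, so that
  a localization operator is an average of shifts against an L1 weight.\<close>

lemma norm_STFT_le:
  assumes "square_integrable \<phi>" "square_integrable f"
  shows "norm (STFT \<phi> f z) \<le> L2_norm f * L2_norm \<phi>"
  using norm_L2_inner_le[OF assms(2) square_integrable_tf_shift[OF assms(1), of z]]
  by (simp add: STFT_def L2_norm_tf_shift assms)

text \<open>Measurability goals speak of products of \<open>borel\<close>, the theorem on parametric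
  integrals of products with \<open>lborel\<close>; the two \<sigma>-algebras coincide.\<close>

lemma borel_measurable_lborel_integral:
  fixes f :: "'a \<Rightarrow> 'b::euclidean_space \<Rightarrow> complex"
  assumes "(\<lambda>(x, y). f x y) \<in> borel_measurable (M \<Otimes>\<^sub>M borel)"
  shows "(\<lambda>x. \<integral>y. f x y \<partial>lborel) \<in> borel_measurable M"
proof -
  have "sets (M \<Otimes>\<^sub>M borel) = sets (M \<Otimes>\<^sub>M (lborel :: 'b measure))"
    by (intro sets_pair_measure_cong) auto
  then have "(\<lambda>(x, y). f x y) \<in> borel_measurable (M \<Otimes>\<^sub>M lborel)"
    using assms by (simp cong: measurable_cong_sets)
  then show ?thesis
    by (rule lborel.borel_measurable_lebesgue_integral)
qed

lemma borel_measurable_STFT [measurable]: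
  assumes [measurable]: "\<phi> \<in> borel_measurable borel" "f \<in> borel_measurable borel"
  shows "STFT \<phi> f \<in> borel_measurable borel"
proof -
  have "(\<lambda>z. \<integral>t. f t * cnj (cis (2 * pi * (snd z * t)) * \<phi> (t - fst z)) \<partial>lborel)
      \<in> borel_measurable (borel \<Otimes>\<^sub>M borel)"
    by (rule borel_measurable_lborel_integral) measurable
  then show ?thesis
    unfolding STFT_def[abs_def] L2_inner_def tf_shift_cis borel_prod .
qed

lemma STFT_diff:
  assumes "square_integrable \<phi>" "square_integrable f" "square_integrable g"
  shows "STFT \<phi> (\<lambda>t. f t - g t) z = STFT \<phi> f z - STFT \<phi> g z"
  using assms
  by (simp add: STFT_def L2_inner_def left_diff_distrib integrable_mult_square_integrable
      square_integrable_cnj square_integrable_tf_shift)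

text \<open>Together with the isometry this turns closeness of two windows in L2 into closeness of
  their STFTs in L2. It is applied to the two windows of the theorem and to a window and its
  shifts.\<close>

lemma STFT_diff_window:
  assumes "square_integrable \<phi>" "square_integrable \<psi>" "square_integrable f"
  shows "STFT (\<lambda>t. \<phi> t - \<psi> t) f z = STFT \<phi> f z - STFT \<psi> f z"
proof -
  have "tf_shift z (\<lambda>t. \<phi> t - \<psi> t) t = tf_shift z \<phi> t - tf_shift z \<psi> t" for t
    by (simp add: tf_shift_def right_diff_distrib)
  then show ?thesis
    using assms
    by (simp add: STFT_def L2_inner_def right_diff_distrib integrable_mult_square_integrable
        square_integrable_cnj square_integrable_tf_shift)
qed

subsection \<open>Continuity of translation in the mean\<close>

text \<open>A three-epsilon argument: by translation invariance the error between \<open>f\<close>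
  and \<open>g\<close> is the same before and after the shift. It serves both limit passages of
  \<open>translation_L1\<close>, from open sets to Borel sets and from a dominated sequence to its
  limit.\<close>

lemma translation_L1_approx:
  fixes f :: "real \<Rightarrow> complex"
  assumes f: "integrable lborel f"
    and approx: "\<And>e. 0 < e \<Longrightarrow> \<exists>g. integrable lborel g \<and> (\<integral>x. norm (f x - g x) \<partial>lborel) < e \<and>
      (\<lambda>n. \<integral>x. norm (g (x + u n) - g x) \<partial>lborel) \<longlonglongrightarrow> 0"
  shows "(\<lambda>n. \<integral>x. norm (f (x + u n) - f x) \<partial>lborel) \<longlonglongrightarrow> 0"
proof (rule LIMSEQ_I)
  fix r :: real
  assume "0 < r"
  then obtain g where g: "integrable lborel g" and fg: "(\<integral>x. norm (f x - g x) \<partial>lborel) < r / 3"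
    and lim: "(\<lambda>n. \<integral>x. norm (g (x + u n) - g x) \<partial>lborel) \<longlonglongrightarrow> 0"
    using approx[of "r / 3"] by auto
  obtain N where N: "\<And>n. N \<le> n \<Longrightarrow> norm ((\<integral>x. norm (g (x + u n) - g x) \<partial>lborel) - 0) < r / 3"
    using LIMSEQ_D[OF lim, of "r / 3"] \<open>0 < r\<close> by auto
  have shift: "integrable lborel (\<lambda>x. h (x + c))" if "integrable lborel h" for h :: "real \<Rightarrow> complex" and c
    using lborel_integrable_real_affine[OF that, of 1 c] by (simp add: add.commute)
  have "norm ((\<integral>x. norm (f (x + u n) - f x) \<partial>lborel) - 0) < r" if "N \<le> n" for n
  proof -
    have "(\<integral>x. norm (f (x + u n) - f x) \<partial>lborel)
        \<le> (\<integral>x. norm (f (x + u n) - g (x + u n)) + norm (g (x + u n) - g x) + norm (f x - g x) \<partial>lborel)"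
    proof (intro integral_mono)
      show "norm (f (x + u n) - f x)
          \<le> norm (f (x + u n) - g (x + u n)) + norm (g (x + u n) - g x) + norm (f x - g x)" for x
        using norm_triangle_ineq4[of "f (x + u n) - g (x + u n) + (g (x + u n) - g x)" "f x - g x"]
          norm_triangle_ineq[of "f (x + u n) - g (x + u n)" "g (x + u n) - g x"]
        by simp
      show "integrable lborel (\<lambda>x. norm (f (x + u n) - g (x + u n)) + norm (g (x + u n) - g x) + norm (f x - g x))"
        by (intro Bochner_Integration.integrable_add integrable_norm Bochner_Integration.integrable_diff shift f g)
      show "integrable lborel (\<lambda>x. norm (f (x + u n) - f x))"
        by (intro integrable_norm Bochner_Integration.integrable_diff shift f)
    qed
    also have "\<dots> = (\<integral>x. norm (f (x + u n) - g (x + u n)) \<partial>lborel)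
        + (\<integral>x. norm (g (x + u n) - g x) \<partial>lborel) + (\<integral>x. norm (f x - g x) \<partial>lborel)"
      using f g shift by simp
    also have "(\<integral>x. norm (f (x + u n) - g (x + u n)) \<partial>lborel) = (\<integral>x. norm (f x - g x) \<partial>lborel)"
      using lborel_integral_real_affine[of 1 "\<lambda>x. norm (f x - g x)" "u n"] by (simp add: add.commute)
    finally show ?thesis
      using fg N[OF that] by simp
  qed
  then show "\<exists>N. \<forall>n\<ge>N. norm ((\<integral>x. norm (f (x + u n) - f x) \<partial>lborel) - 0) < r"
    by blast
qed

text \<open>The L1 distance is \<open>norm c\<close> times twice the measure of \<open>U\<close>
  minus twice the measure of the overlap of \<open>U\<close> with its translate. The overlap
  converges by dominated convergence: a point of the open set \<open>U\<close> stays in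
  \<open>U\<close> under all small shifts, and off \<open>U\<close> the product of indicators
  vanishes.\<close>

lemma translation_L1_open:
  fixes c :: complex
  assumes U: "open U" "emeasure lborel U < \<infinity>" and u: "u \<longlonglongrightarrow> (0::real)"
  shows "(\<lambda>n. \<integral>x. norm (indicator U (x + u n) *\<^sub>R c - indicator U x *\<^sub>R c) \<partial>lborel) \<longlonglongrightarrow> 0"
proof -
  have [measurable]: "U \<in> sets borel"
    using U by auto
  let ?I = "indicator U :: real \<Rightarrow> real"
  have int: "integrable lborel ?I"
    using U by (simp add: less_top)
  then have shift: "integrable lborel (\<lambda>x. ?I (x + b))" for b
    using lborel_integrable_real_affine[OF int, of 1 b] by (simp add: add.commute)
  have int': "integrable lborel (\<lambda>x. ?I x * ?I (x + b))" for b
    by (rule Bochner_Integration.integrable_bound[OF int]) (auto simp: indicator_def)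
  have "(\<lambda>n. \<integral>x. ?I x * ?I (x + u n) \<partial>lborel) \<longlonglongrightarrow> (\<integral>x. ?I x \<partial>lborel)"
  proof (rule integral_dominated_convergence[where w = ?I])
    show "AE x in lborel. (\<lambda>n. ?I x * ?I (x + u n)) \<longlonglongrightarrow> ?I x"
    proof (rule AE_I2)
      fix x :: real
      show "(\<lambda>n. ?I x * ?I (x + u n)) \<longlonglongrightarrow> ?I x"
      proof (cases "x \<in> U")
        case True
        have "(\<lambda>n. x + u n) \<longlonglongrightarrow> x"
          using tendsto_add[OF tendsto_const[of x] u] by simp
        then have "\<forall>\<^sub>F n in sequentially. x + u n \<in> U"
          using U True by (auto simp: tendsto_def)
        then show ?thesis
          using True by (intro tendsto_eventually) (auto elim!: eventually_mono)
      qed auto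
    qed
  qed (use int in \<open>auto simp: indicator_def\<close>)
  then have "(\<lambda>n. norm c * (2 * (\<integral>x. ?I x \<partial>lborel) - 2 * (\<integral>x. ?I x * ?I (x + u n) \<partial>lborel))) 
      \<longlonglongrightarrow> norm c * (2 * (\<integral>x. ?I x \<partial>lborel) - 2 * (\<integral>x. ?I x \<partial>lborel))"
    by (intro tendsto_intros)
  moreover have "(\<integral>x. norm (indicator U (x + b) *\<^sub>R c - indicator U x *\<^sub>R c) \<partial>lborel)
      = norm c * (2 * (\<integral>x. ?I x \<partial>lborel) - 2 * (\<integral>x. ?I x * ?I (x + b) \<partial>lborel))" for b
  proof -
    have "(\<integral>x. norm (indicator U (x + b) *\<^sub>R c - indicator U x *\<^sub>R c) \<partial>lborel)
        = (\<integral>x. norm c * (?I (x + b) + ?I x - 2 * (?I x * ?I (x + b))) \<partial>lborel)"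
      by (intro Bochner_Integration.integral_cong) (auto simp: indicator_def)
    also have "\<dots> = norm c * ((\<integral>x. ?I (x + b) \<partial>lborel) + (\<integral>x. ?I x \<partial>lborel)
        - 2 * (\<integral>x. ?I x * ?I (x + b) \<partial>lborel))"
      using int int' shift by simp
    also have "(\<integral>x. ?I (x + b) \<partial>lborel) = (\<integral>x. ?I x \<partial>lborel)"
      using lborel_integral_real_affine[of 1 ?I b] by (simp add: add.commute)
    finally show ?thesis
      by simp
  qed
  ultimately show ?thesis
    by simp
qed

text \<open>In the base case outer regularity replaces the Borel set by an open superset of nearly
  the same measure; the other cases are the triangle inequality and dominated approximation.\<close>

lemma translation_L1:
  fixes f :: "real \<Rightarrow> complex"
  assumes "integrable lborel f" and u: "u \<longlonglongrightarrow> 0"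
  shows "(\<lambda>n. \<integral>x. norm (f (x + u n) - f x) \<partial>lborel) \<longlonglongrightarrow> 0"
  using assms(1)
proof (induction rule: integrable_induct)
  case (base A c)
  then have A: "A \<in> sets borel" "emeasure lborel A < \<infinity>"
    by auto
  show ?case
  proof (rule translation_L1_approx)
    show "integrable lborel (\<lambda>x. indicat_real A x *\<^sub>R c)"
      using A by (simp add: less_top)
    fix e :: real
    assume "0 < e"
    \<comment> \<open>Adding 1 to \<open>norm c\<close> also covers \<open>c = 0\<close>.\<close>
    define e' where "e' = e / (norm c + 1)"
    have "0 < e'"
      using \<open>0 < e\<close> by (simp add: e'_def add_nonneg_pos)
    then obtain U where U: "open U" "A \<subseteq> U" "emeasure lborel (U - A) < ennreal e'"
      using outer_regular_lborel[of A e'] A by auto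
    have [measurable]: "U \<in> sets borel"
      using U by auto
    note [measurable] = A(1)
    have "emeasure lborel U \<le> emeasure lborel A + emeasure lborel (U - A)"
      using emeasure_subadditive[of A lborel "U - A"] U A by (simp add: Un_absorb1)
    also have "\<dots> < \<infinity>"
      using A U(3) by (auto simp: less_top[symmetric])
    finally have fin: "emeasure lborel U < \<infinity>" .
    have m: "measure lborel (U - A) < e'"
      using U(3) \<open>0 < e'\<close> by (simp add: emeasure_eq_ennreal_measure[OF top.not_eq_extremum[THEN iffD2, OF order.strict_trans[OF U(3) ennreal_less_top]]] ennreal_less_iff)
    have "(\<integral>x. norm (indicat_real A x *\<^sub>R c - indicat_real U x *\<^sub>R c) \<partial>lborel)
        = (\<integral>x. indicat_real (U - A) x * norm c \<partial>lborel)"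
      using U(2) by (intro Bochner_Integration.integral_cong) (auto simp: indicator_def)
    also have "\<dots> = measure lborel (U - A) * norm c"
      by simp
    also have "\<dots> \<le> e' * norm c"
      using m by (intro mult_right_mono) auto
    also have "\<dots> < e"
      using \<open>0 < e\<close> by (simp add: e'_def divide_simps add_nonneg_pos)
    finally show "\<exists>g. integrable lborel g \<and> (\<integral>x. norm (indicat_real A x *\<^sub>R c - g x) \<partial>lborel) < e \<and>
        (\<lambda>n. \<integral>x. norm (g (x + u n) - g x) \<partial>lborel) \<longlonglongrightarrow> 0"
      using translation_L1_open[OF U(1) fin u, of c] fin
      by (intro exI[of _ "\<lambda>x. indicat_real U x *\<^sub>R c"]) (auto simp: less_top)
  qed
next
  case (add f g)
  have shift: "integrable lborel (\<lambda>x. h (x + c))" if "integrable lborel h" for h :: "real \<Rightarrow> complex" and c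
    using lborel_integrable_real_affine[OF that, of 1 c] by (simp add: add.commute)
  show ?case
  proof (rule tendsto_sandwich[OF _ _ tendsto_const])
    show "(\<lambda>n. (\<integral>x. norm (f (x + u n) - f x) \<partial>lborel) + (\<integral>x. norm (g (x + u n) - g x) \<partial>lborel)) \<longlonglongrightarrow> 0"
      using tendsto_add[OF add.IH] by simp
    have "(\<integral>x. norm (f (x + b) + g (x + b) - (f x + g x)) \<partial>lborel)
       \<le> (\<integral>x. norm (f (x + b) - f x) + norm (g (x + b) - g x) \<partial>lborel)" for b
      by (intro integral_mono)
        (use add shift norm_triangle_ineq[of "f (_ + b) - f _" "g (_ + b) - g _"] in
          \<open>auto simp: add_diff_add\<close>)
    then show "\<forall>\<^sub>F n in sequentially. (\<integral>x. norm (f (x + u n) + g (x + u n) - (f x + g x)) \<partial>lborel)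
       \<le> (\<integral>x. norm (f (x + u n) - f x) \<partial>lborel) + (\<integral>x. norm (g (x + u n) - g x) \<partial>lborel)"
      using add shift by simp
  qed simp
next
  case (lim f s)
  show ?case
  proof (rule translation_L1_approx[OF lim.hyps(4)])
    fix e :: real
    assume "0 < e"
    have "(\<lambda>i. \<integral>x. norm (f x - s i x) \<partial>lborel) \<longlonglongrightarrow> (\<integral>x. (0::real) \<partial>(lborel :: real measure))"
    proof (rule integral_dominated_convergence[where w = "\<lambda>x. 3 * norm (f x)"])
      show "AE x in lborel. (\<lambda>i. norm (f x - s i x)) \<longlonglongrightarrow> 0"
      proof (rule AE_I2)
        fix x :: real
        have "(\<lambda>i. norm (f x - s i x)) \<longlonglongrightarrow> norm (f x - f x)"
          using lim.hyps(2)[of x] by (intro tendsto_intros) auto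
        then show "(\<lambda>i. norm (f x - s i x)) \<longlonglongrightarrow> 0"
          by simp
      qed
      show "AE x in lborel. norm (norm (f x - s i x)) \<le> 3 * norm (f x)" for i
      proof (rule AE_I2)
        fix x :: real
        show "norm (norm (f x - s i x)) \<le> 3 * norm (f x)"
          using norm_triangle_ineq4[of "f x" "s i x"] lim.hyps(3)[of x i] by simp
      qed
    qed (use lim.hyps in auto)
    then obtain i where "(\<integral>x. norm (f x - s i x) \<partial>lborel) < e"
      using LIMSEQ_D[of _ "0::real" e] \<open>0 < e\<close> by fastforce
    then show "\<exists>g. integrable lborel g \<and> (\<integral>x. norm (f x - g x) \<partial>lborel) < e \<and>
        (\<lambda>n. \<integral>x. norm (g (x + u n) - g x) \<partial>lborel) \<longlonglongrightarrow> 0"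
      using lim.hyps(1) lim.IH by blast
  qed
qed

text \<open>Strong monotonicity of the map sending \<open>a\<close> to \<open>norm a * a\<close>:
  twice the inner product below exceeds \<open>(norm a + norm b) * (norm (a - b))\<^sup>2\<close> by
  a nonnegative square times \<open>norm a + norm b\<close>. Cauchy-Schwarz and division by
  \<open>norm (a - b)\<close> finish. The map carries L2 to L1, which reduces translation in L2 to
  translation in L1.\<close>

lemma norm_diff_squared_le:
  fixes a b :: complex
  shows "(norm (a - b))\<^sup>2 \<le> 2 * norm (of_real (norm a) * a - of_real (norm b) * b)"
proof -
  have "(norm a + norm b) * (norm (a - b))\<^sup>2 / 2
      \<le> inner (norm a *\<^sub>R a - norm b *\<^sub>R b) (a - b)"
  proof -
    have "2 * inner (norm a *\<^sub>R a - norm b *\<^sub>R b) (a - b) - (norm a + norm b) * (norm (a - b))\<^sup>2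
        = (norm a - norm b) * ((norm a)\<^sup>2 - (norm b)\<^sup>2)"
      unfolding power2_norm_eq_inner by (simp add: algebra_simps inner_commute)
    also have "\<dots> = (norm a - norm b)\<^sup>2 * (norm a + norm b)"
      by (simp add: power2_eq_square algebra_simps)
    also have "\<dots> \<ge> 0"
      by simp
    finally show ?thesis
      by simp
  qed
  also have "\<dots> \<le> norm (norm a *\<^sub>R a - norm b *\<^sub>R b) * norm (a - b)"
    by (rule norm_cauchy_schwarz)
  finally have *: "(norm a + norm b) * (norm (a - b))\<^sup>2 / 2 \<le> norm (norm a *\<^sub>R a - norm b *\<^sub>R b) * norm (a - b)" .
  show ?thesis
  proof (cases "a = b")
    case False
    then have "(norm a + norm b) * norm (a - b) \<le> 2 * norm (norm a *\<^sub>R a - norm b *\<^sub>R b)"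
      using * by (simp add: power2_eq_square)
    moreover have "(norm (a - b))\<^sup>2 \<le> (norm a + norm b) * norm (a - b)"
      unfolding power2_eq_square by (intro mult_right_mono norm_triangle_ineq4) auto
    ultimately show ?thesis
      by (simp add: scaleR_conv_of_real)
  qed auto
qed

text \<open>The function \<open>F\<close> has modulus \<open>(norm (f x))\<^sup>2\<close> and is
  therefore integrable; the pointwise inequality bounds the squared L2 distance of \<open>f\<close>
  to its translate by twice the L1 distance of \<open>F\<close> to its translate.\<close>

lemma translation_L2:
  fixes f :: "real \<Rightarrow> complex"
  assumes f: "square_integrable f" and u: "u \<longlonglongrightarrow> 0"
  shows "(\<lambda>n. L2_norm (\<lambda>x. f (x + u n) - f x)) \<longlonglongrightarrow> 0"
proof -
  have [measurable]: "f \<in> borel_measurable borel"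
    using f by auto
  define F where "F = (\<lambda>x. of_real (norm (f x)) * f x)"
  have F: "integrable lborel F"
    by (rule Bochner_Integration.integrable_bound[of _ "\<lambda>x. (norm (f x))\<^sup>2"])
      (use f in \<open>auto simp: F_def square_integrable_def norm_mult power2_eq_square\<close>)
  then have F': "integrable lborel (\<lambda>x. F (x + c))" for c
    using lborel_integrable_real_affine[OF F, of 1 c] by (simp add: add.commute)
  have "(\<lambda>n. (L2_norm (\<lambda>x. f (x + u n) - f x))\<^sup>2) \<longlonglongrightarrow> 0"
  proof (rule tendsto_sandwich[OF _ _ tendsto_const])
    show "(\<lambda>n. 2 * (\<integral>x. norm (F (x + u n) - F x) \<partial>lborel)) \<longlonglongrightarrow> 0"
      using tendsto_mult_left[OF translation_L1[OF F u], of 2] by simp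
    have "(L2_norm (\<lambda>x. f (x + b) - f x))\<^sup>2 \<le> 2 * (\<integral>x. norm (F (x + b) - F x) \<partial>lborel)" for b
    proof -
      have "(L2_norm (\<lambda>x. f (x + b) - f x))\<^sup>2 \<le> (\<integral>x. 2 * norm (F (x + b) - F x) \<partial>lborel)"
        unfolding L2_norm_squared
      proof (rule integral_mono')
        show "integrable lborel (\<lambda>x. 2 * norm (F (x + b) - F x))"
          using F F' by auto
      qed (use norm_diff_squared_le in \<open>auto simp: F_def\<close>)
      then show ?thesis
        by simp
    qed
    then show "\<forall>\<^sub>F n in sequentially. (L2_norm (\<lambda>x. f (x + u n) - f x))\<^sup>2 \<le> 2 * (\<integral>x. norm (F (x + u n) - F x) \<partial>lborel)"
      by simp
  qed simp
  then have "(\<lambda>n. sqrt ((L2_norm (\<lambda>x. f (x + u n) - f x))\<^sup>2)) \<longlonglongrightarrow> sqrt 0"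
    by (rule tendsto_real_sqrt)
  then show ?thesis
    by simp
qed

subsection \<open>The Plancherel identity and the isometry property of the STFT\<close>

lemma nn_integral_lborel_pair:
  fixes h :: "real \<times> real \<Rightarrow> ennreal"
  assumes "h \<in> borel_measurable borel"
  shows "(\<integral>\<^sup>+z. h z \<partial>lborel) = (\<integral>\<^sup>+x. \<integral>\<^sup>+y. h (x, y) \<partial>lborel \<partial>lborel)"
  using lborel.nn_integral_fst[of h "lborel :: real measure"] assms by (simp add: lborel_prod)

lemma nn_integral_lborel_swap:
  fixes h :: "'a::euclidean_space \<Rightarrow> 'b::euclidean_space \<Rightarrow> ennreal"
  assumes "(\<lambda>(x, y). h x y) \<in> borel_measurable (borel \<Otimes>\<^sub>M borel)"
  shows "(\<integral>\<^sup>+x. \<integral>\<^sup>+y. h x y \<partial>lborel \<partial>lborel) = (\<integral>\<^sup>+y. \<integral>\<^sup>+x. h x y \<partial>lborel \<partial>lborel)"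
proof -
  have "sets (borel \<Otimes>\<^sub>M borel) = sets (lborel \<Otimes>\<^sub>M lborel :: ('a \<times> 'b) measure)"
    by (intro sets_pair_measure_cong) auto
  then have "(\<lambda>(x, y). h x y) \<in> borel_measurable (lborel \<Otimes>\<^sub>M lborel)"
    using assms by (simp cong: measurable_cong_sets)
  from lborel_pair.Fubini'[OF this] show ?thesis
    by simp
qed

lemma lborel_Fubini:
  fixes h :: "'a::euclidean_space \<Rightarrow> 'b::euclidean_space \<Rightarrow> complex"
  assumes m: "(\<lambda>(x, y). h x y) \<in> borel_measurable (borel \<Otimes>\<^sub>M borel)"
    and fin: "(\<integral>\<^sup>+x. \<integral>\<^sup>+y. ennreal (norm (h x y)) \<partial>lborel \<partial>lborel) < \<infinity>"
  shows "(\<integral>x. \<integral>y. h x y \<partial>lborel \<partial>lborel) = (\<integral>y. \<integral>x. h x y \<partial>lborel \<partial>lborel)"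
proof -
  have "sets (borel \<Otimes>\<^sub>M borel) = sets (lborel \<Otimes>\<^sub>M lborel :: ('a \<times> 'b) measure)"
    by (intro sets_pair_measure_cong) auto
  then have m': "(\<lambda>(x, y). h x y) \<in> borel_measurable (lborel \<Otimes>\<^sub>M lborel)"
    using m by (simp cong: measurable_cong_sets)
  have "(\<integral>\<^sup>+z. ennreal (norm (case z of (x, y) \<Rightarrow> h x y)) \<partial>(lborel \<Otimes>\<^sub>M lborel))
      = (\<integral>\<^sup>+x. \<integral>\<^sup>+y. ennreal (norm (h x y)) \<partial>lborel \<partial>lborel)"
    using m' by (subst lborel.nn_integral_fst[symmetric]) auto
  with fin m' have int: "integrable (lborel \<Otimes>\<^sub>M lborel) (\<lambda>(x, y). h x y)"
    by (auto intro!: integrableI_bounded)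
  show "(\<integral>x. \<integral>y. h x y \<partial>lborel \<partial>lborel) = (\<integral>y. \<integral>x. h x y \<partial>lborel \<partial>lborel)"
    using lborel_pair.Fubini_integral[OF int] by simp
qed

text \<open>Both are rescalings of the standard normal law and its characteristic function:
  \<open>k\<close> turns the normal density into the Gaussian of the statement, and \<open>t\<close>
  is chosen so that \<open>t * k = 2 * pi * u\<close>.\<close>

lemma
  fixes c :: real
  assumes c: "0 < c"
  shows integrable_gauss: "integrable lborel (\<lambda>\<omega>. exp (- pi * (c * \<omega>)\<^sup>2))"
    and fourier_gauss: "(\<integral>\<omega>. exp (- pi * (c * \<omega>)\<^sup>2) * cis (2 * pi * u * \<omega>) \<partial>lborel)
      = of_real (exp (- pi * (u / c)\<^sup>2) / c)"
proof -
  define k where "k = c * sqrt (2 * pi)"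
  define t where "t = sqrt (2 * pi) * u / c"
  have k: "k \<noteq> 0"
    using c by (simp add: k_def)
  have k2: "(k * \<omega>)\<^sup>2 / 2 = pi * (c * \<omega>)\<^sup>2" for \<omega>
    by (simp add: k_def power_mult_distrib)
  have dens: "std_normal_density (k * \<omega>) = exp (- pi * (c * \<omega>)\<^sup>2) / sqrt (2 * pi)" for \<omega>
    by (simp add: std_normal_density_def k2[symmetric])
  have t2: "t\<^sup>2 / 2 = pi * (u / c)\<^sup>2"
    by (simp add: t_def power_mult_distrib power_divide)
  have tk: "t * (k * \<omega>) = 2 * pi * u * \<omega>" for \<omega>
    using c by (simp add: t_def k_def)
  have "integrable lborel (\<lambda>\<omega>. std_normal_density (0 + k * \<omega>))"
    by (rule lborel_integrable_real_affine[OF _ k]) simp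
  then have "integrable lborel (\<lambda>\<omega>. sqrt (2 * pi) * std_normal_density (k * \<omega>))"
    by simp
  then show "integrable lborel (\<lambda>\<omega>. exp (- pi * (c * \<omega>)\<^sup>2))"
    by (simp add: dens)
  have "exp (- (t\<^sup>2) / 2) = char std_normal_distribution t"
    by (simp add: char_std_normal_distribution)
  also have "\<dots> = (\<integral>x. std_normal_density x *\<^sub>R iexp (t * x) \<partial>lborel)"
    unfolding char_def by (subst integral_density) auto
  also have "\<dots> = \<bar>k\<bar> *\<^sub>R (\<integral>\<omega>. std_normal_density (0 + k * \<omega>) *\<^sub>R iexp (t * (0 + k * \<omega>)) \<partial>lborel)"
    by (rule lborel_integral_real_affine[OF k])
  also have "\<dots> = \<bar>k\<bar> *\<^sub>R (\<integral>\<omega>. (exp (- pi * (c * \<omega>)\<^sup>2) * cis (2 * pi * u * \<omega>)) / of_real (sqrt (2 * pi)) \<partial>lborel)"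
    by (simp add: dens tk cis_conv_exp scaleR_conv_of_real mult.assoc del: of_real_mult)
  also have "\<dots> = of_real c * (\<integral>\<omega>. exp (- pi * (c * \<omega>)\<^sup>2) * cis (2 * pi * u * \<omega>) \<partial>lborel)"
    using c by (simp add: k_def scaleR_conv_of_real del: real_sqrt_mult)
  finally show "(\<integral>\<omega>. exp (- pi * (c * \<omega>)\<^sup>2) * cis (2 * pi * u * \<omega>) \<partial>lborel)
      = of_real (exp (- pi * (u / c)\<^sup>2) / c)"
    using c by (simp add: t2 field_simps)
qed

lemma integral_gauss: "(\<integral>\<omega>. exp (- pi * \<omega>\<^sup>2) \<partial>lborel) = 1"
proof -
  have "complex_of_real (\<integral>\<omega>. exp (- pi * \<omega>\<^sup>2) \<partial>lborel) = 1"
    using fourier_gauss[of 1 0] by simp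
  then show ?thesis
    by (simp only: of_real_eq_1_iff)
qed

text \<open>Fubini moves the Fourier integral from \<open>F\<close> to \<open>h\<close>. The
  constant \<open>a\<close> in the exponent allows both signs of the transform.\<close>

lemma fourier_multiplication_formula:
  fixes F h :: "real \<Rightarrow> complex"
  assumes F: "integrable lborel F" and h: "integrable lborel h"
  shows "(\<integral>\<omega>. (\<integral>t. F t * cis (a * \<omega> * t) \<partial>lborel) * h \<omega> \<partial>lborel)
    = (\<integral>t. F t * (\<integral>\<omega>. h \<omega> * cis (a * \<omega> * t) \<partial>lborel) \<partial>lborel)"
proof -
  have [measurable]: "F \<in> borel_measurable borel" "h \<in> borel_measurable borel"
    using F h by auto
  have "(\<integral>\<omega>. (\<integral>t. F t * cis (a * \<omega> * t) \<partial>lborel) * h \<omega> \<partial>lborel)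
      = (\<integral>\<omega>. \<integral>t. F t * cis (a * \<omega> * t) * h \<omega> \<partial>lborel \<partial>lborel)"
    by simp
  also have "\<dots> = (\<integral>t. \<integral>\<omega>. F t * cis (a * \<omega> * t) * h \<omega> \<partial>lborel \<partial>lborel)"
  proof (rule lborel_Fubini)
    have "(\<integral>\<^sup>+\<omega>. \<integral>\<^sup>+t. ennreal (norm (F t * cis (a * \<omega> * t) * h \<omega>)) \<partial>lborel \<partial>lborel)
        = (\<integral>\<^sup>+t. ennreal (norm (F t)) \<partial>lborel) * (\<integral>\<^sup>+\<omega>. ennreal (norm (h \<omega>)) \<partial>lborel)"
      by (simp add: norm_mult ennreal_mult nn_integral_multc nn_integral_cmult)
    also have "\<dots> < \<infinity>"
      using F h by (simp add: integrable_iff_bounded ennreal_mult_less_top)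
    finally show "(\<integral>\<^sup>+\<omega>. \<integral>\<^sup>+t. ennreal (norm (F t * cis (a * \<omega> * t) * h \<omega>)) \<partial>lborel \<partial>lborel) < \<infinity>" .
  qed measurable
  also have "\<dots> = (\<integral>t. F t * (\<integral>\<omega>. h \<omega> * cis (a * \<omega> * t) \<partial>lborel) \<partial>lborel)"
    by (simp add: mult.assoc mult.commute[of "cis _" "h _"])
  finally show ?thesis .
qed

text \<open>By Cauchy-Schwarz the deviation is at most the norm of \<open>F\<close> times the L2
  distance of \<open>F\<close> to its translate.\<close>

lemma tendsto_autocorrelation:
  assumes F: "square_integrable F" and u: "u \<longlonglongrightarrow> (0::real)"
  shows "(\<lambda>n. \<integral>t. F t * cnj (F (t + u n)) \<partial>lborel) \<longlonglongrightarrow> of_real ((L2_norm F)\<^sup>2)"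
proof (rule LIM_zero_cancel, rule tendsto_0_le[of _ _ _ "L2_norm F"])
  show "(\<lambda>n. L2_norm (\<lambda>t. F (t + u n) - F t)) \<longlonglongrightarrow> 0"
    by (rule translation_L2[OF F u])
  have shift: "square_integrable (\<lambda>t. F (t + b))" for b
    using square_integrable_tf_shift[OF F, of "(-b, 0)"] by (simp add: tf_shift_def[abs_def])
  have "norm ((\<integral>t. F t * cnj (F (t + b)) \<partial>lborel) - of_real ((L2_norm F)\<^sup>2))
      \<le> L2_norm (\<lambda>t. F (t + b) - F t) * L2_norm F" for b
  proof -
    have "of_real ((L2_norm F)\<^sup>2) = (\<integral>t. F t * cnj (F t) \<partial>lborel)"
      by (simp add: L2_norm_squared complex_norm_square[symmetric] flip: of_real_power)
    then have "(\<integral>t. F t * cnj (F (t + b)) \<partial>lborel) - of_real ((L2_norm F)\<^sup>2)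
        = (\<integral>t. F t * cnj (F (t + b) - F t) \<partial>lborel)"
      using integrable_mult_square_integrable[OF F square_integrable_cnj[OF F]]
        integrable_mult_square_integrable[OF F square_integrable_cnj[OF shift]]
      by (simp add: right_diff_distrib)
    then show ?thesis
      using norm_L2_inner_le[OF F square_integrable_diff[OF shift F], of b]
      by (simp add: L2_inner_def mult.commute)
  qed
  then show "\<forall>\<^sub>F n in sequentially. norm ((\<integral>t. F t * cnj (F (t + u n)) \<partial>lborel) - of_real ((L2_norm F)\<^sup>2))
      \<le> norm (L2_norm (\<lambda>t. F (t + u n) - F t)) * L2_norm F"
    by simp
qed

text \<open>Damping the Fourier transform by a Gaussian makes all integrals absolutely convergent and turns
  its energy into an average of the autocorrelation of \<open>F\<close> over shifts of size \<open>e\<close>.\<close>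

lemma plancherel_damped:
  fixes F :: "real \<Rightarrow> complex"
  assumes F: "integrable lborel F" "square_integrable F" and e: "0 < e"
  shows "(\<integral>\<omega>. of_real ((norm (\<integral>t. F t * cis (- 2 * pi * \<omega> * t) \<partial>lborel))\<^sup>2 * exp (- pi * (e * \<omega>)\<^sup>2)) \<partial>lborel)
    = (\<integral>u. exp (- pi * u\<^sup>2) * (\<integral>t. F t * cnj (F (t + e * u)) \<partial>lborel) \<partial>lborel)"
proof -
  have [measurable]: "F \<in> borel_measurable borel"
    using F by auto
  define Fh where "Fh \<omega> = (\<integral>t. F t * cis (- 2 * pi * \<omega> * t) \<partial>lborel)" for \<omega>
  define E where "E \<omega> = exp (- pi * (e * \<omega>)\<^sup>2)" for \<omega>
  have [measurable]: "Fh \<in> borel_measurable borel"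
    unfolding Fh_def[abs_def] by (rule borel_measurable_lborel_integral) measurable
  have [measurable]: "E \<in> borel_measurable borel"
    unfolding E_def[abs_def] by measurable
  have E: "integrable lborel E"
    unfolding E_def[abs_def] by (rule integrable_gauss[OF e])
  have Fh_cnj: "cnj (Fh \<omega>) = (\<integral>s. cnj (F s) * cis (2 * pi * \<omega> * s) \<partial>lborel)" for \<omega>
  proof -
    have "cnj (Fh \<omega>) = (\<integral>t. cnj (F t * cis (- 2 * pi * \<omega> * t)) \<partial>lborel)"
      unfolding Fh_def by (rule Bochner_Integration.integral_cnj[symmetric])
    then show ?thesis
      by (simp only: complex_cnj_mult cis_cnj) simp
  qed
  have bound: "norm (Fh \<omega>) \<le> (\<integral>t. norm (F t) \<partial>lborel)" for \<omega>
    unfolding Fh_def by (rule order_trans[OF integral_norm_bound]) (simp add: norm_mult)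
  have int1: "integrable lborel (\<lambda>\<omega>. cnj (Fh \<omega>) * E \<omega>)"
  proof (rule Bochner_Integration.integrable_bound)
    show "integrable lborel (\<lambda>\<omega>. (\<integral>t. norm (F t) \<partial>lborel) * E \<omega>)"
      using E by simp
    show "AE \<omega> in lborel. norm (cnj (Fh \<omega>) * E \<omega>) \<le> norm ((\<integral>t. norm (F t) \<partial>lborel) * E \<omega>)"
      using bound by (intro AE_I2) (auto simp: norm_mult E_def intro!: mult_right_mono)
  qed measurable
  have "(\<integral>\<omega>. of_real ((norm (Fh \<omega>))\<^sup>2 * E \<omega>) \<partial>lborel) = (\<integral>\<omega>. Fh \<omega> * (cnj (Fh \<omega>) * E \<omega>) \<partial>lborel)"
    by (simp only: of_real_mult complex_norm_square mult.assoc)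
  also have "\<dots> = (\<integral>t. F t * (\<integral>\<omega>. cnj (Fh \<omega>) * E \<omega> * cis (- 2 * pi * \<omega> * t) \<partial>lborel) \<partial>lborel)"
    using fourier_multiplication_formula[OF F(1) int1, of "- 2 * pi"] by (simp add: Fh_def)
  also have "\<dots> = (\<integral>t. F t * (\<integral>u. cnj (F (t + e * u)) * exp (- pi * u\<^sup>2) \<partial>lborel) \<partial>lborel)"
  proof (rule Bochner_Integration.integral_cong[OF refl], rule arg_cong2[where f = "(*)", OF refl])
    fix t
    \<comment> \<open>A second transfer, of the transform inside \<open>cnj (Fh \<omega>)\<close>
      onto a modulated Gaussian. This yields a Gaussian kernel of width \<open>e\<close> centred at
      \<open>t\<close>, and the substitution \<open>s = t + e * u\<close> absorbs the factor
      \<open>1 / e\<close>.\<close>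
    have "integrable lborel (\<lambda>\<omega>. of_real (E \<omega>) * cis (- 2 * pi * \<omega> * t))"
      by (rule Bochner_Integration.integrable_bound[OF E]) (auto simp: norm_mult)
    then have "(\<integral>\<omega>. cnj (Fh \<omega>) * (E \<omega> * cis (- 2 * pi * \<omega> * t)) \<partial>lborel)
        = (\<integral>s. cnj (F s) * (\<integral>\<omega>. E \<omega> * cis (- 2 * pi * \<omega> * t) * cis (2 * pi * \<omega> * s) \<partial>lborel) \<partial>lborel)"
      unfolding Fh_cnj using F(1) by (intro fourier_multiplication_formula) auto
    also have "\<dots> = (\<integral>s. cnj (F s) * of_real (exp (- pi * ((s - t) / e)\<^sup>2) / e) \<partial>lborel)"
    proof (rule Bochner_Integration.integral_cong[OF refl], rule arg_cong2[where f = "(*)", OF refl])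
      fix s
      show "(\<integral>\<omega>. E \<omega> * cis (- 2 * pi * \<omega> * t) * cis (2 * pi * \<omega> * s) \<partial>lborel)
          = of_real (exp (- pi * ((s - t) / e)\<^sup>2) / e)"
        unfolding fourier_gauss[OF e, of "s - t", symmetric]
        by (intro Bochner_Integration.integral_cong) (auto simp: E_def mult.assoc cis_mult algebra_simps)
    qed
    also have "\<dots> = (\<integral>u. cnj (F (t + e * u)) * exp (- pi * u\<^sup>2) \<partial>lborel)"
      using e by (subst lborel_integral_real_affine[of e _ t]) (auto simp: scaleR_conv_of_real)
    finally show "(\<integral>\<omega>. cnj (Fh \<omega>) * E \<omega> * cis (- 2 * pi * \<omega> * t) \<partial>lborel)
        = (\<integral>u. cnj (F (t + e * u)) * exp (- pi * u\<^sup>2) \<partial>lborel)"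
      by (simp add: mult.assoc)
  qed
  also have "\<dots> = (\<integral>t. \<integral>u. exp (- pi * u\<^sup>2) * (F t * cnj (F (t + e * u))) \<partial>lborel \<partial>lborel)"
    by (simp add: mult_ac flip: integral_mult_right_zero)
  also have "\<dots> = (\<integral>u. \<integral>t. exp (- pi * u\<^sup>2) * (F t * cnj (F (t + e * u))) \<partial>lborel \<partial>lborel)"
  proof (rule lborel_Fubini[symmetric])
    have shift: "square_integrable (\<lambda>t. F (t + b))" "L2_norm (\<lambda>t. F (t + b)) = L2_norm F" for b
      using square_integrable_tf_shift[OF F(2), of "(-b, 0)"] L2_norm_tf_shift[OF F(2), of "(-b, 0)"]
      by (simp_all add: tf_shift_def[abs_def])
    have "(\<integral>\<^sup>+t. ennreal (norm (exp (- pi * u\<^sup>2) * (F t * cnj (F (t + e * u))))) \<partial>lborel)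
        \<le> ennreal (exp (- pi * u\<^sup>2)) * ennreal (L2_norm F * L2_norm F)" for u
    proof -
      have "(\<integral>\<^sup>+t. ennreal (norm (exp (- pi * u\<^sup>2) * (F t * cnj (F (t + e * u))))) \<partial>lborel)
          = ennreal (exp (- pi * u\<^sup>2)) * (\<integral>\<^sup>+t. ennreal (norm (F t) * norm (F (t + e * u))) \<partial>lborel)"
        by (simp add: norm_mult ennreal_mult nn_integral_cmult flip: exp_of_real)
      also have "\<dots> \<le> ennreal (exp (- pi * u\<^sup>2)) * ennreal (L2_norm F * L2_norm F)"
        using nn_integral_mult_le_L2_norm[OF F(2) shift(1), of "e * u"]
        by (intro mult_left_mono) (auto simp: shift(2))
      finally show ?thesis .
    qed
    then have "(\<integral>\<^sup>+u. \<integral>\<^sup>+t. ennreal (norm (exp (- pi * u\<^sup>2) * (F t * cnj (F (t + e * u))))) \<partial>lborel \<partial>lborel)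
        \<le> (\<integral>\<^sup>+u. ennreal (exp (- pi * u\<^sup>2)) * ennreal (L2_norm F * L2_norm F) \<partial>lborel)"
      by (intro nn_integral_mono) auto
    also have "\<dots> < \<infinity>"
      using integrable_gauss[of 1]
      by (simp add: nn_integral_multc integrable_iff_bounded ennreal_mult_less_top)
    finally show "(\<integral>\<^sup>+u. \<integral>\<^sup>+t. ennreal (norm (exp (- pi * u\<^sup>2) * (F t * cnj (F (t + e * u))))) \<partial>lborel \<partial>lborel) < \<infinity>" .
  qed measurable
  finally show ?thesis
    by (simp add: Fh_def E_def)
qed

text \<open>The damping is removed along \<open>e n = 1 / (n + 1)\<close>. The autocorrelation side
  converges by domination, the Fourier side by monotone convergence since weaker damping means
  larger weights. The equality thus holds in \<open>ennreal\<close> without knowing in advance that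
  the transform is square integrable.\<close>

lemma plancherel:
  fixes F :: "real \<Rightarrow> complex"
  assumes F: "integrable lborel F" "square_integrable F"
  shows "(\<integral>\<^sup>+\<omega>. ennreal ((norm (\<integral>t. F t * cis (- 2 * pi * \<omega> * t) \<partial>lborel))\<^sup>2) \<partial>lborel)
    = ennreal ((L2_norm F)\<^sup>2)"
proof -
  have [measurable]: "F \<in> borel_measurable borel"
    using F by auto
  define Fh where "Fh \<omega> = (\<integral>t. F t * cis (- 2 * pi * \<omega> * t) \<partial>lborel)" for \<omega>
  define e where "e n = 1 / real (Suc n)" for n
  have e: "0 < e n" for n
    by (simp add: e_def)
  have e0: "e \<longlonglongrightarrow> 0"
    unfolding e_def[abs_def] by (rule lim_1_over_n[THEN LIMSEQ_Suc])
  have [measurable]: "Fh \<in> borel_measurable borel"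
    unfolding Fh_def[abs_def] by (rule borel_measurable_lborel_integral) measurable
  have bound: "norm (Fh \<omega>) \<le> (\<integral>t. norm (F t) \<partial>lborel)" for \<omega>
    unfolding Fh_def by (rule order_trans[OF integral_norm_bound]) (simp add: norm_mult)
  define I where "I n = (\<integral>\<omega>. (norm (Fh \<omega>))\<^sup>2 * exp (- pi * (e n * \<omega>)\<^sup>2) \<partial>lborel)" for n
  have int: "integrable lborel (\<lambda>\<omega>. (norm (Fh \<omega>))\<^sup>2 * exp (- pi * (e n * \<omega>)\<^sup>2))" for n
    by (rule Bochner_Integration.integrable_bound[of _ "\<lambda>\<omega>. (\<integral>t. norm (F t) \<partial>lborel)\<^sup>2 * exp (- pi * (e n * \<omega>)\<^sup>2)"])
      (use integrable_gauss[OF e, of n] bound in \<open>auto intro!: mult_right_mono power_mono\<close>)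
  have "(\<lambda>n. complex_of_real (I n)) \<longlonglongrightarrow> (\<integral>u. complex_of_real (exp (- pi * u\<^sup>2)) * of_real ((L2_norm F)\<^sup>2) \<partial>lborel)"
  proof -
    have shift: "square_integrable (\<lambda>t. F (t + b))" "L2_norm (\<lambda>t. F (t + b)) = L2_norm F" for b
      using square_integrable_tf_shift[OF F(2), of "(-b, 0)"] L2_norm_tf_shift[OF F(2), of "(-b, 0)"]
      by (simp_all add: tf_shift_def[abs_def])
    have "(\<lambda>n. \<integral>u. exp (- pi * u\<^sup>2) * (\<integral>t. F t * cnj (F (t + e n * u)) \<partial>lborel) \<partial>lborel)
        \<longlonglongrightarrow> (\<integral>u. complex_of_real (exp (- pi * u\<^sup>2)) * of_real ((L2_norm F)\<^sup>2) \<partial>lborel)"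
    proof (rule integral_dominated_convergence[where w = "\<lambda>u. exp (- pi * u\<^sup>2) * (L2_norm F)\<^sup>2"])
      show "integrable lborel (\<lambda>u. exp (- pi * u\<^sup>2) * (L2_norm F)\<^sup>2)"
        using integrable_gauss[of 1] by simp
      show "(\<lambda>u. exp (- pi * u\<^sup>2) * (\<integral>t. F t * cnj (F (t + e n * u)) \<partial>lborel)) \<in> borel_measurable lborel" for n
      proof -
        have [measurable]: "(\<lambda>u. \<integral>t. F t * cnj (F (t + e n * u)) \<partial>lborel) \<in> borel_measurable borel"
          by (rule borel_measurable_lborel_integral) measurable
        show ?thesis
          by measurable
      qed
      show "AE u in lborel. (\<lambda>n. exp (- pi * u\<^sup>2) * (\<integral>t. F t * cnj (F (t + e n * u)) \<partial>lborel))
          \<longlonglongrightarrow> complex_of_real (exp (- pi * u\<^sup>2)) * of_real ((L2_norm F)\<^sup>2)"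
        by (intro AE_I2 tendsto_mult[OF tendsto_const] tendsto_autocorrelation F tendsto_mult_left_zero e0)
      show "AE u in lborel. norm (exp (- pi * u\<^sup>2) * (\<integral>t. F t * cnj (F (t + e n * u)) \<partial>lborel))
          \<le> exp (- pi * u\<^sup>2) * (L2_norm F)\<^sup>2" for n
        using norm_L2_inner_le[OF F(2) shift(1)] 
        by (intro AE_I2) (simp add: norm_mult L2_inner_def shift(2) power2_eq_square flip: exp_of_real)
    qed measurable
    moreover have "complex_of_real (I n) = (\<integral>u. exp (- pi * u\<^sup>2) * (\<integral>t. F t * cnj (F (t + e n * u)) \<partial>lborel) \<partial>lborel)" for n
      using plancherel_damped[OF F e[of n]] unfolding I_def Fh_def by (simp only: integral_complex_of_real)
    ultimately show ?thesis
      by simp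
  qed
  also have "(\<integral>u. complex_of_real (exp (- pi * u\<^sup>2)) * of_real ((L2_norm F)\<^sup>2) \<partial>lborel) = complex_of_real ((L2_norm F)\<^sup>2)"
  proof -
    have "(\<integral>u. complex_of_real (exp (- pi * u\<^sup>2)) \<partial>lborel) = 1"
      using integral_gauss by (simp only: integral_complex_of_real of_real_1)
    then show ?thesis
      by (simp del: of_real_power)
  qed
  finally have "I \<longlonglongrightarrow> (L2_norm F)\<^sup>2"
    by (simp only: tendsto_of_real_iff)
  then have lim1: "(\<lambda>n. ennreal (I n)) \<longlonglongrightarrow> ennreal ((L2_norm F)\<^sup>2)"
    by (rule tendsto_ennrealI)
  have "(\<lambda>n. \<integral>\<^sup>+\<omega>. ennreal ((norm (Fh \<omega>))\<^sup>2 * exp (- pi * (e n * \<omega>)\<^sup>2)) \<partial>lborel)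
      \<longlonglongrightarrow> (\<integral>\<^sup>+\<omega>. ennreal ((norm (Fh \<omega>))\<^sup>2) \<partial>lborel)"
  proof (rule nn_integral_LIMSEQ)
    show "incseq (\<lambda>n \<omega>. ennreal ((norm (Fh \<omega>))\<^sup>2 * exp (- pi * (e n * \<omega>)\<^sup>2)))"
    proof (intro incseq_SucI le_funI ennreal_leI mult_left_mono)
      fix n \<omega>
      have "(e (Suc n) * \<omega>)\<^sup>2 \<le> (e n * \<omega>)\<^sup>2"
        unfolding power_mult_distrib by (intro mult_right_mono power_mono) (auto simp: e_def field_simps)
      then show "exp (- pi * (e n * \<omega>)\<^sup>2) \<le> exp (- pi * (e (Suc n) * \<omega>)\<^sup>2)"
        by simp
    qed simp
    fix \<omega>
    have "(\<lambda>n. (norm (Fh \<omega>))\<^sup>2 * exp (- pi * (e n * \<omega>)\<^sup>2)) \<longlonglongrightarrow> (norm (Fh \<omega>))\<^sup>2 * exp (- pi * (0 * \<omega>)\<^sup>2)"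
      by (intro tendsto_intros e0)
    then show "(\<lambda>n. ennreal ((norm (Fh \<omega>))\<^sup>2 * exp (- pi * (e n * \<omega>)\<^sup>2))) \<longlonglongrightarrow> ennreal ((norm (Fh \<omega>))\<^sup>2)"
      by (intro tendsto_ennrealI) simp
  qed measurable
  moreover have "(\<integral>\<^sup>+\<omega>. ennreal ((norm (Fh \<omega>))\<^sup>2 * exp (- pi * (e n * \<omega>)\<^sup>2)) \<partial>lborel) = ennreal (I n)" for n
    unfolding I_def by (rule nn_integral_eq_integral[OF int]) auto
  ultimately have "(\<lambda>n. ennreal (I n)) \<longlonglongrightarrow> (\<integral>\<^sup>+\<omega>. ennreal ((norm (Fh \<omega>))\<^sup>2) \<partial>lborel)"
    by simp
  from LIMSEQ_unique[OF this lim1] show ?thesis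
    by (simp add: Fh_def)
qed

lemma STFT_fourier:
  "STFT \<phi> f (x, \<omega>) = (\<integral>t. f t * cnj (\<phi> (t - x)) * cis (- 2 * pi * \<omega> * t) \<partial>lborel)"
  by (simp add: STFT_def L2_inner_def tf_shift_cis cis_cnj mult_ac)

text \<open>For fixed \<open>x\<close> the STFT is the Fourier transform in \<omega> of
  \<open>f\<close> times the conjugate of the translated window, so Plancherel applies on each line;
  Tonelli and translation invariance evaluate the remaining double integral.\<close>

lemma STFT_isometry:
  assumes \<phi>: "square_integrable \<phi>" and f: "square_integrable f"
  shows "(\<integral>\<^sup>+z. ennreal ((norm (STFT \<phi> f z))\<^sup>2) \<partial>lborel) = ennreal ((L2_norm f)\<^sup>2 * (L2_norm \<phi>)\<^sup>2)"
proof -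
  have [measurable]: "\<phi> \<in> borel_measurable borel" "f \<in> borel_measurable borel"
    using \<phi> f by auto
  define F where "F x t = f t * cnj (\<phi> (t - x))" for x t
  have shift: "square_integrable (\<lambda>t. \<phi> (t - x))" for x
    using square_integrable_tf_shift[OF \<phi>, of "(x, 0)"] by (simp add: tf_shift_def[abs_def])
  have int: "integrable lborel (F x)" for x
    unfolding F_def[abs_def] by (rule integrable_mult_square_integrable[OF f square_integrable_cnj[OF shift]])
  have tot: "(\<integral>\<^sup>+x. \<integral>\<^sup>+t. ennreal ((norm (F x t))\<^sup>2) \<partial>lborel \<partial>lborel) = ennreal ((L2_norm f)\<^sup>2 * (L2_norm \<phi>)\<^sup>2)"
  proof -
    have "(\<integral>\<^sup>+x. \<integral>\<^sup>+t. ennreal ((norm (F x t))\<^sup>2) \<partial>lborel \<partial>lborel)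
        = (\<integral>\<^sup>+t. \<integral>\<^sup>+x. ennreal ((norm (F x t))\<^sup>2) \<partial>lborel \<partial>lborel)"
      unfolding F_def by (rule nn_integral_lborel_swap) measurable
    also have "\<dots> = (\<integral>\<^sup>+t. ennreal ((norm (f t))\<^sup>2) * (\<integral>\<^sup>+x. ennreal ((norm (\<phi> (t - x)))\<^sup>2) \<partial>lborel) \<partial>lborel)"
      by (simp add: F_def norm_mult power_mult_distrib ennreal_mult nn_integral_cmult)
    also have "\<dots> = (\<integral>\<^sup>+t. ennreal ((norm (f t))\<^sup>2) * ennreal ((L2_norm \<phi>)\<^sup>2) \<partial>lborel)"
      using nn_integral_real_affine[of "\<lambda>x. ennreal ((norm (\<phi> x))\<^sup>2)" "-1"] nn_integral_square[OF \<phi>]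
      by simp
    finally show ?thesis
      using nn_integral_square[OF f] by (simp add: nn_integral_multc ennreal_mult)
  qed
  \<comment> \<open>A product of two L2 functions is always integrable but need not be square
    integrable; finiteness of the total \<open>tot\<close> gives this for almost every
    \<open>x\<close>, the second hypothesis of Plancherel.\<close>
  have "AE x in lborel. (\<integral>\<^sup>+t. ennreal ((norm (F x t))\<^sup>2) \<partial>lborel) \<noteq> \<infinity>"
  proof (rule nn_integral_noteq_infinite)
    show "(\<lambda>x. \<integral>\<^sup>+t. ennreal ((norm (F x t))\<^sup>2) \<partial>lborel) \<in> borel_measurable lborel"
      unfolding F_def by measurable
  qed (simp add: tot)
  then have ae: "AE x in lborel. (\<integral>\<^sup>+\<omega>. ennreal ((norm (STFT \<phi> f (x, \<omega>)))\<^sup>2) \<partial>lborel)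
      = (\<integral>\<^sup>+t. ennreal ((norm (F x t))\<^sup>2) \<partial>lborel)"
  proof eventually_elim
    case (elim x)
    have F: "square_integrable (F x)"
      using elim by (auto simp: square_integrable_def F_def[abs_def] less_top intro!: integrableI_bounded)
    show ?case
      using plancherel[OF int F] unfolding nn_integral_square[OF F] by (simp add: STFT_fourier F_def)
  qed
  have "(\<integral>\<^sup>+z. ennreal ((norm (STFT \<phi> f z))\<^sup>2) \<partial>lborel)
      = (\<integral>\<^sup>+x. \<integral>\<^sup>+\<omega>. ennreal ((norm (STFT \<phi> f (x, \<omega>)))\<^sup>2) \<partial>lborel \<partial>lborel)"
    by (rule nn_integral_lborel_pair) measurable
  also have "\<dots> = (\<integral>\<^sup>+x. \<integral>\<^sup>+t. ennreal ((norm (F x t))\<^sup>2) \<partial>lborel \<partial>lborel)"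
    by (rule nn_integral_cong_AE[OF ae])
  finally show ?thesis
    using tot by simp
qed

subsection \<open>Averages of time-frequency shifts\<close>

text \<open>Cauchy-Schwarz after splitting \<open>norm W\<close> into two square roots; for a weight
  of mass 1 this is Jensen's inequality. If the product is not integrable, the Bochner integral is 0
  and the bound is trivial.\<close>

lemma norm_integral_mult_squared_le:
  fixes W X :: "'a \<Rightarrow> complex"
  assumes [measurable]: "W \<in> borel_measurable M" "X \<in> borel_measurable M"
  shows "ennreal ((norm (\<integral>x. W x * X x \<partial>M))\<^sup>2)
    \<le> (\<integral>\<^sup>+x. ennreal (norm (W x)) \<partial>M) * (\<integral>\<^sup>+x. ennreal (norm (W x) * (norm (X x))\<^sup>2) \<partial>M)"
proof (cases "integrable M (\<lambda>x. W x * X x)")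
  case True
  have "ennreal (norm (\<integral>x. W x * X x \<partial>M)) \<le> (\<integral>\<^sup>+x. ennreal (norm (W x * X x)) \<partial>M)"
    using True by (rule integral_norm_bound_ennreal)
  also have "\<dots> = (\<integral>\<^sup>+x. ennreal (sqrt (norm (W x))) * ennreal (sqrt (norm (W x)) * norm (X x)) \<partial>M)"
    by (intro nn_integral_cong) (simp add: norm_mult flip: ennreal_mult mult.assoc)
  finally have "(ennreal (norm (\<integral>x. W x * X x \<partial>M)))\<^sup>2
      \<le> (\<integral>\<^sup>+x. ennreal (sqrt (norm (W x))) * ennreal (sqrt (norm (W x)) * norm (X x)) \<partial>M)\<^sup>2"
    by (intro power_mono) auto
  also have "\<dots> \<le> (\<integral>\<^sup>+x. (ennreal (sqrt (norm (W x))))\<^sup>2 \<partial>M)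
      * (\<integral>\<^sup>+x. (ennreal (sqrt (norm (W x)) * norm (X x)))\<^sup>2 \<partial>M)"
    by (rule Cauchy_Schwarz_nn_integral) auto
  finally show ?thesis
    by (simp add: ennreal_power power_mult_distrib)
qed (simp add: not_integrable_integral_eq)

text \<open>The common form of \<open>loc_op\<close>, with weight
  \<open>STFT \<phi> f z * of_real (m z)\<close>, and of the localizers, whose weight is a density
  times a character.\<close>

definition tf_average :: "(real \<times> real \<Rightarrow> complex) \<Rightarrow> (real \<Rightarrow> complex) \<Rightarrow> real \<Rightarrow> complex" where
  "tf_average W \<psi> t = (\<integral>z. W z * tf_shift z \<psi> t \<partial>lborel)"

lemma loc_op_tf_average: "loc_op m \<phi> f = tf_average (\<lambda>z. STFT \<phi> f z * of_real (m z)) \<phi>"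
  by (simp add: loc_op_def[abs_def] tf_average_def[abs_def])

lemma measurable_tf_shift [measurable (raw)]:
  assumes [measurable]: "\<psi> \<in> borel_measurable borel" and f: "f \<in> borel_measurable M"
    and [measurable]: "h \<in> borel_measurable M"
  shows "(\<lambda>x. tf_shift (f x) \<psi> (h x)) \<in> borel_measurable M"
proof -
  have [measurable]: "(\<lambda>x. fst (f x)) \<in> borel_measurable M" "(\<lambda>x. snd (f x)) \<in> borel_measurable M"
    using f by (auto simp: borel_prod[symmetric])
  show ?thesis
    unfolding tf_shift_cis by measurable
qed

context
  fixes W :: "real \<times> real \<Rightarrow> complex" and \<psi> :: "real \<Rightarrow> complex"
  assumes W: "integrable lborel W" and \<psi>: "square_integrable \<psi>"
begin

text \<open>Weighted Cauchy-Schwarz for each \<open>t\<close>, then Tonelli: every shift of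
  \<open>\<psi>\<close> has the same norm, so the squared norm is at most that of
  \<open>\<psi>\<close> times the square of the L1 norm of \<open>W\<close>.\<close>

lemma square_integrable_tf_average: "square_integrable (tf_average W \<psi>)"
proof -
  have [measurable]: "W \<in> borel_measurable borel" "\<psi> \<in> borel_measurable borel"
    using W \<psi> by auto
  have fin: "(\<integral>\<^sup>+z. ennreal (norm (W z)) \<partial>lborel) < \<infinity>"
    using W by (simp add: integrable_iff_bounded)
  have m: "tf_average W \<psi> \<in> borel_measurable borel"
    unfolding tf_average_def[abs_def] by (rule borel_measurable_lborel_integral) measurable
  have "(\<integral>\<^sup>+t. ennreal ((norm (tf_average W \<psi> t))\<^sup>2) \<partial>lborel)
      \<le> (\<integral>\<^sup>+t. (\<integral>\<^sup>+z. ennreal (norm (W z)) \<partial>lborel)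
        * (\<integral>\<^sup>+z. ennreal (norm (W z) * (norm (tf_shift z \<psi> t))\<^sup>2) \<partial>lborel) \<partial>lborel)"
    unfolding tf_average_def by (intro nn_integral_mono norm_integral_mult_squared_le) auto
  also have "\<dots> = (\<integral>\<^sup>+z. ennreal (norm (W z)) \<partial>lborel)
      * (\<integral>\<^sup>+t. \<integral>\<^sup>+z. ennreal (norm (W z) * (norm (tf_shift z \<psi> t))\<^sup>2) \<partial>lborel \<partial>lborel)"
    by (intro nn_integral_cmult) measurable
  also have "(\<integral>\<^sup>+t. \<integral>\<^sup>+z. ennreal (norm (W z) * (norm (tf_shift z \<psi> t))\<^sup>2) \<partial>lborel \<partial>lborel)
      = (\<integral>\<^sup>+z. \<integral>\<^sup>+t. ennreal (norm (W z) * (norm (tf_shift z \<psi> t))\<^sup>2) \<partial>lborel \<partial>lborel)"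
    by (rule nn_integral_lborel_swap) measurable
  also have "\<dots> = (\<integral>\<^sup>+z. ennreal (norm (W z)) * ennreal ((L2_norm \<psi>)\<^sup>2) \<partial>lborel)"
    using nn_integral_square[OF square_integrable_tf_shift[OF \<psi>]]
    by (simp add: ennreal_mult nn_integral_cmult L2_norm_tf_shift \<psi>)
  finally have le: "(\<integral>\<^sup>+t. ennreal ((norm (tf_average W \<psi> t))\<^sup>2) \<partial>lborel)
      \<le> (\<integral>\<^sup>+z. ennreal (norm (W z)) \<partial>lborel) * (\<integral>\<^sup>+z. ennreal (norm (W z)) * ennreal ((L2_norm \<psi>)\<^sup>2) \<partial>lborel)" .
  have "(\<integral>\<^sup>+t. ennreal ((norm (tf_average W \<psi> t))\<^sup>2) \<partial>lborel) < \<infinity>"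
    by (rule order.strict_trans1[OF le]) (use fin in \<open>simp add: nn_integral_multc ennreal_mult_less_top\<close>)
  with m show ?thesis
    by (auto simp: square_integrable_def intro!: integrableI_bounded)
qed

lemma L2_inner_tf_average:
  assumes h: "square_integrable h"
  shows "L2_inner (tf_average W \<psi>) h = (\<integral>z. W z * L2_inner (tf_shift z \<psi>) h \<partial>lborel)"
proof -
  have [measurable]: "W \<in> borel_measurable borel" "\<psi> \<in> borel_measurable borel" "h \<in> borel_measurable borel"
    using W \<psi> h by auto
  have "L2_inner (tf_average W \<psi>) h = (\<integral>t. \<integral>z. W z * (tf_shift z \<psi> t * cnj (h t)) \<partial>lborel \<partial>lborel)"
    by (simp add: L2_inner_def tf_average_def mult.assoc flip: integral_mult_left_zero)
  also have "\<dots> = (\<integral>z. \<integral>t. W z * (tf_shift z \<psi> t * cnj (h t)) \<partial>lborel \<partial>lborel)"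
  proof (rule lborel_Fubini[symmetric])
    have "(\<integral>\<^sup>+z. \<integral>\<^sup>+t. ennreal (norm (W z * (tf_shift z \<psi> t * cnj (h t)))) \<partial>lborel \<partial>lborel)
        = (\<integral>\<^sup>+z. ennreal (norm (W z)) * (\<integral>\<^sup>+t. ennreal (norm (tf_shift z \<psi> t) * norm (h t)) \<partial>lborel) \<partial>lborel)"
      by (simp add: norm_mult ennreal_mult nn_integral_cmult)
    also have "\<dots> \<le> (\<integral>\<^sup>+z. ennreal (norm (W z)) * ennreal (L2_norm \<psi> * L2_norm h) \<partial>lborel)"
      using nn_integral_mult_le_L2_norm[OF square_integrable_tf_shift[OF \<psi>] h]
      by (intro nn_integral_mono mult_left_mono) (auto simp: L2_norm_tf_shift \<psi>)
    also have "\<dots> < \<infinity>"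
      using W by (simp add: nn_integral_multc integrable_iff_bounded ennreal_mult_less_top)
    finally show "(\<integral>\<^sup>+z. \<integral>\<^sup>+t. ennreal (norm (W z * (tf_shift z \<psi> t * cnj (h t)))) \<partial>lborel \<partial>lborel) < \<infinity>" .
  qed measurable
  finally show ?thesis
    by (simp add: L2_inner_def)
qed

end

section \<open>The STFT as a map into L2 of the plane, and the weak form of localization
  operators\<close>

lemma
  assumes \<phi>: "square_integrable \<phi>" and f: "square_integrable f"
  shows square_integrable_STFT: "square_integrable (STFT \<phi> f)"
    and L2_norm_STFT: "L2_norm (STFT \<phi> f) = L2_norm f * L2_norm \<phi>"
proof -
  have m: "STFT \<phi> f \<in> borel_measurable borel"
    using \<phi> f by measurable
  show s: "square_integrable (STFT \<phi> f)"
    by (rule square_integrableI(1)[OF m _ eq_refl[OF STFT_isometry[OF \<phi> f]]]) simp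
  have "ennreal ((L2_norm (STFT \<phi> f))\<^sup>2) = ennreal ((L2_norm f * L2_norm \<phi>)\<^sup>2)"
    using nn_integral_square[OF s] STFT_isometry[OF \<phi> f] by (simp add: power_mult_distrib)
  then show "L2_norm (STFT \<phi> f) = L2_norm f * L2_norm \<phi>"
    by simp
qed

lemma L2_inner_cnj: "cnj (L2_inner f g) = L2_inner g f"
proof -
  have "cnj (L2_inner f g) = (\<integral>t. cnj (f t * cnj (g t)) \<partial>lborel)"
    unfolding L2_inner_def by (rule Bochner_Integration.integral_cnj[symmetric])
  then show ?thesis
    by (simp add: L2_inner_def mult.commute)
qed

lemma L2_inner_self: "L2_inner f f = of_real ((L2_norm f)\<^sup>2)"
  unfolding L2_inner_def L2_norm_squared complex_norm_square[symmetric] by (rule integral_complex_of_real)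

context
  fixes m :: "real \<times> real \<Rightarrow> real" and \<phi> f :: "real \<Rightarrow> complex"
  assumes m: "integrable lborel m" and \<phi>: "square_integrable \<phi>" and f: "square_integrable f"
begin

lemma integrable_loc_op_weight: "integrable lborel (\<lambda>z. STFT \<phi> f z * of_real (m z))"
proof (rule Bochner_Integration.integrable_bound)
  have [measurable]: "\<phi> \<in> borel_measurable borel" "f \<in> borel_measurable borel" "m \<in> borel_measurable borel"
    using \<phi> f m by auto
  show "integrable lborel (\<lambda>z. (L2_norm f * L2_norm \<phi>) * m z)"
    using m by simp
  show "(\<lambda>z. STFT \<phi> f z * of_real (m z)) \<in> borel_measurable lborel"
    by measurable
  show "AE z in lborel. norm (STFT \<phi> f z * of_real (m z)) \<le> norm ((L2_norm f * L2_norm \<phi>) * m z)"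
    using norm_STFT_le[OF \<phi> f] by (intro AE_I2) (auto simp: norm_mult abs_mult intro!: mult_right_mono)
qed

lemma square_integrable_loc_op: "square_integrable (loc_op m \<phi> f)"
  unfolding loc_op_tf_average by (rule square_integrable_tf_average[OF integrable_loc_op_weight \<phi>])

text \<open>This gives a meaning to \<open>H = V^* m V\<close> by duality: the inner product of a
  shifted window with \<open>h\<close> is the conjugate of a value of \<open>STFT \<phi> h\<close>.
  The later norm and energy estimates of \<open>loc_op\<close> rest on it.\<close>

lemma L2_inner_loc_op:
  assumes "square_integrable h"
  shows "L2_inner (loc_op m \<phi> f) h = (\<integral>z. STFT \<phi> f z * of_real (m z) * cnj (STFT \<phi> h z) \<partial>lborel)"
  unfolding loc_op_tf_average L2_inner_tf_average[OF integrable_loc_op_weight \<phi> assms]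
  by (simp add: STFT_def L2_inner_cnj)

text \<open>Duality with \<open>h\<close> equal to the operator's own output: its STFT has norm
  \<open>L2_norm h * L2_norm \<phi>\<close>, and one factor \<open>L2_norm h\<close>
  cancels.\<close>

lemma L2_norm_loc_op_le:
  assumes G: "square_integrable (\<lambda>z. STFT \<phi> f z * of_real (m z))"
  shows "L2_norm (loc_op m \<phi> f) \<le> L2_norm (\<lambda>z. STFT \<phi> f z * of_real (m z)) * L2_norm \<phi>"
proof -
  let ?H = "loc_op m \<phi> f" and ?G = "\<lambda>z. STFT \<phi> f z * of_real (m z)"
  note H = square_integrable_loc_op
  have "(L2_norm ?H)\<^sup>2 = norm (L2_inner ?H ?H)"
    unfolding L2_inner_self norm_of_real by simp
  also have "\<dots> \<le> L2_norm ?G * L2_norm (\<lambda>z. cnj (STFT \<phi> ?H z))"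
    unfolding L2_inner_loc_op[OF H]
    by (rule norm_integral_mult_le[OF G square_integrable_cnj[OF square_integrable_STFT[OF \<phi> H]]])
  also have "\<dots> = (L2_norm ?G * L2_norm \<phi>) * L2_norm ?H"
    by (simp add: L2_norm_cnj L2_norm_STFT \<phi> H)
  finally have "L2_norm ?H * L2_norm ?H \<le> (L2_norm ?G * L2_norm \<phi>) * L2_norm ?H"
    by (simp add: power2_eq_square)
  then show ?thesis
    using L2_norm_nonneg[of ?H] L2_norm_nonneg[of ?G] L2_norm_nonneg[of \<phi>]
    by (cases "L2_norm ?H = 0") (auto simp: mult_le_cancel_right)
qed

end

subsection \<open>Summation over relatively separated sets\<close>

text \<open>Unlike a power of \<open>1 + norm z\<close>, this weight factors into the two
  coordinates, so planar integrals reduce to the line. Its critical exponent for summability in the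
  plane is 1 instead of 2.\<close>

definition product_decay :: "real \<Rightarrow> real \<times> real \<Rightarrow> real" where
  "product_decay r z = ((1 + \<bar>fst z\<bar>) * (1 + \<bar>snd z\<bar>)) powr (- r)"

lemma nn_integral_powr_decay_finite:
  fixes r :: real
  assumes r: "1 < r"
  shows "(\<integral>\<^sup>+x. ennreal ((1 + \<bar>x\<bar>) powr (- r)) \<partial>lborel) < \<infinity>"
proof -
  define h where "h x = ennreal ((1 + x) powr (- r)) * indicator {0..} x" for x :: real
  have [measurable]: "h \<in> borel_measurable borel"
    unfolding h_def[abs_def] by measurable
  have "(\<integral>\<^sup>+x. h x \<partial>lborel) = ennreal (0 - (1 + 0) powr (1 - r) / (1 - r))"
    unfolding h_def
  proof (rule nn_integral_FTC_atLeast)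
    show "DERIV (\<lambda>x. (1 + x) powr (1 - r) / (1 - r)) x :> (1 + x) powr (- r)" if "0 \<le> x" for x
    proof -
      have "DERIV (\<lambda>x. (1 + x) powr (1 - r) / (1 - r)) x
          :> ((1 - r) * (1 + x) powr (1 - r - of_nat 1) * 1) / (1 - r)"
        using that by (intro DERIV_cdivide DERIV_fun_powr) (auto intro!: derivative_eq_intros)
      then show ?thesis
        using r by simp
    qed
    have "((\<lambda>x. (1 + x) powr (1 - r)) \<longlongrightarrow> 0) at_top"
      using r by (intro tendsto_neg_powr filterlim_tendsto_add_at_top[OF tendsto_const] filterlim_ident) auto
    then have "((\<lambda>x. (1 + x) powr (1 - r) / (1 - r)) \<longlongrightarrow> 0 / (1 - r)) at_top"
      using r by (intro tendsto_divide tendsto_const) auto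
    then show "((\<lambda>x. (1 + x) powr (1 - r) / (1 - r)) \<longlongrightarrow> 0) at_top"
      by simp
  qed auto
  then have fin: "(\<integral>\<^sup>+x. h x \<partial>lborel) < \<infinity>"
    by simp
  have "(\<integral>\<^sup>+x. ennreal ((1 + \<bar>x\<bar>) powr (- r)) \<partial>lborel) \<le> (\<integral>\<^sup>+x. h x + h (- x) \<partial>lborel)"
    by (intro nn_integral_mono) (auto simp: h_def indicator_def)
  also have "\<dots> = (\<integral>\<^sup>+x. h x \<partial>lborel) + (\<integral>\<^sup>+x. h (- x) \<partial>lborel)"
    by (rule nn_integral_add) auto
  also have "(\<integral>\<^sup>+x. h (- x) \<partial>lborel) = (\<integral>\<^sup>+x. h x \<partial>lborel)"
    using nn_integral_real_affine[of h "-1" 0] by simp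
  finally show ?thesis
    using fin by (auto simp: top_unique less_top[symmetric])
qed

text \<open>Within distance 1/2 of \<open>c\<close> the quantity \<open>1 + \<bar>x\<bar>\<close> is
  at most \<open>2 * (1 + \<bar>c\<bar>)\<close>, so the value at \<open>c\<close> is controlled by
  the mean over a unit interval. This replaces point values by integrals.\<close>

lemma powr_decay_le_average:
  fixes c r :: real
  assumes r: "0 \<le> r"
  shows "ennreal ((1 + \<bar>c\<bar>) powr (- r))
    \<le> ennreal (2 powr r) * (\<integral>\<^sup>+x. ennreal ((1 + \<bar>x\<bar>) powr (- r)) * indicator {c - 1/2..c + 1/2} x \<partial>lborel)"
proof -
  have "ennreal ((1 + \<bar>c\<bar>) powr (- r)) = (\<integral>\<^sup>+x. ennreal ((1 + \<bar>c\<bar>) powr (- r)) * indicator {c - 1/2..c + 1/2} x \<partial>lborel)"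
    by (simp add: nn_integral_cmult)
  also have "\<dots> \<le> (\<integral>\<^sup>+x. ennreal (2 powr r) * (ennreal ((1 + \<bar>x\<bar>) powr (- r)) * indicator {c - 1/2..c + 1/2} x) \<partial>lborel)"
  proof (rule nn_integral_mono)
    fix x
    show "ennreal ((1 + \<bar>c\<bar>) powr (- r)) * indicator {c - 1/2..c + 1/2} x
        \<le> ennreal (2 powr r) * (ennreal ((1 + \<bar>x\<bar>) powr (- r)) * indicator {c - 1/2..c + 1/2} x)"
    proof (cases "x \<in> {c - 1/2..c + 1/2}")
      case True
      then have "(1 + \<bar>x\<bar>) / 2 \<le> 1 + \<bar>c\<bar>"
        by auto
      then have "(1 + \<bar>c\<bar>) powr (- r) \<le> ((1 + \<bar>x\<bar>) / 2) powr (- r)"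
        using r by (intro powr_mono2') auto
      also have "\<dots> = 2 powr r * (1 + \<bar>x\<bar>) powr (- r)"
        by (simp add: powr_divide powr_minus field_simps)
      finally show ?thesis
        using True by (simp flip: ennreal_mult)
    qed simp
  qed
  also have "\<dots> = ennreal (2 powr r) * (\<integral>\<^sup>+x. ennreal ((1 + \<bar>x\<bar>) powr (- r)) * indicator {c - 1/2..c + 1/2} x \<partial>lborel)"
    by (rule nn_integral_cmult) measurable
  finally show ?thesis .
qed

text \<open>Each term is bounded by a mean over the unit square centred at
  \<open>z - \<gamma>\<close>. At most \<open>N\<close> of these squares contain a given point, so
  the sum is at most a constant times \<open>N\<close> times the integral of the weight over the
  plane, uniformly in \<open>z\<close>.\<close>

lemma product_decay_sum_bounded:
  assumes \<Gamma>: "discrete_set \<Gamma>" and r: "1 < r"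
  obtains C where "0 < C" "\<And>z F. finite F \<Longrightarrow> F \<subseteq> \<Gamma> \<Longrightarrow> (\<Sum>\<gamma>\<in>F. product_decay r (z - \<gamma>)) \<le> C"
proof -
  obtain N where N: "\<And>z. card (\<Gamma> \<inter> cball z 1) \<le> N"
    using \<Gamma> by (auto simp: discrete_set_def)
  \<comment> \<open>\<open>card\<close> of an infinite set is 0, so the bound by \<open>N\<close>
    has content only together with finiteness, which compactness of the disc and the absence of
    accumulation points provide.\<close>
  have fin: "finite (\<Gamma> \<inter> cball z 1)" for z
    using finite_not_islimpt_in_compact[of "cball z 1" \<Gamma>] \<Gamma> by (auto simp: discrete_set_def Int_commute)
  define p :: "real \<Rightarrow> ennreal" where "p x = ennreal ((1 + \<bar>x\<bar>) powr (- r))" for x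
  define q :: "real \<Rightarrow> real \<Rightarrow> ennreal" where "q c x = indicator {c - 1/2..c + 1/2} x" for c x
  have [measurable]: "p \<in> borel_measurable borel"
    unfolding p_def[abs_def] by measurable
  have [measurable]: "q c \<in> borel_measurable borel" for c
    unfolding q_def[abs_def] by measurable
  define D where "D = ennreal (2 powr r) * ennreal (2 powr r) * (of_nat N * ((\<integral>\<^sup>+x. p x \<partial>lborel) * (\<integral>\<^sup>+x. p x \<partial>lborel)))"
  have D: "D < \<infinity>"
    using nn_integral_powr_decay_finite[OF r]
    by (simp add: D_def p_def ennreal_mult_less_top of_nat_less_top)
  have le: "(\<Sum>\<gamma>\<in>F. ennreal (product_decay r (z - \<gamma>))) \<le> D" if F: "finite F" "F \<subseteq> \<Gamma>" for z F
  proof -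
    let ?c = "ennreal (2 powr r)"
    have "(\<Sum>\<gamma>\<in>F. ennreal (product_decay r (z - \<gamma>)))
        \<le> (\<Sum>\<gamma>\<in>F. ?c * ?c * (\<integral>\<^sup>+x. \<integral>\<^sup>+y. p x * q (fst z - fst \<gamma>) x * (p y * q (snd z - snd \<gamma>) y) \<partial>lborel \<partial>lborel))"
    proof (rule sum_mono)
      fix \<gamma>
      have "ennreal (product_decay r (z - \<gamma>)) = p (fst z - fst \<gamma>) * p (snd z - snd \<gamma>)"
        by (simp add: product_decay_def p_def powr_mult ennreal_mult)
      also have "\<dots> \<le> (?c * (\<integral>\<^sup>+x. p x * q (fst z - fst \<gamma>) x \<partial>lborel)) * (?c * (\<integral>\<^sup>+y. p y * q (snd z - snd \<gamma>) y \<partial>lborel))"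
        unfolding p_def q_def by (intro mult_mono powr_decay_le_average) (use r in auto)
      also have "\<dots> = ?c * ?c * (\<integral>\<^sup>+x. \<integral>\<^sup>+y. p x * q (fst z - fst \<gamma>) x * (p y * q (snd z - snd \<gamma>) y) \<partial>lborel \<partial>lborel)"
        by (simp add: nn_integral_cmult nn_integral_multc) (simp add: mult_ac)
      finally show "ennreal (product_decay r (z - \<gamma>)) \<le> \<dots>" .
    qed
    also have "\<dots> = ?c * ?c * (\<integral>\<^sup>+x. \<integral>\<^sup>+y. (\<Sum>\<gamma>\<in>F. p x * q (fst z - fst \<gamma>) x * (p y * q (snd z - snd \<gamma>) y)) \<partial>lborel \<partial>lborel)"
      by (simp add: sum_distrib_left nn_integral_sum)
    also have "\<dots> \<le> ?c * ?c * (\<integral>\<^sup>+x. \<integral>\<^sup>+y. of_nat N * (p x * p y) \<partial>lborel \<partial>lborel)"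
    proof (intro mult_left_mono nn_integral_mono)
      fix x y
      let ?B = "{\<gamma> \<in> F. x \<in> {fst z - fst \<gamma> - 1/2..fst z - fst \<gamma> + 1/2} \<and> y \<in> {snd z - snd \<gamma> - 1/2..snd z - snd \<gamma> + 1/2}}"
      \<comment> \<open>Half a side in each coordinate adds up to at most 1, the radius in
        \<open>discrete_set\<close>.\<close>
      have "?B \<subseteq> \<Gamma> \<inter> cball (z - (x, y)) 1"
      proof
        fix \<gamma>
        assume \<gamma>: "\<gamma> \<in> ?B"
        have "dist (z - (x, y)) \<gamma> = norm (fst z - x - fst \<gamma>, snd z - y - snd \<gamma>)"
          by (simp add: dist_norm prod_eq_iff minus_prod_def)
        also have "\<dots> \<le> norm (fst z - x - fst \<gamma>) + norm (snd z - y - snd \<gamma>)"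
          by (rule norm_Pair_le)
        also have "\<dots> \<le> 1/2 + 1/2"
          using \<gamma> unfolding real_norm_def mem_Collect_eq atLeastAtMost_iff
          by (intro add_mono) linarith+
        finally show "\<gamma> \<in> \<Gamma> \<inter> cball (z - (x, y)) 1"
          using \<gamma> F by auto
      qed
      then have B: "card ?B \<le> N"
        using card_mono[OF fin] N order_trans by blast
      have "(\<Sum>\<gamma>\<in>F. p x * q (fst z - fst \<gamma>) x * (p y * q (snd z - snd \<gamma>) y))
          = (\<Sum>\<gamma>\<in>F. (if \<gamma> \<in> ?B then 1 else 0) * (p x * p y))"
        by (intro sum.cong) (auto simp: q_def indicator_def)
      also have "\<dots> = of_nat (card ?B) * (p x * p y)"
        using F by (simp add: sum.If_cases sum_distrib_right[symmetric] Int_def Collect_conj_eq[symmetric])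
      also have "\<dots> \<le> of_nat N * (p x * p y)"
        using B by (intro mult_right_mono) auto
      finally show "(\<Sum>\<gamma>\<in>F. p x * q (fst z - fst \<gamma>) x * (p y * q (snd z - snd \<gamma>) y)) \<le> of_nat N * (p x * p y)" .
    qed auto
    also have "\<dots> = D"
      by (simp add: D_def nn_integral_cmult nn_integral_multc)
    finally show ?thesis .
  qed
  \<comment> \<open>The summand 1 serves only to make the constant positive, also when
    \<open>D\<close> is 0.\<close>
  have "(\<Sum>\<gamma>\<in>F. product_decay r (z - \<gamma>)) \<le> enn2real D + 1" if F: "finite F" "F \<subseteq> \<Gamma>" for z F
  proof -
    have "ennreal (\<Sum>\<gamma>\<in>F. product_decay r (z - \<gamma>)) \<le> ennreal (enn2real D)"
      using le[OF F, of z] D by (simp add: product_decay_def sum_ennreal less_top)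
    then show ?thesis
      by (simp add: ennreal_le_iff)
  qed
  then show thesis
    by (intro that[of "enn2real D + 1"]) (auto simp: add_nonneg_pos)
qed

subsection \<open>Localizers\<close>

lemma
  fixes a b :: "real \<Rightarrow> complex"
  assumes a: "integrable lborel a" and b: "integrable lborel b"
  shows integrable_lborel_pair_mult: "integrable lborel (\<lambda>z. a (fst z) * b (snd z))"
    and integral_lborel_pair_mult:
      "(\<integral>z. a (fst z) * b (snd z) \<partial>lborel) = (\<integral>x. a x \<partial>lborel) * (\<integral>y. b y \<partial>lborel)"
proof -
  have [measurable]: "a \<in> borel_measurable borel" "b \<in> borel_measurable borel"
    using a b by auto
  have m: "(\<lambda>z. a (fst z) * b (snd z)) \<in> borel_measurable (borel \<Otimes>\<^sub>M borel)"
    by measurable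
  show int: "integrable lborel (\<lambda>z. a (fst z) * b (snd z))"
  proof (rule integrableI_bounded)
    show "(\<lambda>z. a (fst z) * b (snd z)) \<in> borel_measurable lborel"
      using m by (simp add: borel_prod)
    then have "(\<lambda>z. ennreal (norm (a (fst z) * b (snd z)))) \<in> borel_measurable borel"
      by simp
    from nn_integral_lborel_pair[OF this]
    have "(\<integral>\<^sup>+z. ennreal (norm (a (fst z) * b (snd z))) \<partial>lborel)
        = (\<integral>\<^sup>+x. \<integral>\<^sup>+y. ennreal (norm (a x)) * ennreal (norm (b y)) \<partial>lborel \<partial>lborel)"
      by (simp add: norm_mult ennreal_mult)
    also have "\<dots> < \<infinity>"
      using a b by (simp add: nn_integral_cmult nn_integral_multc integrable_iff_bounded ennreal_mult_less_top)
    finally show "(\<integral>\<^sup>+z. ennreal (norm (a (fst z) * b (snd z))) \<partial>lborel) < \<infinity>" .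
  qed
  then have "integrable (lborel \<Otimes>\<^sub>M lborel) (\<lambda>z. a (fst z) * b (snd z))"
    by (simp add: lborel_prod)
  from lborel_pair.integral_fst'[OF this]
  show "(\<integral>z. a (fst z) * b (snd z) \<partial>lborel) = (\<integral>x. a x \<partial>lborel) * (\<integral>y. b y \<partial>lborel)"
    by (simp add: lborel_prod)
qed

definition gauss_mass :: "real \<Rightarrow> real" where
  "gauss_mass \<delta> = (\<integral>u. indicator {-\<delta>..\<delta>} u * exp (- pi * u\<^sup>2) \<partial>lborel)"

text \<open>A probability density on the square of side \<open>2 * \<delta>\<close>: a truncated,
  renormalized Gaussian in the translation variable and a uniform density in the modulation
  variable. The first yields the frequency cut-off, the second the time cut-off of the
  localizer.\<close>

definition window_density :: "real \<Rightarrow> real \<times> real \<Rightarrow> real" where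
  "window_density \<delta> \<xi> = (indicator {-\<delta>..\<delta>} (fst \<xi>) * exp (- pi * (fst \<xi>)\<^sup>2) / gauss_mass \<delta>)
    * (indicator {-\<delta>..\<delta>} (snd \<xi>) / (2 * \<delta>))"

text \<open>The character is the symplectic pairing of \<gamma> with \<xi>. Composing
  \<open>tf_shift \<xi>\<close> with the STFT at \<open>z\<close> produces the opposite pairing of
  \<open>z\<close> with \<xi>, so only the difference of \<open>z\<close> and \<gamma> remains in
  the phase.\<close>

definition localizer :: "real \<Rightarrow> real \<times> real \<Rightarrow> (real \<Rightarrow> complex) \<Rightarrow> real \<Rightarrow> complex" where
  "localizer \<delta> \<gamma> = tf_average
    (\<lambda>\<xi>. of_real (window_density \<delta> \<xi>) * cis (2 * pi * (snd \<gamma> * fst \<xi> - fst \<gamma> * snd \<xi>)))"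

lemma square_integrable_reflect:
  fixes f :: "real \<Rightarrow> complex"
  assumes f: "square_integrable f"
  shows "square_integrable (\<lambda>u. f (t - u))"
proof -
  have [measurable]: "f \<in> borel_measurable borel"
    using f by auto
  have "(\<integral>\<^sup>+u. ennreal ((norm (f (t - u)))\<^sup>2) \<partial>lborel) = ennreal ((L2_norm f)\<^sup>2)"
    using nn_integral_real_affine[of "\<lambda>x. ennreal ((norm (f x))\<^sup>2)" "-1" t] nn_integral_square[OF f] by simp
  then show ?thesis
    by (intro square_integrableI(1)[of _ "(L2_norm f)\<^sup>2"]) auto
qed

text \<open>The integral is a normalized sinc. The trivial bound 1 handles small \<open>t\<close>,
  the explicit antiderivative gives \<open>1 / \<delta>\<close> for \<open>\<bar>t\<bar>\<close>
  times the modulus; adding the two bounds produces the decay.\<close>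

lemma norm_integral_cis_le:
  assumes \<delta>: "0 < \<delta>"
  shows "norm (\<integral>v. of_real (indicator {-\<delta>..\<delta>} v / (2 * \<delta>)) * cis (2 * pi * t * v) \<partial>lborel)
    \<le> (1 + 1 / \<delta>) / (1 + \<bar>t\<bar>)"
proof -
  let ?I = "\<integral>v. of_real (indicator {-\<delta>..\<delta>} v / (2 * \<delta>)) * cis (2 * pi * t * v) \<partial>lborel"
  have "norm ?I \<le> (\<integral>v. norm (of_real (indicator {-\<delta>..\<delta>} v / (2 * \<delta>)) * cis (2 * pi * t * v)) \<partial>lborel)"
    by (rule integral_norm_bound)
  also have "\<dots> = (\<integral>v. indicator {-\<delta>..\<delta>} v / (2 * \<delta>) \<partial>lborel)"
    using \<delta> by (simp add: norm_mult norm_divide)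
  also have "\<dots> = 1"
    using \<delta> by simp
  finally have 1: "norm ?I \<le> 1" .
  have 2: "\<bar>t\<bar> * norm ?I \<le> 1 / \<delta>"
  proof (cases "t = 0")
    case False
    define F where "F v = cis (2 * pi * t * v) / (2 * pi * \<i> * t)" for v
    have "(\<integral>v. indicator {-\<delta>..\<delta>} v *\<^sub>R cis (2 * pi * t * v) \<partial>lborel) = F \<delta> - F (- \<delta>)"
    proof (rule integral_FTC_atLeastAtMost)
      show "(F has_vector_derivative cis (2 * pi * t * v)) (at v within {-\<delta>..\<delta>})" for v
      proof -
        have "((\<lambda>v. cis (2 * pi * t * v) / (2 * pi * \<i> * t)) has_vector_derivative
            ((2 * pi * t) *\<^sub>R (\<i> * cis (2 * pi * t * v))) / (2 * pi * \<i> * t)) (at v within {-\<delta>..\<delta>})"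
          unfolding cis_conv_exp
          by (auto intro!: derivative_eq_intros has_vector_derivative_real_field simp: scaleR_conv_of_real)
        then show ?thesis
          using False by (simp add: F_def[abs_def] scaleR_conv_of_real)
      qed
    qed (use \<delta> in \<open>auto intro!: continuous_intros\<close>)
    moreover have "?I = (\<integral>v. indicator {-\<delta>..\<delta>} v *\<^sub>R cis (2 * pi * t * v) \<partial>lborel) / (2 * \<delta>)"
      by (simp add: scaleR_conv_of_real)
    ultimately have "norm ?I = norm (F \<delta> - F (- \<delta>)) / (2 * \<delta>)"
      using \<delta> by (simp add: norm_divide)
    also have "\<dots> \<le> (norm (F \<delta>) + norm (F (- \<delta>))) / (2 * \<delta>)"
      using \<delta> by (intro divide_right_mono norm_triangle_ineq4) auto
    also have "\<dots> = 1 / (2 * pi * \<bar>t\<bar> * \<delta>)"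
      using \<delta> by (simp add: F_def norm_divide norm_mult)
    finally have "\<bar>t\<bar> * norm ?I \<le> \<bar>t\<bar> * (1 / (2 * pi * \<bar>t\<bar> * \<delta>))"
      by (intro mult_left_mono) auto
    also have "\<dots> = 1 / (2 * pi) / \<delta>"
      using False by simp
    also have "\<dots> \<le> 1 / \<delta>"
      using \<delta> pi_ge_two by (intro divide_right_mono) auto
    finally show ?thesis .
  qed (use \<delta> in auto)
  show ?thesis
    using 1 2 by (simp add: field_simps)
qed

text \<open>Order 2 matches the square of the sinc bound, so that the frequency and time factors
  combine to \<open>product_decay 2\<close>.\<close>

lemma exp_le_decay:
  fixes y :: real
  shows "exp (- pi * y\<^sup>2) \<le> 2 / (1 + \<bar>y\<bar>)\<^sup>2"
proof -
  have "(1 + \<bar>y\<bar>)\<^sup>2 \<le> 2 * (1 + y\<^sup>2)"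
    using zero_le_power2[of "1 - \<bar>y\<bar>"] by (simp add: power2_eq_square algebra_simps)
  also have "\<dots> \<le> 2 * (1 + pi * y\<^sup>2)"
    using mult_right_mono[of 1 pi "y\<^sup>2"] pi_ge_two by simp
  also have "\<dots> \<le> 2 * exp (pi * y\<^sup>2)"
    by (intro mult_left_mono exp_ge_add_one_self) simp
  finally show ?thesis
    by (simp add: exp_minus field_simps)
qed

context
  fixes \<delta> :: real
  assumes \<delta>: "0 < \<delta>"
begin

lemma integrable_gauss_interval: "integrable lborel (\<lambda>u. indicator {-\<delta>..\<delta>} u * exp (- pi * u\<^sup>2))"
  by (rule Bochner_Integration.integrable_bound[of _ "\<lambda>u. exp (- pi * u\<^sup>2)"])
    (use integrable_gauss[of 1] in \<open>auto simp: indicator_def\<close>)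

lemma gauss_mass_pos: "0 < gauss_mass \<delta>"
proof -
  have "0 < exp (- pi * \<delta>\<^sup>2) * (2 * \<delta>)"
    using \<delta> by simp
  also have "\<dots> = (\<integral>u. indicator {-\<delta>..\<delta>} u * exp (- pi * \<delta>\<^sup>2) \<partial>lborel)"
    using \<delta> by simp
  also have "\<dots> \<le> gauss_mass \<delta>"
    unfolding gauss_mass_def
  proof (rule integral_mono[OF _ integrable_gauss_interval])
    show "indicator {-\<delta>..\<delta>} u * exp (- pi * \<delta>\<^sup>2) \<le> indicator {-\<delta>..\<delta>} u * exp (- pi * u\<^sup>2)" for u :: real
      by (auto simp: indicator_def intro!: power2_le_iff_abs_le[THEN iffD2])
  qed (use \<delta> in auto)
  finally show ?thesis .
qed

lemma window_density_nonneg: "0 \<le> window_density \<delta> \<xi>"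
  using \<delta> gauss_mass_pos by (simp add: window_density_def)

lemma window_density_support:
  "window_density \<delta> \<xi> \<noteq> 0 \<Longrightarrow> \<bar>fst \<xi>\<bar> \<le> \<delta> \<and> \<bar>snd \<xi>\<bar> \<le> \<delta>"
  by (auto simp: window_density_def indicator_def split: if_splits)

lemma borel_measurable_window_density [measurable]: "window_density \<delta> \<in> borel_measurable borel"
  unfolding window_density_def[abs_def] borel_prod[symmetric] by measurable

lemma integrable_window_density: "integrable lborel (window_density \<delta>)"
  and integral_window_density: "(\<integral>\<xi>. window_density \<delta> \<xi> \<partial>lborel) = 1"
proof -
  have int: "integrable lborel (\<lambda>u. complex_of_real (indicator {-\<delta>..\<delta>} u * exp (- pi * u\<^sup>2) / gauss_mass \<delta>))"
    "integrable lborel (\<lambda>v. complex_of_real (indicator {-\<delta>..\<delta>} v / (2 * \<delta>)))"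
    unfolding complex_of_real_integrable_eq using integrable_gauss_interval \<delta> by auto
  have I1: "(\<integral>u. complex_of_real (indicator {-\<delta>..\<delta>} u * exp (- pi * u\<^sup>2) / gauss_mass \<delta>) \<partial>lborel) = 1"
    using gauss_mass_pos
    unfolding integral_complex_of_real integral_divide_zero gauss_mass_def[symmetric] by simp
  have I2: "(\<integral>v. complex_of_real (indicator {-\<delta>..\<delta>} v / (2 * \<delta>)) \<partial>lborel) = 1"
    using \<delta> unfolding integral_complex_of_real by simp
  have "integrable lborel (\<lambda>\<xi>. complex_of_real (window_density \<delta> \<xi>))"
    using integrable_lborel_pair_mult[OF int] by (simp add: window_density_def)
  then show "integrable lborel (window_density \<delta>)"
    by (simp add: complex_of_real_integrable_eq)
  have "(\<integral>\<xi>. complex_of_real (window_density \<delta> \<xi>) \<partial>lborel) = 1"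
    using integral_lborel_pair_mult[OF int] unfolding I1 I2 by (simp add: window_density_def)
  then show "(\<integral>\<xi>. window_density \<delta> \<xi> \<partial>lborel) = 1"
    unfolding integral_complex_of_real by (simp only: of_real_eq_1_iff)
qed

lemma integrable_localizer_weight:
  "integrable lborel (\<lambda>\<xi>. of_real (window_density \<delta> \<xi>) * cis (2 * pi * (snd \<gamma> * fst \<xi> - fst \<gamma> * snd \<xi>)))"
proof (rule Bochner_Integration.integrable_bound[OF integrable_window_density])
  have "(\<lambda>\<xi>. cis (2 * pi * (snd \<gamma> * fst \<xi> - fst \<gamma> * snd \<xi>))) \<in> borel_measurable (borel :: (real \<times> real) measure)"
    unfolding borel_prod[symmetric] by measurable
  then show "(\<lambda>\<xi>. of_real (window_density \<delta> \<xi>) * cis (2 * pi * (snd \<gamma> * fst \<xi> - fst \<gamma> * snd \<xi>))) \<in> borel_measurable lborel"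
    by measurable
qed (auto simp: norm_mult)

lemma square_integrable_localizer: "square_integrable f \<Longrightarrow> square_integrable (localizer \<delta> \<gamma> f)"
  unfolding localizer_def by (rule square_integrable_tf_average[OF integrable_localizer_weight])

lemma square_integrable_interval: "square_integrable (\<lambda>u. complex_of_real (indicator {-\<delta>..\<delta>} u))"
proof -
  have "(\<lambda>x. (norm (complex_of_real (indicator {-\<delta>..\<delta>} x)))\<^sup>2) = indicator {-\<delta>..\<delta>}"
    by (auto simp: indicator_def)
  then show ?thesis
    using \<delta> by (auto simp: square_integrable_def)
qed

text \<open>Writing the Gaussian factor of the density as a Fourier integral expresses the frequency cut-off
  as an average of values of an STFT, which is what makes the localizers summable over \<open>\<gamma>\<close>.\<close>

lemma frequency_cutoff_le:
  assumes f: "square_integrable f"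
  shows "ennreal ((norm (\<integral>u. of_real (indicator {-\<delta>..\<delta>} u * exp (- pi * u\<^sup>2)) * cis (2 * pi * \<omega> * u) * f (t - u) \<partial>lborel))\<^sup>2)
    \<le> (\<integral>\<^sup>+y. ennreal (exp (- pi * (y - \<omega>)\<^sup>2)
        * (norm (STFT (\<lambda>u. of_real (indicator {-\<delta>..\<delta>} u)) f (t, y)))\<^sup>2) \<partial>lborel)"
proof -
  let ?V = "STFT (\<lambda>u. of_real (indicator {-\<delta>..\<delta>} u)) f"
  have [measurable]: "f \<in> borel_measurable borel"
    using f by auto
  have [measurable]: "(\<lambda>y. ?V (t, y)) \<in> borel_measurable borel"
  proof -
    have "?V \<in> borel_measurable (borel \<Otimes>\<^sub>M borel)"
      unfolding borel_prod by measurable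
    then show ?thesis
      by measurable
  qed
  define F where "F u = of_real (indicator {-\<delta>..\<delta>} u) * cis (2 * pi * \<omega> * u) * f (t - u)" for u
  have "square_integrable (\<lambda>u. of_real (indicator {-\<delta>..\<delta>} u) * cis (2 * pi * \<omega> * u))"
    using square_integrable_interval by (auto simp: square_integrable_def norm_mult)
  from integrable_mult_square_integrable[OF this square_integrable_reflect[OF f]] have F: "integrable lborel F"
    by (simp add: F_def[abs_def])
  have h: "integrable lborel (\<lambda>y. complex_of_real (exp (- pi * y\<^sup>2)))"
    using integrable_gauss[of 1] by (simp del: of_real_exp)
  \<comment> \<open>The reflection \<open>u = t - s\<close> turns the Fourier integral into an STFT
    with the interval as window; the interval is symmetric, so the reflection leaves it
    unchanged.\<close>
  have Fh: "(\<integral>u. F u * cis (2 * pi * y * u) \<partial>lborel) = cis (2 * pi * (\<omega> + y) * t) * ?V (t, \<omega> + y)" for y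
  proof -
    have "(\<integral>u. F u * cis (2 * pi * y * u) \<partial>lborel)
        = (\<integral>s. F (t - s) * cis (2 * pi * y * (t - s)) \<partial>lborel)"
      using lborel_integral_real_affine[of "-1" "\<lambda>u. F u * cis (2 * pi * y * u)" t] by simp
    also have "\<dots> = (\<integral>s. cis (2 * pi * (\<omega> + y) * t)
        * (f s * cnj (of_real (indicator {-\<delta>..\<delta>} (s - t))) * cis (- 2 * pi * (\<omega> + y) * s)) \<partial>lborel)"
    proof (rule Bochner_Integration.integral_cong)
      fix s
      have "indicator {-\<delta>..\<delta>} (t - s) = (indicator {-\<delta>..\<delta>} (s - t) :: real)"
        by (auto simp: indicator_def)
      moreover have "cis (2 * pi * \<omega> * (t - s)) * cis (2 * pi * y * (t - s))
          = cis (2 * pi * (\<omega> + y) * t) * cis (- 2 * pi * (\<omega> + y) * s)"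
        unfolding cis_mult by (simp add: algebra_simps)
      ultimately show "F (t - s) * cis (2 * pi * y * (t - s)) = cis (2 * pi * (\<omega> + y) * t)
          * (f s * cnj (of_real (indicator {-\<delta>..\<delta>} (s - t))) * cis (- 2 * pi * (\<omega> + y) * s))"
        by (simp add: F_def algebra_simps)
    qed simp
    finally show ?thesis
      by (simp add: STFT_fourier)
  qed
  have "(\<integral>u. of_real (indicator {-\<delta>..\<delta>} u * exp (- pi * u\<^sup>2)) * cis (2 * pi * \<omega> * u) * f (t - u) \<partial>lborel)
      = (\<integral>u. F u * (\<integral>y. of_real (exp (- pi * y\<^sup>2)) * cis (2 * pi * y * u) \<partial>lborel) \<partial>lborel)"
    using fourier_gauss[of 1] by (simp add: F_def mult_ac)
  also have "\<dots> = (\<integral>y. of_real (exp (- pi * y\<^sup>2)) * (cis (2 * pi * (\<omega> + y) * t) * ?V (t, \<omega> + y)) \<partial>lborel)"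
    using fourier_multiplication_formula[OF F h, of "2 * pi"] unfolding Fh by (simp add: mult.commute)
  finally have eq: "(\<integral>u. of_real (indicator {-\<delta>..\<delta>} u * exp (- pi * u\<^sup>2)) * cis (2 * pi * \<omega> * u) * f (t - u) \<partial>lborel)
      = (\<integral>y. of_real (exp (- pi * y\<^sup>2)) * (cis (2 * pi * (\<omega> + y) * t) * ?V (t, \<omega> + y)) \<partial>lborel)" .
  \<comment> \<open>The Gaussian has mass 1, so the square of the mean is at most the mean of the
    squares.\<close>
  have "ennreal ((norm (\<integral>y. of_real (exp (- pi * y\<^sup>2)) * (cis (2 * pi * (\<omega> + y) * t) * ?V (t, \<omega> + y)) \<partial>lborel))\<^sup>2)
      \<le> (\<integral>\<^sup>+y. ennreal (norm (complex_of_real (exp (- pi * y\<^sup>2)))) \<partial>lborel)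
        * (\<integral>\<^sup>+y. ennreal (norm (complex_of_real (exp (- pi * y\<^sup>2))) * (norm (cis (2 * pi * (\<omega> + y) * t) * ?V (t, \<omega> + y)))\<^sup>2) \<partial>lborel)"
    by (rule norm_integral_mult_squared_le) measurable
  also have "(\<integral>\<^sup>+y. ennreal (norm (complex_of_real (exp (- pi * y\<^sup>2)))) \<partial>lborel) = 1"
    using nn_integral_eq_integral[OF integrable_gauss[of 1]] integral_gauss by simp
  also have "1 * (\<integral>\<^sup>+y. ennreal (norm (complex_of_real (exp (- pi * y\<^sup>2))) * (norm (cis (2 * pi * (\<omega> + y) * t) * ?V (t, \<omega> + y)))\<^sup>2) \<partial>lborel)
      = (\<integral>\<^sup>+y. ennreal (exp (- pi * (y - \<omega>)\<^sup>2) * (norm (?V (t, y)))\<^sup>2) \<partial>lborel)"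
    using nn_integral_real_affine[of "\<lambda>y. ennreal (exp (- pi * (y - \<omega>)\<^sup>2) * (norm (?V (t, y)))\<^sup>2)" 1 \<omega>]
    by (simp add: norm_mult)
  finally show ?thesis
    unfolding eq .
qed

text \<open>Density and character both split into coordinates, and the two integrals separate: the
  translation integral depends on \<gamma> only through its frequency, the modulation integral only
  through its position in time.\<close>

lemma localizer_eq:
  assumes f: "square_integrable f"
  shows "localizer \<delta> \<gamma> f t
    = (\<integral>u. of_real (indicator {-\<delta>..\<delta>} u * exp (- pi * u\<^sup>2)) * cis (2 * pi * snd \<gamma> * u) * f (t - u) \<partial>lborel)
      / gauss_mass \<delta> * (\<integral>v. of_real (indicator {-\<delta>..\<delta>} v / (2 * \<delta>)) * cis (2 * pi * (t - fst \<gamma>) * v) \<partial>lborel)"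
proof -
  let ?a = "\<lambda>u. of_real (indicator {-\<delta>..\<delta>} u * exp (- pi * u\<^sup>2)) * cis (2 * pi * snd \<gamma> * u) * f (t - u)"
  let ?b = "\<lambda>v. of_real (indicator {-\<delta>..\<delta>} v / (2 * \<delta>)) * cis (2 * pi * (t - fst \<gamma>) * v)"
  have "square_integrable (\<lambda>u. of_real (indicator {-\<delta>..\<delta>} u * exp (- pi * u\<^sup>2)) * cis (2 * pi * snd \<gamma> * u))"
    unfolding square_integrable_def
  proof
    show "integrable lborel (\<lambda>u. (norm (of_real (indicator {-\<delta>..\<delta>} u * exp (- pi * u\<^sup>2)) * cis (2 * pi * snd \<gamma> * u)))\<^sup>2)"
      by (rule Bochner_Integration.integrable_bound[OF integrable_gauss_interval])
        (auto simp: norm_mult indicator_def power2_eq_square mult_le_one)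
  qed measurable
  from integrable_mult_square_integrable[OF this square_integrable_reflect[OF f]]
  have a: "integrable lborel (\<lambda>u. ?a u / gauss_mass \<delta>)"
    by simp
  have b: "integrable lborel ?b"
  proof (rule Bochner_Integration.integrable_bound)
    show "integrable lborel (\<lambda>v. indicat_real {-\<delta>..\<delta>} v / (2 * \<delta>))"
      using \<delta> by simp
  qed (auto simp: norm_mult norm_divide)
  have "localizer \<delta> \<gamma> f t = (\<integral>\<xi>. (?a (fst \<xi>) / gauss_mass \<delta>) * ?b (snd \<xi>) \<partial>lborel)"
    unfolding localizer_def tf_average_def
  proof (rule Bochner_Integration.integral_cong)
    fix \<xi> :: "real \<times> real"
    have "cis (2 * pi * (snd \<gamma> * fst \<xi> - fst \<gamma> * snd \<xi>)) * cis (2 * pi * (snd \<xi> * t))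
        = cis (2 * pi * snd \<gamma> * fst \<xi>) * cis (2 * pi * (t - fst \<gamma>) * snd \<xi>)"
      unfolding cis_mult by (simp add: algebra_simps)
    then show "of_real (window_density \<delta> \<xi>) * cis (2 * pi * (snd \<gamma> * fst \<xi> - fst \<gamma> * snd \<xi>)) * tf_shift \<xi> f t
        = (?a (fst \<xi>) / gauss_mass \<delta>) * ?b (snd \<xi>)"
      by (simp add: window_density_def tf_shift_cis mult_ac)
  qed simp
  then show ?thesis
    unfolding integral_lborel_pair_mult[OF a b] by simp
qed

text \<open>The squared sinc supplies the decay in \<open>t - fst \<gamma>\<close>, the Gaussian
  mean the decay in \<open>y - snd \<gamma>\<close>. On the right \<gamma> enters only through a
  weight on one fixed STFT, which makes summation over \<gamma> possible.\<close>

lemma localizer_pointwise_le: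
  assumes f: "square_integrable f"
  shows "ennreal ((norm (localizer \<delta> \<gamma> f t))\<^sup>2)
    \<le> ennreal (2 * ((1 + 1 / \<delta>) / gauss_mass \<delta>)\<^sup>2)
      * (\<integral>\<^sup>+y. ennreal (product_decay 2 ((t, y) - \<gamma>) * (norm (STFT (\<lambda>u. of_real (indicator {-\<delta>..\<delta>} u)) f (t, y)))\<^sup>2) \<partial>lborel)"
proof -
  let ?V = "STFT (\<lambda>u. of_real (indicator {-\<delta>..\<delta>} u)) f"
  have [measurable]: "f \<in> borel_measurable borel"
    using f by auto
  have [measurable]: "(\<lambda>y. ?V (t, y)) \<in> borel_measurable borel"
  proof -
    have "?V \<in> borel_measurable (borel \<Otimes>\<^sub>M borel)"
      unfolding borel_prod by measurable
    then show ?thesis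
      by measurable
  qed
  define A where "A = (\<integral>u. of_real (indicator {-\<delta>..\<delta>} u * exp (- pi * u\<^sup>2)) * cis (2 * pi * snd \<gamma> * u) * f (t - u) \<partial>lborel)"
  define B where "B = (\<integral>v. of_real (indicator {-\<delta>..\<delta>} v / (2 * \<delta>)) * cis (2 * pi * (t - fst \<gamma>) * v) \<partial>lborel)"
  let ?k = "((1 + 1 / \<delta>) / gauss_mass \<delta>)\<^sup>2 / (1 + \<bar>t - fst \<gamma>\<bar>)\<^sup>2"
  have "localizer \<delta> \<gamma> f t = A / gauss_mass \<delta> * B"
    unfolding A_def B_def by (rule localizer_eq[OF f])
  then have "(norm (localizer \<delta> \<gamma> f t))\<^sup>2 = (norm A)\<^sup>2 * ((norm B)\<^sup>2 / (gauss_mass \<delta>)\<^sup>2)"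
    by (simp add: norm_mult norm_divide power_mult_distrib power_divide)
  also have "\<dots> \<le> (norm A)\<^sup>2 * (((1 + 1 / \<delta>) / (1 + \<bar>t - fst \<gamma>\<bar>))\<^sup>2 / (gauss_mass \<delta>)\<^sup>2)"
    using norm_integral_cis_le[OF \<delta>, of "t - fst \<gamma>"] unfolding B_def
    by (intro mult_left_mono divide_right_mono power_mono) auto
  also have "\<dots> = ?k * (norm A)\<^sup>2"
    by (simp add: power_divide mult_ac)
  finally have "ennreal ((norm (localizer \<delta> \<gamma> f t))\<^sup>2) \<le> ennreal ?k * ennreal ((norm A)\<^sup>2)"
    by (simp add: ennreal_leI flip: ennreal_mult)
  also have "\<dots> \<le> ennreal ?k * (\<integral>\<^sup>+y. ennreal (exp (- pi * (y - snd \<gamma>)\<^sup>2) * (norm (?V (t, y)))\<^sup>2) \<partial>lborel)"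
    unfolding A_def by (intro mult_left_mono frequency_cutoff_le[OF f]) simp
  also have "\<dots> = (\<integral>\<^sup>+y. ennreal (?k * (exp (- pi * (y - snd \<gamma>)\<^sup>2) * (norm (?V (t, y)))\<^sup>2)) \<partial>lborel)"
    by (subst nn_integral_cmult[symmetric]) (auto simp flip: ennreal_mult)
  also have "\<dots> \<le> (\<integral>\<^sup>+y. ennreal (2 * ((1 + 1 / \<delta>) / gauss_mass \<delta>)\<^sup>2)
      * ennreal (product_decay 2 ((t, y) - \<gamma>) * (norm (?V (t, y)))\<^sup>2) \<partial>lborel)"
  proof (rule nn_integral_mono)
    fix y
    have "?k * (exp (- pi * (y - snd \<gamma>)\<^sup>2) * (norm (?V (t, y)))\<^sup>2)
        \<le> ?k * (2 / (1 + \<bar>y - snd \<gamma>\<bar>)\<^sup>2 * (norm (?V (t, y)))\<^sup>2)"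
      by (intro mult_left_mono mult_right_mono exp_le_decay) auto
    also have "\<dots> = 2 * ((1 + 1 / \<delta>) / gauss_mass \<delta>)\<^sup>2 * (product_decay 2 ((t, y) - \<gamma>) * (norm (?V (t, y)))\<^sup>2)"
      by (simp add: product_decay_def powr_minus power_mult_distrib divide_inverse)
    finally show "ennreal (?k * (exp (- pi * (y - snd \<gamma>)\<^sup>2) * (norm (?V (t, y)))\<^sup>2))
        \<le> ennreal (2 * ((1 + 1 / \<delta>) / gauss_mass \<delta>)\<^sup>2) * ennreal (product_decay 2 ((t, y) - \<gamma>) * (norm (?V (t, y)))\<^sup>2)"
      by (simp add: ennreal_leI product_decay_def flip: ennreal_mult)
  qed
  also have "\<dots> = ennreal (2 * ((1 + 1 / \<delta>) / gauss_mass \<delta>)\<^sup>2)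
      * (\<integral>\<^sup>+y. ennreal (product_decay 2 ((t, y) - \<gamma>) * (norm (?V (t, y)))\<^sup>2) \<partial>lborel)"
    by (rule nn_integral_cmult) (simp add: product_decay_def)
  finally show ?thesis .
qed

text \<open>Summing inside the integral leaves a uniformly bounded sum of weights, and the isometry
  for the interval window evaluates the rest. The bound is an almost-orthogonality statement for the
  localizers; \<open>C\<close> depends on \<open>\<delta>\<close>.\<close>

lemma localizer_sum_le:
  assumes \<Gamma>: "discrete_set \<Gamma>"
  obtains C where "0 < C" "\<And>f F. square_integrable f \<Longrightarrow> finite F \<Longrightarrow> F \<subseteq> \<Gamma>
    \<Longrightarrow> (\<Sum>\<gamma>\<in>F. (L2_norm (localizer \<delta> \<gamma> f))\<^sup>2) \<le> C * (L2_norm f)\<^sup>2"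
proof -
  let ?w = "\<lambda>u. complex_of_real (indicator {-\<delta>..\<delta>} u)"
  obtain D where D: "0 < D" "\<And>z F. finite F \<Longrightarrow> F \<subseteq> \<Gamma> \<Longrightarrow> (\<Sum>\<gamma>\<in>F. product_decay 2 (z - \<gamma>)) \<le> D"
    using product_decay_sum_bounded[OF \<Gamma>, of 2] by auto
  define K where "K = 2 * ((1 + 1 / \<delta>) / gauss_mass \<delta>)\<^sup>2"
  have K: "0 < K"
    unfolding K_def
    by (intro mult_pos_pos zero_less_power divide_pos_pos gauss_mass_pos add_pos_pos) (use \<delta> in auto)
  define C where "C = K * D * ((L2_norm ?w)\<^sup>2 + 1)"
  have C: "0 < C"
    using K D by (simp add: C_def add_nonneg_pos)
  have "(\<Sum>\<gamma>\<in>F. (L2_norm (localizer \<delta> \<gamma> f))\<^sup>2) \<le> C * (L2_norm f)\<^sup>2"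
    if f: "square_integrable f" and F: "finite F" "F \<subseteq> \<Gamma>" for f F
  proof -
    let ?V = "STFT ?w f"
    have [measurable]: "f \<in> borel_measurable borel"
      using f by auto
    have V [measurable]: "?V \<in> borel_measurable (borel \<Otimes>\<^sub>M borel)"
      unfolding borel_prod by measurable
    have "ennreal (\<Sum>\<gamma>\<in>F. (L2_norm (localizer \<delta> \<gamma> f))\<^sup>2)
        = (\<Sum>\<gamma>\<in>F. \<integral>\<^sup>+t. ennreal ((norm (localizer \<delta> \<gamma> f t))\<^sup>2) \<partial>lborel)"
      by (simp add: nn_integral_square square_integrable_localizer f)
    also have "\<dots> \<le> (\<Sum>\<gamma>\<in>F. \<integral>\<^sup>+t. ennreal K
        * (\<integral>\<^sup>+y. ennreal (product_decay 2 ((t, y) - \<gamma>) * (norm (?V (t, y)))\<^sup>2) \<partial>lborel) \<partial>lborel)"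
      unfolding K_def by (intro sum_mono nn_integral_mono localizer_pointwise_le f)
    also have "\<dots> = ennreal K * (\<integral>\<^sup>+t. \<integral>\<^sup>+y.
        (\<Sum>\<gamma>\<in>F. ennreal (product_decay 2 ((t, y) - \<gamma>) * (norm (?V (t, y)))\<^sup>2)) \<partial>lborel \<partial>lborel)"
      by (simp add: product_decay_def nn_integral_cmult nn_integral_sum flip: sum_distrib_left del: sum_ennreal)
    also have "\<dots> \<le> ennreal K * (\<integral>\<^sup>+t. \<integral>\<^sup>+y. ennreal D * ennreal ((norm (?V (t, y)))\<^sup>2) \<partial>lborel \<partial>lborel)"
    proof (intro mult_left_mono nn_integral_mono)
      fix t y
      have "(\<Sum>\<gamma>\<in>F. ennreal (product_decay 2 ((t, y) - \<gamma>) * (norm (?V (t, y)))\<^sup>2))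
          = ennreal ((\<Sum>\<gamma>\<in>F. product_decay 2 ((t, y) - \<gamma>)) * (norm (?V (t, y)))\<^sup>2)"
        by (simp add: product_decay_def sum_ennreal sum_distrib_right)
      also have "\<dots> \<le> ennreal (D * (norm (?V (t, y)))\<^sup>2)"
        by (intro ennreal_leI mult_right_mono D F) simp
      finally show "(\<Sum>\<gamma>\<in>F. ennreal (product_decay 2 ((t, y) - \<gamma>) * (norm (?V (t, y)))\<^sup>2))
          \<le> ennreal D * ennreal ((norm (?V (t, y)))\<^sup>2)"
        using D by (simp add: ennreal_mult)
    qed simp
    also have "\<dots> = ennreal K * (ennreal D * (\<integral>\<^sup>+z. ennreal ((norm (?V z))\<^sup>2) \<partial>lborel))"
      by (subst nn_integral_lborel_pair) (simp_all add: nn_integral_cmult)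
    also have "\<dots> = ennreal (K * D * (L2_norm ?w)\<^sup>2 * (L2_norm f)\<^sup>2)"
      unfolding STFT_isometry[OF square_integrable_interval f]
      using K D by (simp add: ennreal_mult mult_ac)
    finally have "(\<Sum>\<gamma>\<in>F. (L2_norm (localizer \<delta> \<gamma> f))\<^sup>2) \<le> K * D * (L2_norm ?w)\<^sup>2 * (L2_norm f)\<^sup>2"
      using K D by (subst (asm) ennreal_le_iff) auto
    also have "\<dots> \<le> C * (L2_norm f)\<^sup>2"
      unfolding C_def using K D by (intro mult_right_mono mult_left_mono) auto
    finally show ?thesis .
  qed
  with C show thesis
    by (rule that)
qed

end

subsection \<open>Remainders of localization\<close>

text \<open>The window that results when a time-frequency shift of the signal is moved to the other side of
  the inner product; it is \<open>tf_shift (- \<xi>) \<phi>\<close> up to a constant phase.\<close>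

definition dual_shift :: "real \<times> real \<Rightarrow> (real \<Rightarrow> complex) \<Rightarrow> real \<Rightarrow> complex" where
  "dual_shift \<xi> \<phi> t = cis (- (2 * pi * (snd \<xi> * (t + fst \<xi>)))) * \<phi> (t + fst \<xi>)"

text \<open>The commutation relation of time-frequency shifts, obtained by the substitution
  \<open>t = s + fst \<xi>\<close>. Moving the shift from the signal to the window costs only a
  unimodular phase.\<close>

lemma L2_inner_tf_shift_tf_shift:
  "L2_inner (tf_shift \<xi> f) (tf_shift z \<phi>)
    = cis (2 * pi * (snd \<xi> * fst z - snd z * fst \<xi>)) * STFT (dual_shift \<xi> \<phi>) f z"
proof -
  have "L2_inner (tf_shift \<xi> f) (tf_shift z \<phi>)
      = (\<integral>s. tf_shift \<xi> f (s + fst \<xi>) * cnj (tf_shift z \<phi> (s + fst \<xi>)) \<partial>lborel)"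
    unfolding L2_inner_def
    using lborel_integral_real_affine[of 1 "\<lambda>t. tf_shift \<xi> f t * cnj (tf_shift z \<phi> t)" "fst \<xi>"]
    by (simp add: add.commute)
  also have "\<dots> = (\<integral>s. cis (2 * pi * (snd \<xi> * fst z - snd z * fst \<xi>))
      * (f s * cnj (tf_shift z (dual_shift \<xi> \<phi>) s)) \<partial>lborel)"
  proof (rule Bochner_Integration.integral_cong)
    fix s
    have "cis (2 * pi * (snd \<xi> * (s + fst \<xi>))) * cis (- (2 * pi * (snd z * (s + fst \<xi>))))
        = cis (2 * pi * (snd \<xi> * fst z - snd z * fst \<xi>)) * (cis (- (2 * pi * (snd z * s)))
          * cis (2 * pi * (snd \<xi> * (s - fst z + fst \<xi>))))"
      unfolding cis_mult by (simp add: algebra_simps)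
    then show "tf_shift \<xi> f (s + fst \<xi>) * cnj (tf_shift z \<phi> (s + fst \<xi>))
        = cis (2 * pi * (snd \<xi> * fst z - snd z * fst \<xi>)) * (f s * cnj (tf_shift z (dual_shift \<xi> \<phi>) s))"
      by (simp add: tf_shift_cis dual_shift_def cis_cnj add_diff_eq diff_add_eq mult_ac)
  qed simp
  finally show ?thesis
    by (simp add: STFT_def L2_inner_def)
qed

lemma square_integrable_dual_shift:
  assumes "square_integrable \<phi>"
  shows "square_integrable (dual_shift \<xi> \<phi>)"
proof -
  have [measurable]: "\<phi> \<in> borel_measurable borel"
    using assms by auto
  have "square_integrable (\<lambda>t. \<phi> (t + fst \<xi>))"
    using square_integrable_tf_shift[OF assms, of "(- fst \<xi>, 0)"] by (simp add: tf_shift_def[abs_def])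
  then show ?thesis
    by (auto simp: square_integrable_def dual_shift_def[abs_def] norm_mult)
qed

text \<open>The difference splits into a translation error \<open>a\<close>, handled by continuity
  of translation in L2, and a modulation error \<open>b\<close>, which tends to 0 pointwise and
  whose square is dominated by \<open>4 * (norm (\<phi> t))\<^sup>2\<close>.\<close>

lemma tendsto_dual_shift:
  assumes \<phi>: "square_integrable \<phi>" and \<xi>: "\<xi> \<longlonglongrightarrow> 0"
  shows "(\<lambda>n. (L2_norm (\<lambda>t. dual_shift (\<xi> n) \<phi> t - \<phi> t))\<^sup>2) \<longlonglongrightarrow> 0"
proof -
  have [measurable]: "\<phi> \<in> borel_measurable borel"
    using \<phi> by auto
  have u: "(\<lambda>n. fst (\<xi> n)) \<longlonglongrightarrow> 0" and v: "(\<lambda>n. snd (\<xi> n)) \<longlonglongrightarrow> 0"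
    using tendsto_fst[OF \<xi>] tendsto_snd[OF \<xi>] by simp_all
  define c where "c n t = cis (- (2 * pi * (snd (\<xi> n) * (t + fst (\<xi> n)))))" for n t
  define a where "a n t = c n t * (\<phi> (t + fst (\<xi> n)) - \<phi> t)" for n t
  define b where "b n t = (c n t - 1) * \<phi> t" for n t
  have [measurable]: "c n \<in> borel_measurable borel" for n
    unfolding c_def[abs_def] by measurable
  have shift: "square_integrable (\<lambda>t. \<phi> (t + x))" for x
    using square_integrable_tf_shift[OF \<phi>, of "(- x, 0)"] by (simp add: tf_shift_def[abs_def])
  have norm_c: "norm (c n t) = 1" for n t
    by (simp add: c_def)
  have norm_b: "(norm (b n t))\<^sup>2 \<le> 4 * (norm (\<phi> t))\<^sup>2" for n t
  proof -
    have "norm (c n t - 1) \<le> 2"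
      using norm_triangle_ineq4[of "c n t" 1] norm_c by simp
    then have "(norm (c n t - 1) * norm (\<phi> t))\<^sup>2 \<le> (2 * norm (\<phi> t))\<^sup>2"
      by (intro power_mono mult_right_mono) auto
    then show ?thesis
      by (simp add: b_def norm_mult power_mult_distrib)
  qed
  have a: "square_integrable (a n)" for n
    using square_integrable_diff[OF shift \<phi>, of "fst (\<xi> n)"]
    by (auto simp: square_integrable_def a_def[abs_def] norm_mult norm_c)
  have b: "square_integrable (b n)" for n
    unfolding square_integrable_def
  proof
    show m: "b n \<in> borel_measurable lborel"
      unfolding b_def[abs_def] by measurable
    show "integrable lborel (\<lambda>t. (norm (b n t))\<^sup>2)"
    proof (rule Bochner_Integration.integrable_bound)
      show "integrable lborel (\<lambda>t. 4 * (norm (\<phi> t))\<^sup>2)"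
        using \<phi> by (simp add: square_integrable_def)
      show "(\<lambda>t. (norm (b n t))\<^sup>2) \<in> borel_measurable lborel"
        using m by measurable
      show "AE t in lborel. norm ((norm (b n t))\<^sup>2) \<le> norm (4 * (norm (\<phi> t))\<^sup>2)"
        using norm_b[of n] by (intro AE_I2) simp
    qed
  qed
  have "(\<lambda>n. (L2_norm (\<lambda>t. \<phi> (t + fst (\<xi> n)) - \<phi> t))\<^sup>2) \<longlonglongrightarrow> 0\<^sup>2"
    by (intro tendsto_power translation_L2 \<phi> u)
  moreover have "L2_norm (a n) = L2_norm (\<lambda>t. \<phi> (t + fst (\<xi> n)) - \<phi> t)" for n
    by (simp add: L2_norm_def a_def norm_mult norm_c)
  ultimately have lim_a: "(\<lambda>n. (L2_norm (a n))\<^sup>2) \<longlonglongrightarrow> 0"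
    by simp
  have "(\<lambda>n. \<integral>t. (norm (b n t))\<^sup>2 \<partial>lborel) \<longlonglongrightarrow> (\<integral>t. 0 \<partial>(lborel :: real measure))"
  proof (rule integral_dominated_convergence[where w = "\<lambda>t. 4 * (norm (\<phi> t))\<^sup>2"])
    show "AE t in lborel. (\<lambda>n. (norm (b n t))\<^sup>2) \<longlonglongrightarrow> 0"
    proof (rule AE_I2)
      fix t :: real
      have "(\<lambda>n. (norm ((cis (- (2 * pi * (snd (\<xi> n) * (t + fst (\<xi> n))))) - 1) * \<phi> t))\<^sup>2)
          \<longlonglongrightarrow> (norm ((cis (- (2 * pi * (0 * (t + 0)))) - 1) * \<phi> t))\<^sup>2"
        by (intro tendsto_intros u v)
      then show "(\<lambda>n. (norm (b n t))\<^sup>2) \<longlonglongrightarrow> 0"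
        by (simp add: b_def c_def)
    qed
    show "integrable lborel (\<lambda>t. 4 * (norm (\<phi> t))\<^sup>2)"
      using \<phi> by (simp add: square_integrable_def)
    show "(\<lambda>t. (norm (b n t))\<^sup>2) \<in> borel_measurable lborel" for n
      using square_integrable_measurable[OF b[of n]] by measurable
    show "AE t in lborel. norm ((norm (b n t))\<^sup>2) \<le> 4 * (norm (\<phi> t))\<^sup>2" for n
      using norm_b[of n] by (intro AE_I2) simp
  qed simp
  then have lim_b: "(\<lambda>n. (L2_norm (b n))\<^sup>2) \<longlonglongrightarrow> 0"
    by (simp add: L2_norm_squared)
  show ?thesis
  proof (rule tendsto_sandwich[OF _ _ tendsto_const])
    show "(\<lambda>n. 2 * (L2_norm (a n))\<^sup>2 + 2 * (L2_norm (b n))\<^sup>2) \<longlonglongrightarrow> 0"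
      using tendsto_add[OF tendsto_mult_left[OF lim_a, of 2] tendsto_mult_left[OF lim_b, of 2]] by simp
    have "(\<lambda>t. dual_shift (\<xi> n) \<phi> t - \<phi> t) = (\<lambda>t. a n t + b n t)" for n
      by (simp add: dual_shift_def a_def b_def c_def algebra_simps)
    then show "\<forall>\<^sub>F n in sequentially. (L2_norm (\<lambda>t. dual_shift (\<xi> n) \<phi> t - \<phi> t))\<^sup>2
        \<le> 2 * (L2_norm (a n))\<^sup>2 + 2 * (L2_norm (b n))\<^sup>2"
      using L2_norm_add_squared_le[OF a b] by simp
  qed simp
qed

text \<open>Strong continuity at the origin, made uniform over a square of shifts: violations at the
  scales \<open>1 / (n + 1)\<close> would form a sequence of shifts tending to 0.\<close>

lemma dual_shift_small:
  assumes \<phi>: "square_integrable \<phi>" and e: "0 < e"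
  obtains \<delta> where "0 < \<delta>"
    "\<And>\<xi>. \<bar>fst \<xi>\<bar> \<le> \<delta> \<Longrightarrow> \<bar>snd \<xi>\<bar> \<le> \<delta> \<Longrightarrow> (L2_norm (\<lambda>t. dual_shift \<xi> \<phi> t - \<phi> t))\<^sup>2 \<le> e"
proof (rule ccontr)
  assume no: "\<not> thesis"
  have "\<exists>\<xi>. \<bar>fst \<xi>\<bar> \<le> 1 / real (Suc n) \<and> \<bar>snd \<xi>\<bar> \<le> 1 / real (Suc n)
      \<and> e < (L2_norm (\<lambda>t. dual_shift \<xi> \<phi> t - \<phi> t))\<^sup>2" for n
    using that[of "1 / real (Suc n)"] no by (force simp: not_le)
  then obtain \<xi> where \<xi>: "\<And>n. \<bar>fst (\<xi> n)\<bar> \<le> 1 / real (Suc n)" "\<And>n. \<bar>snd (\<xi> n)\<bar> \<le> 1 / real (Suc n)"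
    "\<And>n. e < (L2_norm (\<lambda>t. dual_shift (\<xi> n) \<phi> t - \<phi> t))\<^sup>2"
    by metis
  have 0: "(\<lambda>n. 1 / real (Suc n)) \<longlonglongrightarrow> 0"
    by (rule lim_1_over_n[THEN LIMSEQ_Suc])
  have "(\<lambda>n. fst (\<xi> n)) \<longlonglongrightarrow> 0" "(\<lambda>n. snd (\<xi> n)) \<longlonglongrightarrow> 0"
    using \<xi>(1,2) by (auto intro!: tendsto_0_le[OF 0, of _ 1] always_eventually simp: abs_le_iff)
  then have "(\<lambda>n. (fst (\<xi> n), snd (\<xi> n))) \<longlonglongrightarrow> (0, 0)"
    by (rule tendsto_Pair)
  then have "\<xi> \<longlonglongrightarrow> 0"
    by (simp add: zero_prod_def)
  from LIMSEQ_le_const[OF tendsto_dual_shift[OF \<phi> this], of e] have "e \<le> 0"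
    using \<xi>(3) by (auto intro: less_imp_le)
  with e show False
    by simp
qed

text \<open>Interpolation between the quadratic bound for small angles and the trivial bound 4 for
  large ones. A small \<open>\<sigma>\<close> gives a growth in \<theta> that slowly decaying
  symbols can still absorb.\<close>

lemma norm_one_minus_cis_le:
  assumes "0 \<le> \<sigma>" "\<sigma> \<le> 2"
  shows "(norm (1 - cis \<theta>))\<^sup>2 \<le> 4 * \<bar>\<theta>\<bar> powr \<sigma>"
proof (cases "\<theta> = 0")
  case False
  have "(norm (1 - cis \<theta>))\<^sup>2 = (1 - cos \<theta>)\<^sup>2 + (sin \<theta>)\<^sup>2"
    by (simp add: cmod_power2)
  also have "\<dots> = 2 - 2 * cos \<theta>"
    using sin_cos_squared_add[of \<theta>] by (simp add: power2_diff)
  also have "\<dots> = 4 * (sin (\<theta> / 2))\<^sup>2"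
    using cos_double_sin[of "\<theta> / 2"] by simp
  also have "\<dots> \<le> 4 * \<bar>\<theta>\<bar> powr \<sigma>"
  proof (cases "\<bar>\<theta>\<bar> \<le> 1")
    case True
    have "\<bar>sin (\<theta> / 2)\<bar> \<le> \<bar>\<theta>\<bar>"
      using abs_sin_x_le_abs_x[of "\<theta> / 2"] by simp
    then have "(sin (\<theta> / 2))\<^sup>2 \<le> \<bar>\<theta>\<bar> powr 2"
      using False by (simp add: abs_le_square_iff)
    also have "\<dots> \<le> \<bar>\<theta>\<bar> powr \<sigma>"
      using assms True by (intro powr_mono') auto
    finally show ?thesis
      by simp
  next
    case large: False
    have "(sin (\<theta> / 2))\<^sup>2 \<le> 1"
      by (simp add: abs_square_le_1)
    also have "1 \<le> \<bar>\<theta>\<bar> powr \<sigma>"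
      using large assms by (intro ge_one_powr_ge_zero) auto
    finally show ?thesis
      by simp
  qed
  finally show ?thesis .
qed simp

text \<open>Since the density has integral 1, the STFT of \<open>f\<close> itself is an average of
  constants over \<xi>, and the remainder becomes an average of differences that are small for small
  \<xi> and \<open>z\<close> near \<gamma>.\<close>

lemma STFT_localizer_remainder:
  assumes \<delta>: "0 < \<delta>" and \<phi>: "square_integrable \<phi>" and f: "square_integrable f"
  shows "STFT \<phi> (\<lambda>t. f t - localizer \<delta> \<gamma> f t) z
    = (\<integral>\<xi>. of_real (window_density \<delta> \<xi>) * (STFT \<phi> f z
        - cis (2 * pi * ((snd \<gamma> - snd z) * fst \<xi> + (fst z - fst \<gamma>) * snd \<xi>)) * STFT (dual_shift \<xi> \<phi>) f z) \<partial>lborel)"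
    (is "_ = (\<integral>\<xi>. of_real (window_density \<delta> \<xi>) * (_ - ?X \<xi>) \<partial>lborel)")
proof -
  let ?w = "\<lambda>\<xi>. complex_of_real (window_density \<delta> \<xi>)"
  let ?W = "\<lambda>\<xi>. ?w \<xi> * cis (2 * pi * (snd \<gamma> * fst \<xi> - fst \<gamma> * snd \<xi>))"
  have [measurable]: "\<phi> \<in> borel_measurable borel" "f \<in> borel_measurable borel"
    using \<phi> f by auto
  note L = square_integrable_localizer[OF \<delta> f]
  have eq: "?W \<xi> * L2_inner (tf_shift \<xi> f) (tf_shift z \<phi>) = ?w \<xi> * ?X \<xi>" for \<xi>
  proof -
    have "cis (2 * pi * (snd \<gamma> * fst \<xi> - fst \<gamma> * snd \<xi>)) * cis (2 * pi * (snd \<xi> * fst z - snd z * fst \<xi>))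
        = cis (2 * pi * ((snd \<gamma> - snd z) * fst \<xi> + (fst z - fst \<gamma>) * snd \<xi>))"
      unfolding cis_mult by (simp add: algebra_simps)
    then show ?thesis
      by (simp add: L2_inner_tf_shift_tf_shift flip: mult.assoc)
  qed
  have int_w: "integrable lborel ?w"
    using integrable_window_density[OF \<delta>] by (simp only: complex_of_real_integrable_eq)
  have int_X: "integrable lborel (\<lambda>\<xi>. ?w \<xi> * ?X \<xi>)"
  proof (rule Bochner_Integration.integrable_bound)
    show "integrable lborel (\<lambda>\<xi>. (L2_norm f * L2_norm \<phi>) * window_density \<delta> \<xi>)"
      using integrable_window_density[OF \<delta>] by simp
    have "(\<lambda>\<xi>. L2_inner (tf_shift \<xi> f) (tf_shift z \<phi>)) \<in> borel_measurable borel"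
      unfolding L2_inner_def by (rule borel_measurable_lborel_integral) measurable
    then show "(\<lambda>\<xi>. ?w \<xi> * ?X \<xi>) \<in> borel_measurable lborel"
      unfolding eq[symmetric] 
      using borel_measurable_integrable[OF integrable_localizer_weight[OF \<delta>, of \<gamma>]] by measurable
    have "norm (?w \<xi> * ?X \<xi>) \<le> norm ((L2_norm f * L2_norm \<phi>) * window_density \<delta> \<xi>)" for \<xi>
      using norm_L2_inner_le[OF square_integrable_tf_shift[OF f] square_integrable_tf_shift[OF \<phi>], of \<xi> z]
      by (auto simp: eq[symmetric] norm_mult L2_norm_tf_shift f \<phi> abs_mult mult.commute[of _ "window_density _ _"]
          abs_of_nonneg window_density_nonneg[OF \<delta>] intro!: mult_left_mono)
    then show "AE \<xi> in lborel. norm (?w \<xi> * ?X \<xi>) \<le> norm ((L2_norm f * L2_norm \<phi>) * window_density \<delta> \<xi>)"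
      by simp
  qed
  have "(\<integral>\<xi>. ?w \<xi> * STFT \<phi> f z \<partial>lborel) = STFT \<phi> f z"
    using integral_window_density[OF \<delta>] by (simp del: of_real_eq_1_iff)
  moreover have "STFT \<phi> (localizer \<delta> \<gamma> f) z = (\<integral>\<xi>. ?w \<xi> * ?X \<xi> \<partial>lborel)"
  proof -
    have "STFT \<phi> (localizer \<delta> \<gamma> f) z = L2_inner (tf_average ?W f) (tf_shift z \<phi>)"
      by (simp add: STFT_def localizer_def)
    also have "\<dots> = (\<integral>\<xi>. ?w \<xi> * ?X \<xi> \<partial>lborel)"
      using L2_inner_tf_average[OF integrable_localizer_weight[OF \<delta>, of \<gamma>] f square_integrable_tf_shift[OF \<phi>], of z]
      by (simp only: eq)
    finally show ?thesis .
  qed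
  ultimately show ?thesis
    using int_w int_X by (simp add: STFT_diff[OF \<phi> f L] right_diff_distrib)
qed

lemma measurable_fst_borel [measurable (raw)]:
  fixes f :: "'c \<Rightarrow> 'a::second_countable_topology \<times> 'b::second_countable_topology"
  shows "f \<in> M \<rightarrow>\<^sub>M borel \<Longrightarrow> (\<lambda>x. fst (f x)) \<in> M \<rightarrow>\<^sub>M borel"
  by (auto simp: borel_prod[symmetric])

lemma measurable_snd_borel [measurable (raw)]:
  fixes f :: "'c \<Rightarrow> 'a::second_countable_topology \<times> 'b::second_countable_topology"
  shows "f \<in> M \<rightarrow>\<^sub>M borel \<Longrightarrow> (\<lambda>x. snd (f x)) \<in> M \<rightarrow>\<^sub>M borel"
  by (auto simp: borel_prod[symmetric])

lemma measurable_STFT_dual_shift: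
  assumes [measurable]: "\<phi> \<in> borel_measurable borel" "f \<in> borel_measurable borel"
  shows "(\<lambda>(z, \<xi>). STFT (dual_shift \<xi> \<phi>) f z) \<in> borel_measurable (borel \<Otimes>\<^sub>M borel)"
  unfolding STFT_def L2_inner_def tf_shift_cis dual_shift_def case_prod_beta
  by (rule borel_measurable_lborel_integral) measurable

text \<open>Each difference under the average has two parts. The phase error costs a power
  \<open>\<sigma>\<close> of the distance to \<gamma>, absorbed by the decay of the symbols. The
  window error does not depend on \<gamma> and is small by the isometry and continuity of shifts.
  Both sums over \<gamma> are bounded uniformly, so a small \<open>\<delta>\<close> makes the whole
  sum small.\<close>

lemma localizer_remainder_sum:
  assumes \<Gamma>: "discrete_set \<Gamma>" and r: "1 < r" and C: "0 < C"
    and \<eta>: "\<And>\<gamma> z. \<gamma> \<in> \<Gamma> \<Longrightarrow> 0 \<le> \<eta> \<gamma> z" "\<And>\<gamma> z. \<gamma> \<in> \<Gamma> \<Longrightarrow> \<eta> \<gamma> z \<le> C * product_decay r (z - \<gamma>)"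
    and \<eta>_meas: "\<And>\<gamma>. \<gamma> \<in> \<Gamma> \<Longrightarrow> \<eta> \<gamma> \<in> borel_measurable borel"
    and \<phi>: "square_integrable \<phi>" and e: "0 < e"
  obtains \<delta> where "0 < \<delta>" "\<And>f F. square_integrable f \<Longrightarrow> finite F \<Longrightarrow> F \<subseteq> \<Gamma> \<Longrightarrow>
    (\<Sum>\<gamma>\<in>F. \<integral>\<^sup>+z. ennreal (\<eta> \<gamma> z * (norm (STFT \<phi> (\<lambda>t. f t - localizer \<delta> \<gamma> f t) z))\<^sup>2) \<partial>lborel)
      \<le> ennreal (e * (L2_norm f)\<^sup>2)"
proof -
  \<comment> \<open>At most half of the excess \<open>r - 1\<close> is spent, so the weight of
    exponent \<open>r - \<sigma>\<close> is still summable.\<close>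
  define \<sigma> where "\<sigma> = min 1 ((r - 1) / 2)"
  have \<sigma>: "0 < \<sigma>" "\<sigma> \<le> 2" "1 < r - \<sigma>"
    using r by (auto simp: \<sigma>_def min_def field_simps)
  obtain D1 where D1: "0 < D1" "\<And>z F. finite F \<Longrightarrow> F \<subseteq> \<Gamma> \<Longrightarrow> (\<Sum>\<gamma>\<in>F. product_decay r (z - \<gamma>)) \<le> D1"
    using product_decay_sum_bounded[OF \<Gamma> r] by auto
  obtain D2 where D2: "0 < D2" "\<And>z F. finite F \<Longrightarrow> F \<subseteq> \<Gamma> \<Longrightarrow> (\<Sum>\<gamma>\<in>F. product_decay (r - \<sigma>) (z - \<gamma>)) \<le> D2"
    using product_decay_sum_bounded[OF \<Gamma> \<sigma>(3)] by auto
  \<comment> \<open>With these values the window error contributes exactly \<open>e / 2\<close>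
    through \<open>B * e1\<close>, and the phase error at most \<open>e / 2\<close> through
    \<open>A\<close>.\<close>
  define e1 where "e1 = e / (4 * C * D1)"
  define e2 where "e2 = e / (16 * C * D2 * ((L2_norm \<phi>)\<^sup>2 + 1))"
  have e12: "0 < e1" "0 < e2"
    using e C D1 D2 by (auto simp: e1_def e2_def add_nonneg_pos)
  obtain \<delta>1 where \<delta>1: "0 < \<delta>1"
    "\<And>\<xi>. \<bar>fst \<xi>\<bar> \<le> \<delta>1 \<Longrightarrow> \<bar>snd \<xi>\<bar> \<le> \<delta>1 \<Longrightarrow> (L2_norm (\<lambda>t. dual_shift \<xi> \<phi> t - \<phi> t))\<^sup>2 \<le> e1"
    using dual_shift_small[OF \<phi> e12(1)] by auto
  \<comment> \<open>The second bound is the solution of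
    \<open>(2 * pi * \<delta>) powr \<sigma> = e2\<close>; on the support of the density the angle
    is at most \<open>2 * pi * \<delta> * p\<close>.\<close>
  define \<delta> where "\<delta> = min \<delta>1 (e2 powr (1 / \<sigma>) / (2 * pi))"
  have \<delta>: "0 < \<delta>" "\<delta> \<le> \<delta>1"
    using \<delta>1(1) e12 by (auto simp: \<delta>_def)
  have "2 * pi * \<delta> \<le> e2 powr (1 / \<sigma>)"
    by (simp add: \<delta>_def min_def field_simps)
  then have "(2 * pi * \<delta>) powr \<sigma> \<le> (e2 powr (1 / \<sigma>)) powr \<sigma>"
    using \<delta> \<sigma> by (intro powr_mono2) auto
  then have \<delta>_e2: "(2 * pi * \<delta>) powr \<sigma> \<le> e2"
    using \<sigma> e12 by (simp add: powr_powr)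
  define \<psi> where "\<psi> \<xi> = (\<lambda>t. dual_shift \<xi> \<phi> t - \<phi> t)" for \<xi>
  have \<psi>: "square_integrable (\<psi> \<xi>)" for \<xi>
    unfolding \<psi>_def by (rule square_integrable_diff[OF square_integrable_dual_shift[OF \<phi>] \<phi>])
  define A where "A = 8 * e2 * C * D2"
  define B where "B = 2 * C * D1"
  have AB: "0 \<le> A" "0 \<le> B"
    using e12 C D1 D2 by (auto simp: A_def B_def)
  have total: "A * (L2_norm \<phi>)\<^sup>2 + B * e1 \<le> e"
  proof -
    have "A * (L2_norm \<phi>)\<^sup>2 \<le> A * ((L2_norm \<phi>)\<^sup>2 + 1)"
      using AB by (intro mult_left_mono) auto
    also have "\<dots> = e / 2"
    proof -
      have "(L2_norm \<phi>)\<^sup>2 + 1 \<noteq> 0"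
        by (metis add_nonneg_pos less_numeral_extra(1,3) zero_le_power2)
      moreover have "8 * (e / (16 * C * D2 * N)) * C * D2 * N = e / 2" if "N \<noteq> 0" for N
        using that C D2 by simp
      ultimately show ?thesis
        unfolding A_def e2_def by blast
    qed
    finally show ?thesis
      using C D1 by (simp add: B_def e1_def)
  qed
  have "(\<Sum>\<gamma>\<in>F. \<integral>\<^sup>+z. ennreal (\<eta> \<gamma> z * (norm (STFT \<phi> (\<lambda>t. f t - localizer \<delta> \<gamma> f t) z))\<^sup>2) \<partial>lborel)
      \<le> ennreal (e * (L2_norm f)\<^sup>2)"
    if f: "square_integrable f" and F: "finite F" "F \<subseteq> \<Gamma>" for f F
  proof -
    have [measurable]: "\<phi> \<in> borel_measurable borel" "f \<in> borel_measurable borel"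
      using \<phi> f by auto
    note [measurable] = measurable_STFT_dual_shift borel_measurable_window_density[OF \<delta>(1)]
    have \<eta>_F [measurable]: "\<eta> \<gamma> \<in> borel_measurable borel" if "\<gamma> \<in> F" for \<gamma>
      by (rule \<eta>_meas[OF subsetD[OF F(2) that]])
    let ?w = "window_density \<delta>" and ?V = "STFT \<phi> f"
    define X where "X \<gamma> z \<xi> = STFT \<phi> f z - cis (2 * pi * ((snd \<gamma> - snd z) * fst \<xi> + (fst z - fst \<gamma>) * snd \<xi>))
        * STFT (dual_shift \<xi> \<phi>) f z" for \<gamma> z \<xi>
    define U where "U z \<xi> = STFT (\<psi> \<xi>) f z" for z \<xi>
    have dual_meas [measurable]: "(\<lambda>x. STFT (dual_shift (h x) \<phi>) f (g x)) \<in> borel_measurable M"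
      if "g \<in> M \<rightarrow>\<^sub>M borel" "h \<in> M \<rightarrow>\<^sub>M borel" for g h and M :: "'c measure"
      using measurable_compose[OF measurable_Pair[OF that] measurable_STFT_dual_shift[of \<phi> f]] by simp
    have X_meas [measurable]: "(\<lambda>(z, \<xi>). X \<gamma> z \<xi>) \<in> borel_measurable (borel \<Otimes>\<^sub>M borel)" for \<gamma>
      unfolding X_def case_prod_beta by measurable
    have U_eq: "U z \<xi> = STFT (dual_shift \<xi> \<phi>) f z - STFT \<phi> f z" for z \<xi>
      unfolding U_def \<psi>_def by (rule STFT_diff_window[OF square_integrable_dual_shift[OF \<phi>] \<phi> f])
    have U_meas [measurable]: "(\<lambda>(z, \<xi>). U z \<xi>) \<in> borel_measurable (borel \<Otimes>\<^sub>M borel)"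
      unfolding U_eq case_prod_beta by measurable
    have pointwise: "(\<Sum>\<gamma>\<in>F. \<eta> \<gamma> z * (?w \<xi> * (norm (X \<gamma> z \<xi>))\<^sup>2))
        \<le> ?w \<xi> * (A * (norm (?V z))\<^sup>2 + B * (norm (U z \<xi>))\<^sup>2)" for z \<xi>
    proof (cases "?w \<xi> = 0")
      case False
      then have \<xi>: "\<bar>fst \<xi>\<bar> \<le> \<delta>" "\<bar>snd \<xi>\<bar> \<le> \<delta>"
        using window_density_support[OF \<delta>(1)] by auto
      have single: "\<eta> \<gamma> z * (norm (X \<gamma> z \<xi>))\<^sup>2 \<le> 8 * e2 * C * product_decay (r - \<sigma>) (z - \<gamma>) * (norm (?V z))\<^sup>2
          + 2 * C * product_decay r (z - \<gamma>) * (norm (U z \<xi>))\<^sup>2" if "\<gamma> \<in> F" for \<gamma>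
      proof -
        have \<gamma>: "\<gamma> \<in> \<Gamma>"
          using that F by auto
        define a where "a = fst z - fst \<gamma>"
        define b where "b = snd z - snd \<gamma>"
        define p where "p = (1 + \<bar>a\<bar>) * (1 + \<bar>b\<bar>)"
        have p: "0 < p"
          by (simp add: p_def add_pos_nonneg)
        define \<theta> where "\<theta> = 2 * pi * ((snd \<gamma> - snd z) * fst \<xi> + (fst z - fst \<gamma>) * snd \<xi>)"
        have "\<theta> = 2 * pi * (a * snd \<xi> - b * fst \<xi>)"
          by (simp add: \<theta>_def a_def b_def algebra_simps)
        then have "\<bar>\<theta>\<bar> = 2 * pi * \<bar>a * snd \<xi> - b * fst \<xi>\<bar>"
          by (simp add: abs_mult)
        also have "\<dots> \<le> 2 * pi * (\<bar>a\<bar> * \<bar>snd \<xi>\<bar> + \<bar>b\<bar> * \<bar>fst \<xi>\<bar>)"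
          using abs_triangle_ineq4[of "a * snd \<xi>" "b * fst \<xi>"] by (simp add: abs_mult)
        also have "\<dots> \<le> 2 * pi * (\<bar>a\<bar> * \<delta> + \<bar>b\<bar> * \<delta>)"
          using \<xi> by (intro mult_left_mono add_mono) auto
        also have "\<dots> = 2 * pi * \<delta> * (\<bar>a\<bar> + \<bar>b\<bar>)"
          by (simp add: algebra_simps)
        also have "\<dots> \<le> 2 * pi * \<delta> * p"
          using \<delta> by (intro mult_left_mono) (auto simp: p_def algebra_simps)
        finally have "\<bar>\<theta>\<bar> powr \<sigma> \<le> (2 * pi * \<delta> * p) powr \<sigma>"
          using \<sigma> by (intro powr_mono2) auto
        also have "\<dots> = (2 * pi * \<delta>) powr \<sigma> * p powr \<sigma>"
          using \<delta> p by (simp add: powr_mult)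
        also have "\<dots> \<le> e2 * p powr \<sigma>"
          by (intro mult_right_mono \<delta>_e2) auto
        finally have \<theta>: "(norm (1 - cis \<theta>))\<^sup>2 \<le> 4 * (e2 * p powr \<sigma>)"
          using norm_one_minus_cis_le[of \<sigma> \<theta>] \<sigma> by simp
        have pr: "product_decay r (z - \<gamma>) = p powr (- r)" "product_decay (r - \<sigma>) (z - \<gamma>) = p powr (- r) * p powr \<sigma>"
          by (simp_all add: product_decay_def p_def a_def b_def flip: powr_add)
        \<comment> \<open>Phase error with the original window, plus window error times a unimodular
          phase.\<close>
        have "X \<gamma> z \<xi> = (1 - cis \<theta>) * ?V z + (- cis \<theta> * U z \<xi>)"
          by (simp add: X_def U_eq \<theta>_def algebra_simps)
        then have "(norm (X \<gamma> z \<xi>))\<^sup>2 \<le> 2 * ((norm (1 - cis \<theta>))\<^sup>2 * (norm (?V z))\<^sup>2) + 2 * (norm (U z \<xi>))\<^sup>2"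
          using norm_add_squared_le[of "(1 - cis \<theta>) * ?V z" "- cis \<theta> * U z \<xi>"]
          by (simp add: norm_mult power_mult_distrib)
        also have "\<dots> \<le> 2 * (4 * (e2 * p powr \<sigma>) * (norm (?V z))\<^sup>2) + 2 * (norm (U z \<xi>))\<^sup>2"
          by (intro add_mono mult_left_mono mult_right_mono \<theta>) auto
        finally have "\<eta> \<gamma> z * (norm (X \<gamma> z \<xi>))\<^sup>2
            \<le> (C * p powr (- r)) * (2 * (4 * (e2 * p powr \<sigma>) * (norm (?V z))\<^sup>2) + 2 * (norm (U z \<xi>))\<^sup>2)"
          using \<eta>[OF \<gamma>, of z] C unfolding pr by (intro mult_mono) auto
        then show ?thesis
          unfolding pr by (simp add: algebra_simps)
      qed
      have "(\<Sum>\<gamma>\<in>F. \<eta> \<gamma> z * (norm (X \<gamma> z \<xi>))\<^sup>2)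
          \<le> (\<Sum>\<gamma>\<in>F. 8 * e2 * C * product_decay (r - \<sigma>) (z - \<gamma>) * (norm (?V z))\<^sup>2
          + 2 * C * product_decay r (z - \<gamma>) * (norm (U z \<xi>))\<^sup>2)"
        by (rule sum_mono[OF single])
      also have "\<dots> = 8 * e2 * C * (\<Sum>\<gamma>\<in>F. product_decay (r - \<sigma>) (z - \<gamma>)) * (norm (?V z))\<^sup>2
          + 2 * C * (\<Sum>\<gamma>\<in>F. product_decay r (z - \<gamma>)) * (norm (U z \<xi>))\<^sup>2"
        by (simp add: sum.distrib sum_distrib_left sum_distrib_right)
      also have "\<dots> \<le> A * (norm (?V z))\<^sup>2 + B * (norm (U z \<xi>))\<^sup>2"
        unfolding A_def B_def using e12 C
        by (intro add_mono mult_right_mono mult_left_mono D1(2) D2(2) F) auto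
      finally have "?w \<xi> * (\<Sum>\<gamma>\<in>F. \<eta> \<gamma> z * (norm (X \<gamma> z \<xi>))\<^sup>2)
          \<le> ?w \<xi> * (A * (norm (?V z))\<^sup>2 + B * (norm (U z \<xi>))\<^sup>2)"
        by (rule mult_left_mono) (rule window_density_nonneg[OF \<delta>(1)])
      then show ?thesis
        by (simp add: sum_distrib_left mult_ac)
    qed simp
    have w1: "(\<integral>\<^sup>+\<xi>. ennreal (?w \<xi>) \<partial>lborel) = 1"
      using nn_integral_eq_integral[OF integrable_window_density[OF \<delta>(1)]]
        window_density_nonneg[OF \<delta>(1)] integral_window_density[OF \<delta>(1)] by simp
    have "(\<Sum>\<gamma>\<in>F. \<integral>\<^sup>+z. ennreal (\<eta> \<gamma> z * (norm (STFT \<phi> (\<lambda>t. f t - localizer \<delta> \<gamma> f t) z))\<^sup>2) \<partial>lborel)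
        \<le> (\<Sum>\<gamma>\<in>F. \<integral>\<^sup>+z. \<integral>\<^sup>+\<xi>. ennreal (\<eta> \<gamma> z * (?w \<xi> * (norm (X \<gamma> z \<xi>))\<^sup>2)) \<partial>lborel \<partial>lborel)"
    proof (intro sum_mono nn_integral_mono)
      fix \<gamma> z
      assume "\<gamma> \<in> F"
      then have \<eta>z: "0 \<le> \<eta> \<gamma> z"
        by (intro \<eta>(1) subsetD[OF F(2)])
      \<comment> \<open>Jensen's inequality for the average over \<xi>; the first factor is the mass
        \<open>w1\<close> of the density.\<close>
      have "ennreal ((norm (STFT \<phi> (\<lambda>t. f t - localizer \<delta> \<gamma> f t) z))\<^sup>2)
          \<le> (\<integral>\<^sup>+\<xi>. ennreal (norm (complex_of_real (?w \<xi>))) \<partial>lborel)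
            * (\<integral>\<^sup>+\<xi>. ennreal (norm (complex_of_real (?w \<xi>)) * (norm (X \<gamma> z \<xi>))\<^sup>2) \<partial>lborel)"
        unfolding STFT_localizer_remainder[OF \<delta>(1) \<phi> f] X_def[symmetric]
        by (rule norm_integral_mult_squared_le) measurable
      also have "\<dots> = (\<integral>\<^sup>+\<xi>. ennreal (?w \<xi> * (norm (X \<gamma> z \<xi>))\<^sup>2) \<partial>lborel)"
        using window_density_nonneg[OF \<delta>(1)] w1 by simp
      finally have "ennreal (\<eta> \<gamma> z) * ennreal ((norm (STFT \<phi> (\<lambda>t. f t - localizer \<delta> \<gamma> f t) z))\<^sup>2)
          \<le> ennreal (\<eta> \<gamma> z) * (\<integral>\<^sup>+\<xi>. ennreal (?w \<xi> * (norm (X \<gamma> z \<xi>))\<^sup>2) \<partial>lborel)"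
        by (rule mult_left_mono) simp
      also have "\<dots> = (\<integral>\<^sup>+\<xi>. ennreal (\<eta> \<gamma> z) * ennreal (?w \<xi> * (norm (X \<gamma> z \<xi>))\<^sup>2) \<partial>lborel)"
        by (rule nn_integral_cmult[symmetric]) measurable
      finally show "ennreal (\<eta> \<gamma> z * (norm (STFT \<phi> (\<lambda>t. f t - localizer \<delta> \<gamma> f t) z))\<^sup>2)
          \<le> (\<integral>\<^sup>+\<xi>. ennreal (\<eta> \<gamma> z * (?w \<xi> * (norm (X \<gamma> z \<xi>))\<^sup>2)) \<partial>lborel)"
        using \<eta>z window_density_nonneg[OF \<delta>(1)] by (simp flip: ennreal_mult)
    qed
    also have "\<dots> = (\<integral>\<^sup>+z. \<integral>\<^sup>+\<xi>. (\<Sum>\<gamma>\<in>F. ennreal (\<eta> \<gamma> z * (?w \<xi> * (norm (X \<gamma> z \<xi>))\<^sup>2))) \<partial>lborel \<partial>lborel)"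
    proof -
      have "(\<integral>\<^sup>+z. \<integral>\<^sup>+\<xi>. (\<Sum>\<gamma>\<in>F. ennreal (\<eta> \<gamma> z * (?w \<xi> * (norm (X \<gamma> z \<xi>))\<^sup>2))) \<partial>lborel \<partial>lborel)
          = (\<integral>\<^sup>+z. (\<Sum>\<gamma>\<in>F. \<integral>\<^sup>+\<xi>. ennreal (\<eta> \<gamma> z * (?w \<xi> * (norm (X \<gamma> z \<xi>))\<^sup>2)) \<partial>lborel) \<partial>lborel)"
        by (intro nn_integral_cong nn_integral_sum) measurable
      also have "\<dots> = (\<Sum>\<gamma>\<in>F. \<integral>\<^sup>+z. \<integral>\<^sup>+\<xi>. ennreal (\<eta> \<gamma> z * (?w \<xi> * (norm (X \<gamma> z \<xi>))\<^sup>2)) \<partial>lborel \<partial>lborel)"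
        by (intro nn_integral_sum) measurable
      finally show ?thesis
        by (rule sym)
    qed
    also have "\<dots> \<le> (\<integral>\<^sup>+z. \<integral>\<^sup>+\<xi>. ennreal (?w \<xi> * (A * (norm (?V z))\<^sup>2 + B * (norm (U z \<xi>))\<^sup>2)) \<partial>lborel \<partial>lborel)"
    proof (intro nn_integral_mono)
      fix z \<xi>
      have "(\<Sum>\<gamma>\<in>F. ennreal (\<eta> \<gamma> z * (?w \<xi> * (norm (X \<gamma> z \<xi>))\<^sup>2)))
          = ennreal (\<Sum>\<gamma>\<in>F. \<eta> \<gamma> z * (?w \<xi> * (norm (X \<gamma> z \<xi>))\<^sup>2))"
        by (intro sum_ennreal mult_nonneg_nonneg \<eta>(1)[OF subsetD[OF F(2)]] window_density_nonneg[OF \<delta>(1)]) auto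
      then show "(\<Sum>\<gamma>\<in>F. ennreal (\<eta> \<gamma> z * (?w \<xi> * (norm (X \<gamma> z \<xi>))\<^sup>2)))
          \<le> ennreal (?w \<xi> * (A * (norm (?V z))\<^sup>2 + B * (norm (U z \<xi>))\<^sup>2))"
        using pointwise[of z \<xi>] by (simp add: ennreal_leI)
    qed
    \<comment> \<open>With \<xi> outside, \<open>U\<close> is for each fixed \<xi> the STFT with the
      window \<open>\<psi> \<xi>\<close>, so the isometry evaluates the inner integral
      exactly.\<close>
    also have "\<dots> = (\<integral>\<^sup>+\<xi>. \<integral>\<^sup>+z. ennreal (?w \<xi> * (A * (norm (?V z))\<^sup>2 + B * (norm (U z \<xi>))\<^sup>2)) \<partial>lborel \<partial>lborel)"
      by (rule nn_integral_lborel_swap) measurable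
    also have "\<dots> \<le> (\<integral>\<^sup>+\<xi>. ennreal (?w \<xi>) * ennreal (e * (L2_norm f)\<^sup>2) \<partial>lborel)"
    proof (rule nn_integral_mono)
      fix \<xi>
      note [measurable] = square_integrable_measurable[OF \<psi>]
      have "(\<integral>\<^sup>+z. ennreal (?w \<xi> * (A * (norm (?V z))\<^sup>2 + B * (norm (U z \<xi>))\<^sup>2)) \<partial>lborel)
          = (\<integral>\<^sup>+z. ennreal (?w \<xi>) * (ennreal A * ennreal ((norm (?V z))\<^sup>2) + ennreal B * ennreal ((norm (STFT (\<psi> \<xi>) f z))\<^sup>2)) \<partial>lborel)"
        using AB window_density_nonneg[OF \<delta>(1)] by (simp add: U_def ennreal_plus ennreal_mult)
      also have "\<dots> = ennreal (?w \<xi>) * (ennreal A * ennreal ((L2_norm f)\<^sup>2 * (L2_norm \<phi>)\<^sup>2)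
          + ennreal B * ennreal ((L2_norm f)\<^sup>2 * (L2_norm (\<psi> \<xi>))\<^sup>2))"
        by (simp add: nn_integral_cmult nn_integral_add STFT_isometry \<phi> f \<psi>)
      also have "\<dots> = ennreal (?w \<xi>) * ennreal ((A * (L2_norm \<phi>)\<^sup>2 + B * (L2_norm (\<psi> \<xi>))\<^sup>2) * (L2_norm f)\<^sup>2)"
        using AB by (simp add: algebra_simps ennreal_plus ennreal_mult)
      also have "\<dots> \<le> ennreal (?w \<xi>) * ennreal (e * (L2_norm f)\<^sup>2)"
      proof (cases "?w \<xi> = 0")
        case False
        then have "\<bar>fst \<xi>\<bar> \<le> \<delta>1" "\<bar>snd \<xi>\<bar> \<le> \<delta>1"
          using window_density_support[OF \<delta>(1), of \<xi>] \<delta>(2) by auto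
        then have "A * (L2_norm \<phi>)\<^sup>2 + B * (L2_norm (\<psi> \<xi>))\<^sup>2 \<le> A * (L2_norm \<phi>)\<^sup>2 + B * e1"
          unfolding \<psi>_def using AB by (intro add_left_mono mult_left_mono \<delta>1(2)) auto
        also note total
        finally show ?thesis
          by (intro mult_left_mono ennreal_leI mult_right_mono) auto
      qed simp
      finally show "(\<integral>\<^sup>+z. ennreal (?w \<xi> * (A * (norm (?V z))\<^sup>2 + B * (norm (U z \<xi>))\<^sup>2)) \<partial>lborel)
          \<le> ennreal (?w \<xi>) * ennreal (e * (L2_norm f)\<^sup>2)" .
    qed
    also have "\<dots> = ennreal (e * (L2_norm f)\<^sup>2)"
      using w1 by (simp add: nn_integral_multc)
    finally show ?thesis .
  qed
  with \<delta>(1) show thesis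
    by (rule that)
qed

subsection \<open>Frame bounds\<close>

lemma discrete_set_subset:
  assumes "discrete_set \<Gamma>" and sub: "\<Gamma>' \<subseteq> \<Gamma>"
  shows "discrete_set \<Gamma>'"
proof -
  obtain N where N: "\<And>z. card (\<Gamma> \<inter> cball z 1) \<le> N"
    using assms by (auto simp: discrete_set_def)
  have "finite (\<Gamma> \<inter> cball z 1)" for z
    using finite_not_islimpt_in_compact[of "cball z 1" \<Gamma>] assms by (auto simp: discrete_set_def Int_commute)
  then have "card (\<Gamma>' \<inter> cball z 1) \<le> N" for z
    using card_mono[of "\<Gamma> \<inter> cball z 1" "\<Gamma>' \<inter> cball z 1"] sub N[of z] by (meson Int_mono order_refl order_trans)
  moreover have "\<not> z islimpt \<Gamma>'" for z
    using assms(1) islimpt_subset[of z \<Gamma>' \<Gamma>] sub unfolding discrete_set_def by blast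
  ultimately show ?thesis
    by (auto simp: discrete_set_def)
qed

lemma discrete_set_countable:
  assumes "discrete_set \<Gamma>"
  shows "countable \<Gamma>"
proof -
  have "finite (\<Gamma> \<inter> cball 0 (real n))" for n
    using finite_not_islimpt_in_compact[of "cball 0 (real n)" \<Gamma>] assms by (auto simp: discrete_set_def Int_commute)
  moreover have "\<Gamma> = (\<Union>n. \<Gamma> \<inter> cball 0 (real n))"
    using real_arch_simple by (auto simp: dist_norm)
  ultimately show ?thesis
    by (metis countable_UN countable_finite UNIV_I countableI_type)
qed

text \<open>Each coordinate is at most the norm, so the product of the coordinate factors is at most
  \<open>(1 + norm z)\<^sup>2\<close>. This square halves the exponent, and \<open>s > 2\<close>
  becomes \<open>r > 1\<close>.\<close>

lemma polynomial_decay_product_decay: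
  assumes "polynomial_decay g"
  obtains C r where "0 < C" "1 < r" "\<And>z. \<bar>g z\<bar> \<le> C * product_decay r z"
proof -
  obtain C s where s: "2 < s" and C: "\<And>z. \<bar>g z\<bar> \<le> C * (1 + norm z) powr (- s)"
    using assms by (auto simp: polynomial_decay_def)
  have "\<bar>g z\<bar> \<le> (\<bar>C\<bar> + 1) * product_decay (s / 2) z" for z
  proof -
    have "(1 + \<bar>fst z\<bar>) * (1 + \<bar>snd z\<bar>) \<le> (1 + norm z) * (1 + norm z)"
      using norm_fst_le[of "fst z" "snd z"] norm_snd_le[of "snd z" "fst z"] by (intro mult_mono) auto
    then have "((1 + norm z)\<^sup>2) powr (- (s / 2)) \<le> product_decay (s / 2) z"
      unfolding product_decay_def using s
      by (intro powr_mono2') (auto simp: power2_eq_square intro!: mult_pos_pos add_pos_nonneg)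
    moreover have "((1 + norm z)\<^sup>2) powr (- (s / 2)) = (1 + norm z) powr (- s)"
    proof -
      have "(1 + norm z)\<^sup>2 = (1 + norm z) powr 2"
        by (simp add: add_nonneg_nonneg)
      then show ?thesis
        by (simp only: powr_powr) simp
    qed
    ultimately have "(1 + norm z) powr (- s) \<le> product_decay (s / 2) z"
      by simp
    then have "(\<bar>C\<bar> + 1) * (1 + norm z) powr (- s) \<le> (\<bar>C\<bar> + 1) * product_decay (s / 2) z"
      by (intro mult_left_mono) auto
    moreover have "C * (1 + norm z) powr (- s) \<le> (\<bar>C\<bar> + 1) * (1 + norm z) powr (- s)"
      by (intro mult_right_mono) auto
    ultimately show ?thesis
      using C[of z] by linarith
  qed
  then show thesis
    using s by (intro that[of "\<bar>C\<bar> + 1" "s / 2"]) auto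
qed

text \<open>An \<open>infsum\<close> is a limit along the net of finite subsets. Countability
  provides an increasing exhaustion \<open>E\<close> along which it becomes a sequential limit; this
  preserves measurability and permits Fatou's lemma, so bounds on finite partial sums pass to the
  full sum.\<close>

lemma
  fixes \<eta> :: "'a \<Rightarrow> 'b::euclidean_space \<Rightarrow> real" and h :: "'b \<Rightarrow> real"
  assumes \<Gamma>: "countable \<Gamma>" and sm: "\<And>z. (\<lambda>\<gamma>. \<eta> \<gamma> z) summable_on \<Gamma>"
    and m: "\<And>\<gamma>. \<gamma> \<in> \<Gamma> \<Longrightarrow> \<eta> \<gamma> \<in> borel_measurable borel"
  shows borel_measurable_infsum_countable: "(\<lambda>z. \<Sum>\<^sub>\<infinity>\<gamma>\<in>\<Gamma>. \<eta> \<gamma> z) \<in> borel_measurable borel"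
    and nn_integral_infsum_le: "\<lbrakk>h \<in> borel_measurable borel; \<And>z. 0 \<le> h z; \<And>\<gamma> z. \<gamma> \<in> \<Gamma> \<Longrightarrow> 0 \<le> \<eta> \<gamma> z;
      \<And>F. finite F \<Longrightarrow> F \<subseteq> \<Gamma> \<Longrightarrow> (\<Sum>\<gamma>\<in>F. \<integral>\<^sup>+z. ennreal (\<eta> \<gamma> z * h z) \<partial>lborel) \<le> M\<rbrakk>
      \<Longrightarrow> (\<integral>\<^sup>+z. ennreal ((\<Sum>\<^sub>\<infinity>\<gamma>\<in>\<Gamma>. \<eta> \<gamma> z) * h z) \<partial>lborel) \<le> M"
proof -
  obtain E where E: "\<And>n. finite (E n)" "\<And>n. E n \<subseteq> \<Gamma>" "filterlim E (finite_subsets_at_top \<Gamma>) sequentially"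
  proof (cases "\<Gamma> = {}")
    case True
    then show ?thesis
      by (intro that[of "\<lambda>_. {}"]) (auto simp: filterlim_finite_subsets_at_top)
  next
    case False
    let ?E = "\<lambda>n. from_nat_into \<Gamma> ` {..n}"
    have "filterlim ?E (finite_subsets_at_top \<Gamma>) sequentially"
      unfolding filterlim_finite_subsets_at_top
    proof (intro allI impI)
      fix X
      assume X: "finite X \<and> X \<subseteq> \<Gamma>"
      define N where "N = Max (insert 0 (to_nat_on \<Gamma> ` X))"
      have "X \<subseteq> ?E n" if "N \<le> n" for n
      proof
        fix x
        assume x: "x \<in> X"
        then have "to_nat_on \<Gamma> x \<le> N"
          unfolding N_def using X by (intro Max_ge) auto
        then show "x \<in> ?E n"
          using that X x \<Gamma> by (intro image_eqI[of _ _ "to_nat_on \<Gamma> x"]) auto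
      qed
      then show "\<forall>\<^sub>F n in sequentially. finite (?E n) \<and> X \<subseteq> ?E n \<and> ?E n \<subseteq> \<Gamma>"
        using from_nat_into[OF False] by (intro eventually_sequentiallyI[of N]) auto
    qed
    then show ?thesis
      using from_nat_into[OF False] by (intro that[of ?E]) auto
  qed
  have lim: "(\<lambda>n. \<Sum>\<gamma>\<in>E n. \<eta> \<gamma> z) \<longlonglongrightarrow> (\<Sum>\<^sub>\<infinity>\<gamma>\<in>\<Gamma>. \<eta> \<gamma> z)" for z
    using filterlim_compose[OF has_sum_infsum[OF sm, unfolded has_sum_def] E(3)] .
  have [measurable]: "\<gamma> \<in> E n \<Longrightarrow> \<eta> \<gamma> \<in> borel_measurable borel" for \<gamma> n
    using E m by auto
  show "(\<lambda>z. \<Sum>\<^sub>\<infinity>\<gamma>\<in>\<Gamma>. \<eta> \<gamma> z) \<in> borel_measurable borel"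
    by (rule borel_measurable_LIMSEQ_real[OF lim]) measurable
  assume h [measurable]: "h \<in> borel_measurable borel" and h0: "\<And>z. 0 \<le> h z"
    and \<eta>: "\<And>\<gamma> z. \<gamma> \<in> \<Gamma> \<Longrightarrow> 0 \<le> \<eta> \<gamma> z"
    and M: "\<And>F. finite F \<Longrightarrow> F \<subseteq> \<Gamma> \<Longrightarrow> (\<Sum>\<gamma>\<in>F. \<integral>\<^sup>+z. ennreal (\<eta> \<gamma> z * h z) \<partial>lborel) \<le> M"
  have "(\<integral>\<^sup>+z. ennreal ((\<Sum>\<^sub>\<infinity>\<gamma>\<in>\<Gamma>. \<eta> \<gamma> z) * h z) \<partial>lborel)
      = (\<integral>\<^sup>+z. liminf (\<lambda>n. ennreal ((\<Sum>\<gamma>\<in>E n. \<eta> \<gamma> z) * h z)) \<partial>lborel)"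
  proof (rule nn_integral_cong)
    fix z
    have "(\<lambda>n. ennreal ((\<Sum>\<gamma>\<in>E n. \<eta> \<gamma> z) * h z)) \<longlonglongrightarrow> ennreal ((\<Sum>\<^sub>\<infinity>\<gamma>\<in>\<Gamma>. \<eta> \<gamma> z) * h z)"
      by (intro tendsto_ennrealI tendsto_intros lim)
    then show "ennreal ((\<Sum>\<^sub>\<infinity>\<gamma>\<in>\<Gamma>. \<eta> \<gamma> z) * h z) = liminf (\<lambda>n. ennreal ((\<Sum>\<gamma>\<in>E n. \<eta> \<gamma> z) * h z))"
      by (rule lim_imp_Liminf[OF sequentially_bot, symmetric])
  qed
  also have "\<dots> \<le> liminf (\<lambda>n. \<integral>\<^sup>+z. ennreal ((\<Sum>\<gamma>\<in>E n. \<eta> \<gamma> z) * h z) \<partial>lborel)"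
    by (rule nn_integral_liminf) measurable
  also have "\<dots> \<le> liminf (\<lambda>n::nat. M)"
  proof (intro Liminf_mono always_eventually allI)
    fix n
    have "(\<integral>\<^sup>+z. ennreal ((\<Sum>\<gamma>\<in>E n. \<eta> \<gamma> z) * h z) \<partial>lborel) = (\<integral>\<^sup>+z. (\<Sum>\<gamma>\<in>E n. ennreal (\<eta> \<gamma> z * h z)) \<partial>lborel)"
      using \<eta> h0 E(2)[of n] by (intro nn_integral_cong) (auto simp: sum_distrib_right subset_iff intro!: sum_ennreal[symmetric])
    also have "\<dots> = (\<Sum>\<gamma>\<in>E n. \<integral>\<^sup>+z. ennreal (\<eta> \<gamma> z * h z) \<partial>lborel)"
      by (rule nn_integral_sum) measurable
    also have "\<dots> \<le> M"
      by (rule M[OF E(1,2)])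
    finally show "(\<integral>\<^sup>+z. ennreal ((\<Sum>\<gamma>\<in>E n. \<eta> \<gamma> z) * h z) \<partial>lborel) \<le> M" .
  qed
  also have "\<dots> = M"
    by (simp add: Liminf_const)
  finally show "(\<integral>\<^sup>+z. ennreal ((\<Sum>\<^sub>\<infinity>\<gamma>\<in>\<Gamma>. \<eta> \<gamma> z) * h z) \<partial>lborel) \<le> M" .
qed

text \<open>One window with its own symbols. The normalization of the windows and the lower bound on
  the symbol sums enter only where the two instances are combined.\<close>

locale symbol_family =
  fixes \<Gamma> :: "(real \<times> real) set" and \<eta> :: "real \<times> real \<Rightarrow> real \<times> real \<Rightarrow> real" and C r :: real
    and \<phi> :: "real \<Rightarrow> complex"
  assumes discrete: "discrete_set \<Gamma>"
    and integrable_symbol: "\<And>\<gamma>. \<gamma> \<in> \<Gamma> \<Longrightarrow> integrable lborel (\<eta> \<gamma>)"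
    and symbol_nonneg: "\<And>\<gamma> z. \<gamma> \<in> \<Gamma> \<Longrightarrow> 0 \<le> \<eta> \<gamma> z"
    and C_pos: "0 < C" and r_gt_1: "1 < r"
    and symbol_le: "\<And>\<gamma> z. \<gamma> \<in> \<Gamma> \<Longrightarrow> \<eta> \<gamma> z \<le> C * product_decay r (z - \<gamma>)"
    and window: "square_integrable \<phi>"
begin

lemma symbol_measurable: "\<gamma> \<in> \<Gamma> \<Longrightarrow> \<eta> \<gamma> \<in> borel_measurable borel"
  using integrable_symbol by auto

lemma symbol_le_C:
  assumes "\<gamma> \<in> \<Gamma>"
  shows "\<eta> \<gamma> z \<le> C"
proof -
  have "1 * 1 \<le> (1 + \<bar>fst (z - \<gamma>)\<bar>) * (1 + \<bar>snd (z - \<gamma>)\<bar>)"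
    by (intro mult_mono) auto
  then have "product_decay r (z - \<gamma>) \<le> 1"
    unfolding product_decay_def using r_gt_1 powr_mono2'[of "- r" 1] by simp
  then have "C * product_decay r (z - \<gamma>) \<le> C * 1"
    using C_pos by (intro mult_left_mono) auto
  with symbol_le[OF assms, of z] show ?thesis
    by simp
qed

lemma integrable_symbol_STFT:
  assumes "\<gamma> \<in> \<Gamma>" and f: "square_integrable f" and h: "square_integrable h"
  shows "integrable lborel (\<lambda>z. STFT \<phi> f z * of_real (\<eta> \<gamma> z) * cnj (STFT \<phi> h z))"
proof (rule Bochner_Integration.integrable_bound)
  note [measurable] = symbol_measurable[OF assms(1)] square_integrable_measurable[OF window]
    square_integrable_measurable[OF f] square_integrable_measurable[OF h]
  show "integrable lborel (\<lambda>z. C * norm (STFT \<phi> f z * cnj (STFT \<phi> h z)))"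
    using integrable_mult_square_integrable[OF square_integrable_STFT[OF window f]
        square_integrable_cnj[OF square_integrable_STFT[OF window h]]] by (intro integrable_mult_right integrable_norm)
  show "(\<lambda>z. STFT \<phi> f z * of_real (\<eta> \<gamma> z) * cnj (STFT \<phi> h z)) \<in> borel_measurable lborel"
    by measurable
  have "norm (STFT \<phi> f z * of_real (\<eta> \<gamma> z) * cnj (STFT \<phi> h z)) \<le> norm (C * norm (STFT \<phi> f z * cnj (STFT \<phi> h z)))" for z
  proof -
    have "\<eta> \<gamma> z * (norm (STFT \<phi> f z) * norm (STFT \<phi> h z)) \<le> C * (norm (STFT \<phi> f z) * norm (STFT \<phi> h z))"
      by (intro mult_right_mono symbol_le_C assms) simp
    then show ?thesis
      using C_pos symbol_nonneg[OF assms(1), of z] by (simp add: norm_mult mult_ac)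
  qed
  then show "AE z in lborel. norm (STFT \<phi> f z * of_real (\<eta> \<gamma> z) * cnj (STFT \<phi> h z)) \<le> norm (C * norm (STFT \<phi> f z * cnj (STFT \<phi> h z)))"
    by simp
qed

lemma integrable_symbol_energy:
  assumes "\<gamma> \<in> \<Gamma>" and f: "square_integrable f"
  shows "integrable lborel (\<lambda>z. \<eta> \<gamma> z * (norm (STFT \<phi> f z))\<^sup>2)"
proof -
  have "integrable lborel (\<lambda>z. norm (STFT \<phi> f z * of_real (\<eta> \<gamma> z) * cnj (STFT \<phi> f z)))"
    using integrable_symbol_STFT[OF assms(1) f f] by (rule integrable_norm)
  then show ?thesis
    using symbol_nonneg[OF assms(1)] by (simp add: norm_mult power2_eq_square mult_ac)
qed

lemma loc_op_sum_le:
  obtains B where "0 < B" "\<And>f F. square_integrable f \<Longrightarrow> finite F \<Longrightarrow> F \<subseteq> \<Gamma> \<Longrightarrow>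
    (\<Sum>\<gamma>\<in>F. (L2_norm (loc_op (\<eta> \<gamma>) \<phi> f))\<^sup>2) \<le> B * (L2_norm f)\<^sup>2"
proof -
  obtain D where D: "0 < D" "\<And>z F. finite F \<Longrightarrow> F \<subseteq> \<Gamma> \<Longrightarrow> (\<Sum>\<gamma>\<in>F. product_decay r (z - \<gamma>)) \<le> D"
    using product_decay_sum_bounded[OF discrete r_gt_1] by auto
  \<comment> \<open>One \<open>C\<close> comes from bounding the squared symbol by \<open>C\<close>
    times the symbol, \<open>C * D\<close> bounds the sum of the symbols; one factor
    \<open>(L2_norm \<phi>)\<^sup>2\<close> stems from duality and one from the isometry. The
    summand 1 ensures positivity.\<close>
  define B where "B = C * (C * D) * ((L2_norm \<phi>)\<^sup>2 * (L2_norm \<phi>)\<^sup>2) + 1"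
  have B: "0 < B"
    unfolding B_def using C_pos D(1) by (intro add_nonneg_pos mult_nonneg_nonneg) auto
  have "(\<Sum>\<gamma>\<in>F. (L2_norm (loc_op (\<eta> \<gamma>) \<phi> f))\<^sup>2) \<le> B * (L2_norm f)\<^sup>2"
    if f: "square_integrable f" and F: "finite F" "F \<subseteq> \<Gamma>" for f F
  proof -
    let ?V = "STFT \<phi> f"
    note [measurable] = square_integrable_measurable[OF window] square_integrable_measurable[OF f]
    have [measurable]: "\<eta> \<gamma> \<in> borel_measurable borel" if "\<gamma> \<in> F" for \<gamma>
      by (rule symbol_measurable[OF subsetD[OF F(2) that]])
    have single: "ennreal ((L2_norm (loc_op (\<eta> \<gamma>) \<phi> f))\<^sup>2)
        \<le> (\<integral>\<^sup>+z. ennreal (C * (L2_norm \<phi>)\<^sup>2) * ennreal (\<eta> \<gamma> z * (norm (?V z))\<^sup>2) \<partial>lborel)" if "\<gamma> \<in> F" for \<gamma>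
    proof -
      have \<gamma>: "\<gamma> \<in> \<Gamma>"
        using that F by auto
      note [measurable] = symbol_measurable[OF \<gamma>]
      let ?G = "\<lambda>z. ?V z * complex_of_real (\<eta> \<gamma> z)"
      have sq: "(norm (?G z))\<^sup>2 \<le> C * (\<eta> \<gamma> z * (norm (?V z))\<^sup>2)" for z
      proof -
        have "\<eta> \<gamma> z * (\<eta> \<gamma> z * (norm (?V z))\<^sup>2) \<le> C * (\<eta> \<gamma> z * (norm (?V z))\<^sup>2)"
          by (intro mult_right_mono symbol_le_C \<gamma>) (simp add: symbol_nonneg \<gamma>)
        then show ?thesis
          by (simp add: norm_mult power_mult_distrib power2_eq_square mult_ac)
      qed
      have G: "square_integrable ?G"
        unfolding square_integrable_def
      proof
        show "integrable lborel (\<lambda>z. (norm (?G z))\<^sup>2)"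
        proof (rule Bochner_Integration.integrable_bound)
          show "integrable lborel (\<lambda>z. C * (\<eta> \<gamma> z * (norm (?V z))\<^sup>2))"
            using integrable_symbol_energy[OF \<gamma> f] by simp
          show "(\<lambda>z. (norm (?G z))\<^sup>2) \<in> borel_measurable lborel"
            by measurable
        qed (use sq C_pos symbol_nonneg[OF \<gamma>] in auto)
      qed measurable
      have "(L2_norm (loc_op (\<eta> \<gamma>) \<phi> f))\<^sup>2 \<le> (L2_norm ?G * L2_norm \<phi>)\<^sup>2"
        using L2_norm_loc_op_le[OF integrable_symbol[OF \<gamma>] window f G] by (intro power_mono) auto
      then have "ennreal ((L2_norm (loc_op (\<eta> \<gamma>) \<phi> f))\<^sup>2) \<le> ennreal ((L2_norm \<phi>)\<^sup>2) * ennreal ((L2_norm ?G)\<^sup>2)"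
        by (simp add: power_mult_distrib mult.commute ennreal_leI flip: ennreal_mult)
      also have "\<dots> = (\<integral>\<^sup>+z. ennreal ((L2_norm \<phi>)\<^sup>2) * ennreal ((norm (?G z))\<^sup>2) \<partial>lborel)"
        unfolding nn_integral_square[OF G, symmetric] by (rule nn_integral_cmult[symmetric]) measurable
      also have "\<dots> \<le> (\<integral>\<^sup>+z. ennreal (C * (L2_norm \<phi>)\<^sup>2) * ennreal (\<eta> \<gamma> z * (norm (?V z))\<^sup>2) \<partial>lborel)"
      proof (rule nn_integral_mono)
        fix z
        have "ennreal ((L2_norm \<phi>)\<^sup>2) * ennreal ((norm (?G z))\<^sup>2)
            \<le> ennreal ((L2_norm \<phi>)\<^sup>2) * ennreal (C * (\<eta> \<gamma> z * (norm (?V z))\<^sup>2))"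
          by (intro mult_left_mono ennreal_leI sq) simp
        also have "\<dots> = ennreal (C * (L2_norm \<phi>)\<^sup>2) * ennreal (\<eta> \<gamma> z * (norm (?V z))\<^sup>2)"
          using C_pos symbol_nonneg[OF \<gamma>, of z] by (simp add: mult_ac flip: ennreal_mult)
        finally show "ennreal ((L2_norm \<phi>)\<^sup>2) * ennreal ((norm (?G z))\<^sup>2) \<le> \<dots>" .
      qed
      finally show ?thesis .
    qed
    have "ennreal (\<Sum>\<gamma>\<in>F. (L2_norm (loc_op (\<eta> \<gamma>) \<phi> f))\<^sup>2)
        = (\<Sum>\<gamma>\<in>F. ennreal ((L2_norm (loc_op (\<eta> \<gamma>) \<phi> f))\<^sup>2))"
      by (rule sum_ennreal[symmetric]) simp
    also have "\<dots> \<le> (\<Sum>\<gamma>\<in>F. \<integral>\<^sup>+z. ennreal (C * (L2_norm \<phi>)\<^sup>2) * ennreal (\<eta> \<gamma> z * (norm (?V z))\<^sup>2) \<partial>lborel)"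
      by (rule sum_mono[OF single])
    also have "\<dots> = (\<integral>\<^sup>+z. (\<Sum>\<gamma>\<in>F. ennreal (C * (L2_norm \<phi>)\<^sup>2) * ennreal (\<eta> \<gamma> z * (norm (?V z))\<^sup>2)) \<partial>lborel)"
      by (rule nn_integral_sum[symmetric]) measurable
    also have "\<dots> \<le> (\<integral>\<^sup>+z. ennreal (C * (L2_norm \<phi>)\<^sup>2 * (C * D)) * ennreal ((norm (?V z))\<^sup>2) \<partial>lborel)"
    proof (rule nn_integral_mono)
      fix z
      have "(\<Sum>\<gamma>\<in>F. \<eta> \<gamma> z) \<le> (\<Sum>\<gamma>\<in>F. C * product_decay r (z - \<gamma>))"
        using F by (intro sum_mono symbol_le) auto
      also have "\<dots> \<le> C * D"
        using C_pos D(2)[OF F, of z] by (simp flip: sum_distrib_left)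
      finally have le: "(\<Sum>\<gamma>\<in>F. \<eta> \<gamma> z) \<le> C * D" .
      have "(\<Sum>\<gamma>\<in>F. ennreal (C * (L2_norm \<phi>)\<^sup>2) * ennreal (\<eta> \<gamma> z * (norm (?V z))\<^sup>2))
          = (\<Sum>\<gamma>\<in>F. ennreal ((C * (L2_norm \<phi>)\<^sup>2) * (\<eta> \<gamma> z * (norm (?V z))\<^sup>2)))"
        by (intro sum.cong refl ennreal_mult[symmetric] mult_nonneg_nonneg symbol_nonneg[OF subsetD[OF F(2)]])
          (use C_pos in auto)
      also have "\<dots> = ennreal (\<Sum>\<gamma>\<in>F. (C * (L2_norm \<phi>)\<^sup>2) * (\<eta> \<gamma> z * (norm (?V z))\<^sup>2))"
        by (intro sum_ennreal mult_nonneg_nonneg symbol_nonneg[OF subsetD[OF F(2)]]) (use C_pos in auto)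
      also have "(\<Sum>\<gamma>\<in>F. (C * (L2_norm \<phi>)\<^sup>2) * (\<eta> \<gamma> z * (norm (?V z))\<^sup>2))
          = C * (L2_norm \<phi>)\<^sup>2 * (\<Sum>\<gamma>\<in>F. \<eta> \<gamma> z) * (norm (?V z))\<^sup>2"
        by (simp add: sum_distrib_left sum_distrib_right mult_ac)
      also have "ennreal (C * (L2_norm \<phi>)\<^sup>2 * (\<Sum>\<gamma>\<in>F. \<eta> \<gamma> z) * (norm (?V z))\<^sup>2)
          \<le> ennreal (C * (L2_norm \<phi>)\<^sup>2 * (C * D) * (norm (?V z))\<^sup>2)"
        using C_pos by (intro ennreal_leI mult_right_mono mult_left_mono le) auto
      finally show "(\<Sum>\<gamma>\<in>F. ennreal (C * (L2_norm \<phi>)\<^sup>2) * ennreal (\<eta> \<gamma> z * (norm (?V z))\<^sup>2))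
          \<le> ennreal (C * (L2_norm \<phi>)\<^sup>2 * (C * D)) * ennreal ((norm (?V z))\<^sup>2)"
        using C_pos D(1) by (simp add: ennreal_mult)
    qed
    also have "\<dots> = ennreal (C * (L2_norm \<phi>)\<^sup>2 * (C * D)) * ennreal ((L2_norm f)\<^sup>2 * (L2_norm \<phi>)\<^sup>2)"
      using STFT_isometry[OF window f] by (simp add: nn_integral_cmult)
    also have "\<dots> = ennreal ((B - 1) * (L2_norm f)\<^sup>2)"
      using C_pos D(1) by (simp add: B_def mult_ac flip: ennreal_mult)
    also have "\<dots> \<le> ennreal (B * (L2_norm f)\<^sup>2)"
      by (intro ennreal_leI mult_right_mono) auto
    finally show ?thesis
      using B by (subst (asm) ennreal_le_iff) auto
  qed
  with B show thesis
    by (rule that)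
qed

text \<open>Splitting \<open>f\<close> into its localized part and the remainder bounds the diagonal term
  \<open>\<langle>H f, f\<rangle>\<close> by the norm of \<open>H f\<close> and two summable quantities.\<close>

lemma symbol_energy_le:
  assumes \<gamma>: "\<gamma> \<in> \<Gamma>" and f: "square_integrable f" and \<delta>: "0 < \<delta>" and K: "0 < K"
  shows "(\<integral>z. \<eta> \<gamma> z * (norm (STFT \<phi> f z))\<^sup>2 \<partial>lborel)
    \<le> K * (L2_norm (loc_op (\<eta> \<gamma>) \<phi> f))\<^sup>2 + (L2_norm (localizer \<delta> \<gamma> f))\<^sup>2 / K
      + (\<integral>z. \<eta> \<gamma> z * (norm (STFT \<phi> (\<lambda>t. f t - localizer \<delta> \<gamma> f t) z))\<^sup>2 \<partial>lborel)"
proof -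
  let ?H = "loc_op (\<eta> \<gamma>) \<phi> f" and ?L = "localizer \<delta> \<gamma> f"
  let ?R = "\<lambda>t. f t - ?L t"
  let ?a = "\<integral>z. \<eta> \<gamma> z * (norm (STFT \<phi> f z))\<^sup>2 \<partial>lborel"
  let ?e = "\<integral>z. \<eta> \<gamma> z * (norm (STFT \<phi> ?R z))\<^sup>2 \<partial>lborel"
  note L = square_integrable_localizer[OF \<delta> f]
  note R = square_integrable_diff[OF f L]
  note H = square_integrable_loc_op[OF integrable_symbol[OF \<gamma>] window f]
  note inner = L2_inner_loc_op[OF integrable_symbol[OF \<gamma>] window f]
  note energy = integrable_symbol_energy[OF \<gamma>]
  have "complex_of_real ?a = L2_inner ?H f"
  proof -
    have "L2_inner ?H f = (\<integral>z. complex_of_real (\<eta> \<gamma> z * (norm (STFT \<phi> f z))\<^sup>2) \<partial>lborel)"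
      unfolding inner[OF f] by (simp only: of_real_mult complex_norm_square mult_ac)
    then show ?thesis
      by (simp only: integral_complex_of_real)
  qed
  also have "\<dots> = L2_inner ?H ?L + L2_inner ?H ?R"
  proof -
    have "L2_inner ?H ?R = L2_inner ?H f - L2_inner ?H ?L"
      using integrable_mult_square_integrable[OF H square_integrable_cnj[OF f]]
        integrable_mult_square_integrable[OF H square_integrable_cnj[OF L]]
      by (simp add: L2_inner_def right_diff_distrib)
    then show ?thesis
      by simp
  qed
  finally have "norm (complex_of_real ?a) \<le> norm (L2_inner ?H ?L) + norm (L2_inner ?H ?R)"
    by (metis norm_triangle_ineq)
  then have 1: "?a \<le> norm (L2_inner ?H ?L) + norm (L2_inner ?H ?R)"
    by simp
  have 2: "norm (L2_inner ?H ?L) \<le> L2_norm ?H * L2_norm ?L"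
    by (rule norm_L2_inner_le[OF H L])
  have "norm (L2_inner ?H ?R) \<le> (\<integral>z. norm (STFT \<phi> f z * of_real (\<eta> \<gamma> z) * cnj (STFT \<phi> ?R z)) \<partial>lborel)"
    unfolding inner[OF R] by (rule integral_norm_bound)
  \<comment> \<open>The arithmetic-geometric mean inequality leaves only half of the diagonal term
    on the right, which is absorbed at the end into the left side.\<close>
  also have "\<dots> \<le> (\<integral>z. \<eta> \<gamma> z * (norm (STFT \<phi> f z))\<^sup>2 / 2 + \<eta> \<gamma> z * (norm (STFT \<phi> ?R z))\<^sup>2 / 2 \<partial>lborel)"
  proof (rule integral_mono)
    fix z
    have "norm (STFT \<phi> f z) * norm (STFT \<phi> ?R z) \<le> (norm (STFT \<phi> f z))\<^sup>2 / 2 + (norm (STFT \<phi> ?R z))\<^sup>2 / 2"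
      using sum_squares_bound[of "norm (STFT \<phi> f z)" "norm (STFT \<phi> ?R z)"] by simp
    then have "\<eta> \<gamma> z * (norm (STFT \<phi> f z) * norm (STFT \<phi> ?R z))
        \<le> \<eta> \<gamma> z * ((norm (STFT \<phi> f z))\<^sup>2 / 2 + (norm (STFT \<phi> ?R z))\<^sup>2 / 2)"
      by (intro mult_left_mono symbol_nonneg[OF \<gamma>])
    then show "norm (STFT \<phi> f z * of_real (\<eta> \<gamma> z) * cnj (STFT \<phi> ?R z))
        \<le> \<eta> \<gamma> z * (norm (STFT \<phi> f z))\<^sup>2 / 2 + \<eta> \<gamma> z * (norm (STFT \<phi> ?R z))\<^sup>2 / 2"
      using symbol_nonneg[OF \<gamma>, of z] by (simp add: norm_mult algebra_simps)
  qed (use integrable_symbol_STFT[OF \<gamma> f R] energy[OF f] energy[OF R] in auto)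
  also have "\<dots> = ?a / 2 + ?e / 2"
    using energy[OF f] energy[OF R] by simp
  finally have 3: "norm (L2_inner ?H ?R) \<le> ?a / 2 + ?e / 2" .
  \<comment> \<open>Young's inequality with parameter \<open>K\<close>; a large \<open>K\<close>
    makes the share of the localized part small.\<close>
  have 4: "2 * (L2_norm ?H * L2_norm ?L) \<le> K * (L2_norm ?H)\<^sup>2 + (L2_norm ?L)\<^sup>2 / K"
  proof -
    have "2 * (K * L2_norm ?H) * L2_norm ?L \<le> (K * L2_norm ?H)\<^sup>2 + (L2_norm ?L)\<^sup>2"
      by (rule sum_squares_bound)
    then have "(2 * (K * L2_norm ?H) * L2_norm ?L) / K \<le> ((K * L2_norm ?H)\<^sup>2 + (L2_norm ?L)\<^sup>2) / K"
      using K by (intro divide_right_mono) auto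
    then show ?thesis
      using K by (simp add: add_divide_distrib power2_eq_square mult_ac)
  qed
  show ?thesis
    using 1 2 3 4 by linarith
qed

text \<open>The tolerance is divided equally. One half fixes \<open>\<delta>\<close> through the
  remainders; the constant \<open>D\<close> of the localizers then depends on
  \<open>\<delta>\<close>, and \<open>K = 2 * D / e\<close> makes their share \<open>D / K\<close>
  equal to the other half.\<close>

lemma symbol_energy_sum_le:
  assumes e: "0 < e"
  obtains K where "0 < K" "\<And>f F. square_integrable f \<Longrightarrow> finite F \<Longrightarrow> F \<subseteq> \<Gamma> \<Longrightarrow>
    (\<Sum>\<gamma>\<in>F. \<integral>z. \<eta> \<gamma> z * (norm (STFT \<phi> f z))\<^sup>2 \<partial>lborel)
      \<le> K * (\<Sum>\<gamma>\<in>F. (L2_norm (loc_op (\<eta> \<gamma>) \<phi> f))\<^sup>2) + e * (L2_norm f)\<^sup>2"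
proof -
  obtain \<delta> where \<delta>: "0 < \<delta>" "\<And>f F. square_integrable f \<Longrightarrow> finite F \<Longrightarrow> F \<subseteq> \<Gamma> \<Longrightarrow>
    (\<Sum>\<gamma>\<in>F. \<integral>\<^sup>+z. ennreal (\<eta> \<gamma> z * (norm (STFT \<phi> (\<lambda>t. f t - localizer \<delta> \<gamma> f t) z))\<^sup>2) \<partial>lborel)
      \<le> ennreal (e / 2 * (L2_norm f)\<^sup>2)"
    using localizer_remainder_sum[OF discrete r_gt_1 C_pos symbol_nonneg symbol_le symbol_measurable window, of "e / 2"] e
    by auto
  obtain D where D: "0 < D" "\<And>f F. square_integrable f \<Longrightarrow> finite F \<Longrightarrow> F \<subseteq> \<Gamma>
    \<Longrightarrow> (\<Sum>\<gamma>\<in>F. (L2_norm (localizer \<delta> \<gamma> f))\<^sup>2) \<le> D * (L2_norm f)\<^sup>2"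
    using localizer_sum_le[OF \<delta>(1) discrete] by auto
  define K where "K = 2 * D / e"
  have K: "0 < K"
    using D(1) e by (simp add: K_def)
  have "(\<Sum>\<gamma>\<in>F. \<integral>z. \<eta> \<gamma> z * (norm (STFT \<phi> f z))\<^sup>2 \<partial>lborel)
      \<le> K * (\<Sum>\<gamma>\<in>F. (L2_norm (loc_op (\<eta> \<gamma>) \<phi> f))\<^sup>2) + e * (L2_norm f)\<^sup>2"
    if f: "square_integrable f" and F: "finite F" "F \<subseteq> \<Gamma>" for f F
  proof -
    let ?R = "\<lambda>\<gamma> t. f t - localizer \<delta> \<gamma> f t"
    let ?e = "\<lambda>\<gamma>. \<integral>z. \<eta> \<gamma> z * (norm (STFT \<phi> (?R \<gamma>) z))\<^sup>2 \<partial>lborel"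
    have "(\<Sum>\<gamma>\<in>F. \<integral>\<^sup>+z. ennreal (\<eta> \<gamma> z * (norm (STFT \<phi> (?R \<gamma>) z))\<^sup>2) \<partial>lborel) = (\<Sum>\<gamma>\<in>F. ennreal (?e \<gamma>))"
    proof (rule sum.cong[OF refl])
      fix \<gamma>
      assume "\<gamma> \<in> F"
      then have \<gamma>: "\<gamma> \<in> \<Gamma>"
        using F by auto
      show "(\<integral>\<^sup>+z. ennreal (\<eta> \<gamma> z * (norm (STFT \<phi> (?R \<gamma>) z))\<^sup>2) \<partial>lborel) = ennreal (?e \<gamma>)"
        using symbol_nonneg[OF \<gamma>]
        by (intro nn_integral_eq_integral integrable_symbol_energy \<gamma> square_integrable_diff f
            square_integrable_localizer \<delta>(1)) auto
    qed
    also have "\<dots> = ennreal (\<Sum>\<gamma>\<in>F. ?e \<gamma>)"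
      using F symbol_nonneg by (intro sum_ennreal Bochner_Integration.integral_nonneg) auto
    finally have "ennreal (\<Sum>\<gamma>\<in>F. ?e \<gamma>) \<le> ennreal (e / 2 * (L2_norm f)\<^sup>2)"
      using \<delta>(2)[OF f F] by simp
    then have rem: "(\<Sum>\<gamma>\<in>F. ?e \<gamma>) \<le> e / 2 * (L2_norm f)\<^sup>2"
      using e by (subst (asm) ennreal_le_iff) auto
    have "(\<Sum>\<gamma>\<in>F. \<integral>z. \<eta> \<gamma> z * (norm (STFT \<phi> f z))\<^sup>2 \<partial>lborel)
        \<le> (\<Sum>\<gamma>\<in>F. K * (L2_norm (loc_op (\<eta> \<gamma>) \<phi> f))\<^sup>2 + (L2_norm (localizer \<delta> \<gamma> f))\<^sup>2 / K + ?e \<gamma>)"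
      using F by (intro sum_mono symbol_energy_le f \<delta>(1) K) auto
    also have "\<dots> = K * (\<Sum>\<gamma>\<in>F. (L2_norm (loc_op (\<eta> \<gamma>) \<phi> f))\<^sup>2)
        + (\<Sum>\<gamma>\<in>F. (L2_norm (localizer \<delta> \<gamma> f))\<^sup>2) / K + (\<Sum>\<gamma>\<in>F. ?e \<gamma>)"
      by (simp add: sum.distrib sum_distrib_left sum_divide_distrib)
    also have "\<dots> \<le> K * (\<Sum>\<gamma>\<in>F. (L2_norm (loc_op (\<eta> \<gamma>) \<phi> f))\<^sup>2) + D * (L2_norm f)\<^sup>2 / K + e / 2 * (L2_norm f)\<^sup>2"
      using K by (intro add_mono order_refl rem divide_right_mono D(2) f F) auto
    also have "D * (L2_norm f)\<^sup>2 / K = e / 2 * (L2_norm f)\<^sup>2"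
      using D(1) e by (simp add: K_def)
    finally show ?thesis
      by simp
  qed
  with K show thesis
    by (rule that)
qed

text \<open>\<open>infsum\<close> is 0 for families that are not summable, so the bound is
  accompanied by summability; both follow from the uniform bound on finite partial sums.\<close>

lemma loc_op_frame_upper:
  obtains B where "0 < B"
    "\<And>f. square_integrable f \<Longrightarrow> (\<lambda>\<gamma>. (L2_norm (loc_op (\<eta> \<gamma>) \<phi> f))\<^sup>2) summable_on \<Gamma>"
    "\<And>f. square_integrable f \<Longrightarrow> (\<Sum>\<^sub>\<infinity>\<gamma>\<in>\<Gamma>. (L2_norm (loc_op (\<eta> \<gamma>) \<phi> f))\<^sup>2) \<le> B * (L2_norm f)\<^sup>2"
proof -
  obtain B where B: "0 < B" "\<And>f F. square_integrable f \<Longrightarrow> finite F \<Longrightarrow> F \<subseteq> \<Gamma> \<Longrightarrow>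
    (\<Sum>\<gamma>\<in>F. (L2_norm (loc_op (\<eta> \<gamma>) \<phi> f))\<^sup>2) \<le> B * (L2_norm f)\<^sup>2"
    using loc_op_sum_le by blast
  have "(\<lambda>\<gamma>. (L2_norm (loc_op (\<eta> \<gamma>) \<phi> f))\<^sup>2) summable_on \<Gamma>" if "square_integrable f" for f
    using B(2)[OF that] by (intro nonneg_bdd_above_summable_on) (auto intro!: bdd_aboveI2)
  with B show thesis
    by (intro that[of B] infsum_le_finite_sums) auto
qed

text \<open>The finite estimates have a right side bounded by the one with the full sum of norms,
  since all its terms are nonnegative; Fatou then completes the left side.\<close>

lemma weighted_energy_le:
  assumes summable: "\<And>z. (\<lambda>\<gamma>. \<eta> \<gamma> z) summable_on \<Gamma>" and e: "0 < e"
  obtains K where "0 < K" "\<And>f. square_integrable f \<Longrightarrow>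
    (\<integral>\<^sup>+z. ennreal ((\<Sum>\<^sub>\<infinity>\<gamma>\<in>\<Gamma>. \<eta> \<gamma> z) * (norm (STFT \<phi> f z))\<^sup>2) \<partial>lborel)
      \<le> ennreal (K * (\<Sum>\<^sub>\<infinity>\<gamma>\<in>\<Gamma>. (L2_norm (loc_op (\<eta> \<gamma>) \<phi> f))\<^sup>2) + e * (L2_norm f)\<^sup>2)"
proof -
  obtain K where K: "0 < K" "\<And>f F. square_integrable f \<Longrightarrow> finite F \<Longrightarrow> F \<subseteq> \<Gamma> \<Longrightarrow>
    (\<Sum>\<gamma>\<in>F. \<integral>z. \<eta> \<gamma> z * (norm (STFT \<phi> f z))\<^sup>2 \<partial>lborel)
      \<le> K * (\<Sum>\<gamma>\<in>F. (L2_norm (loc_op (\<eta> \<gamma>) \<phi> f))\<^sup>2) + e * (L2_norm f)\<^sup>2"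
    using symbol_energy_sum_le[OF e] by blast
  obtain B where B: "\<And>f. square_integrable f \<Longrightarrow> (\<lambda>\<gamma>. (L2_norm (loc_op (\<eta> \<gamma>) \<phi> f))\<^sup>2) summable_on \<Gamma>"
    using loc_op_frame_upper by blast
  have "(\<integral>\<^sup>+z. ennreal ((\<Sum>\<^sub>\<infinity>\<gamma>\<in>\<Gamma>. \<eta> \<gamma> z) * (norm (STFT \<phi> f z))\<^sup>2) \<partial>lborel)
      \<le> ennreal (K * (\<Sum>\<^sub>\<infinity>\<gamma>\<in>\<Gamma>. (L2_norm (loc_op (\<eta> \<gamma>) \<phi> f))\<^sup>2) + e * (L2_norm f)\<^sup>2)"
    if f: "square_integrable f" for f
  proof (rule nn_integral_infsum_le[OF discrete_set_countable[OF discrete] summable symbol_measurable])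
    show "(\<lambda>z. (norm (STFT \<phi> f z))\<^sup>2) \<in> borel_measurable borel"
      using square_integrable_measurable[OF square_integrable_STFT[OF window f]] by measurable
    fix F
    assume F: "finite F" "F \<subseteq> \<Gamma>"
    have "(\<Sum>\<gamma>\<in>F. \<integral>\<^sup>+z. ennreal (\<eta> \<gamma> z * (norm (STFT \<phi> f z))\<^sup>2) \<partial>lborel)
        = (\<Sum>\<gamma>\<in>F. ennreal (\<integral>z. \<eta> \<gamma> z * (norm (STFT \<phi> f z))\<^sup>2 \<partial>lborel))"
      by (intro sum.cong refl nn_integral_eq_integral integrable_symbol_energy subsetD[OF F(2)] f
          AE_I2 mult_nonneg_nonneg symbol_nonneg) auto
    also have "\<dots> = ennreal (\<Sum>\<gamma>\<in>F. \<integral>z. \<eta> \<gamma> z * (norm (STFT \<phi> f z))\<^sup>2 \<partial>lborel)"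
      by (intro sum_ennreal Bochner_Integration.integral_nonneg mult_nonneg_nonneg
          symbol_nonneg[OF subsetD[OF F(2)]]) auto
    also have "\<dots> \<le> ennreal (K * (\<Sum>\<^sub>\<infinity>\<gamma>\<in>\<Gamma>. (L2_norm (loc_op (\<eta> \<gamma>) \<phi> f))\<^sup>2) + e * (L2_norm f)\<^sup>2)"
    proof (rule ennreal_leI, rule order_trans[OF K(2)[OF f F]])
      have "(\<Sum>\<gamma>\<in>F. (L2_norm (loc_op (\<eta> \<gamma>) \<phi> f))\<^sup>2) \<le> (\<Sum>\<^sub>\<infinity>\<gamma>\<in>\<Gamma>. (L2_norm (loc_op (\<eta> \<gamma>) \<phi> f))\<^sup>2)"
        by (rule finite_sum_le_infsum[OF B[OF f] F]) simp
      then show "K * (\<Sum>\<gamma>\<in>F. (L2_norm (loc_op (\<eta> \<gamma>) \<phi> f))\<^sup>2) + e * (L2_norm f)\<^sup>2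
          \<le> K * (\<Sum>\<^sub>\<infinity>\<gamma>\<in>\<Gamma>. (L2_norm (loc_op (\<eta> \<gamma>) \<phi> f))\<^sup>2) + e * (L2_norm f)\<^sup>2"
        using K(1) by (intro add_right_mono mult_left_mono) auto
    qed
    finally show "(\<Sum>\<gamma>\<in>F. \<integral>\<^sup>+z. ennreal (\<eta> \<gamma> z * (norm (STFT \<phi> f z))\<^sup>2) \<partial>lborel)
        \<le> ennreal (K * (\<Sum>\<^sub>\<infinity>\<gamma>\<in>\<Gamma>. (L2_norm (loc_op (\<eta> \<gamma>) \<phi> f))\<^sup>2) + e * (L2_norm f)\<^sup>2)" .
  qed (use symbol_nonneg in auto)
  with K(1) show thesis
    by (rule that)
qed

end

section \<open>Comparison of the two windows and the joint frame bounds\<close>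

theorem proposition3p3:
  fixes \<phi> :: "nat \<Rightarrow> real \<Rightarrow> complex"
    and \<Gamma> :: "nat \<Rightarrow> (real \<times> real) set"
    and \<eta> :: "nat \<Rightarrow> real \<times> real \<Rightarrow> real \<times> real \<Rightarrow> real"
  assumes "square_integrable (\<phi> 1)" and "square_integrable (\<phi> 2)"
    and "L2_norm (\<phi> 1) = 1" and "L2_norm (\<phi> 2) = 1"
    and "well_spread {1, 2} \<Gamma> \<eta>"
    and "\<And>i \<gamma> \<xi>. i \<in> {1, 2} \<Longrightarrow> \<gamma> \<in> \<Gamma> i \<Longrightarrow> 0 \<le> \<eta> i \<gamma> \<xi>"
    and "\<And>i \<xi>. i \<in> {1, 2} \<Longrightarrow> (\<lambda>\<gamma>. \<eta> i \<gamma> \<xi>) summable_on \<Gamma> i"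
    and "comparable (\<lambda>\<xi>. \<Sum>i\<in>{1, 2}. \<Sum>\<^sub>\<infinity>\<gamma>\<in>\<Gamma> i. \<eta> i \<gamma> \<xi>) (\<lambda>_. 1)"
    and "L2_norm (\<lambda>t. \<phi> 1 t - \<phi> 2 t) < 1 / 2"
  shows "\<exists>A B. 0 < A \<and> A \<le> B \<and>
    (\<forall>f :: real \<Rightarrow> complex. square_integrable f \<longrightarrow>
       (\<forall>i\<in>{1, 2}. \<forall>\<gamma>\<in>\<Gamma> i. square_integrable (loc_op (\<eta> i \<gamma>) (\<phi> i) f)) \<and>
       (\<forall>i\<in>{1, 2}. (\<lambda>\<gamma>. (L2_norm (loc_op (\<eta> i \<gamma>) (\<phi> i) f))\<^sup>2) summable_on \<Gamma> i) \<and>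
       A * (L2_norm f)\<^sup>2 \<le> (\<Sum>i\<in>{1, 2}. \<Sum>\<^sub>\<infinity>\<gamma>\<in>\<Gamma> i. (L2_norm (loc_op (\<eta> i \<gamma>) (\<phi> i) f))\<^sup>2) \<and>
       (\<Sum>i\<in>{1, 2}. \<Sum>\<^sub>\<infinity>\<gamma>\<in>\<Gamma> i. (L2_norm (loc_op (\<eta> i \<gamma>) (\<phi> i) f))\<^sup>2) \<le> B * (L2_norm f)\<^sup>2)"
proof -
  obtain g where disc: "discrete_set (\<Union>i\<in>{1, 2}. \<Gamma> i)"
    and integrable: "\<And>i \<gamma>. i \<in> {1, 2} \<Longrightarrow> \<gamma> \<in> \<Gamma> i \<Longrightarrow> integrable lborel (\<eta> i \<gamma>)"
    and g: "polynomial_decay g"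
    and \<eta>_g: "\<And>i \<gamma> z. i \<in> {1, 2} \<Longrightarrow> \<gamma> \<in> \<Gamma> i \<Longrightarrow> \<bar>\<eta> i \<gamma> z\<bar> \<le> g (z - \<gamma>)"
    using assms(5) unfolding well_spread_def by blast
  obtain C r where C: "0 < C" "1 < r" "\<And>z. \<bar>g z\<bar> \<le> C * product_decay r z"
    using polynomial_decay_product_decay[OF g] by blast
  \<comment> \<open>The common envelope \<open>g\<close> lets both families share \<open>C\<close>
    and \<open>r\<close>; discreteness passes from the union to each index set.\<close>
  have family: "symbol_family (\<Gamma> i) (\<eta> i) C r (\<phi> i)" if i: "i \<in> {1, 2}" for i
  proof
    show "discrete_set (\<Gamma> i)"
      by (rule discrete_set_subset[OF disc]) (use i in blast)
    show "\<eta> i \<gamma> z \<le> C * product_decay r (z - \<gamma>)" if "\<gamma> \<in> \<Gamma> i" for \<gamma> z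
      using \<eta>_g[OF i that, of z] C(3)[of "z - \<gamma>"] by linarith
    show "square_integrable (\<phi> i)"
      using assms(1,2) i by auto
  qed (use integrable[OF i] assms(6)[OF i] C in auto)
  interpret w1: symbol_family "\<Gamma> 1" "\<eta> 1" C r "\<phi> 1"
    by (rule family) simp
  interpret w2: symbol_family "\<Gamma> 2" "\<eta> 2" C r "\<phi> 2"
    by (rule family) simp
  define S where "S i f = (\<Sum>\<^sub>\<infinity>\<gamma>\<in>\<Gamma> i. (L2_norm (loc_op (\<eta> i \<gamma>) (\<phi> i) f))\<^sup>2)" for i f
  define m where "m i z = (\<Sum>\<^sub>\<infinity>\<gamma>\<in>\<Gamma> i. \<eta> i \<gamma> z)" for i z
  obtain a where a: "0 < a" "\<And>z. a \<le> m 1 z + m 2 z"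
    using assms(8) by (auto simp: comparable_def m_def)
  have summable: "(\<lambda>\<gamma>. \<eta> 1 \<gamma> z) summable_on \<Gamma> 1" "(\<lambda>\<gamma>. \<eta> 2 \<gamma> z) summable_on \<Gamma> 2" for z
    by (rule assms(7), simp)+
  obtain B1 where B1: "0 < B1"
    "\<And>f. square_integrable f \<Longrightarrow> (\<lambda>\<gamma>. (L2_norm (loc_op (\<eta> 1 \<gamma>) (\<phi> 1) f))\<^sup>2) summable_on \<Gamma> 1"
    "\<And>f. square_integrable f \<Longrightarrow> S 1 f \<le> B1 * (L2_norm f)\<^sup>2"
    unfolding S_def using w1.loc_op_frame_upper by blast
  obtain B2 where B2: "0 < B2"
    "\<And>f. square_integrable f \<Longrightarrow> (\<lambda>\<gamma>. (L2_norm (loc_op (\<eta> 2 \<gamma>) (\<phi> 2) f))\<^sup>2) summable_on \<Gamma> 2"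
    "\<And>f. square_integrable f \<Longrightarrow> S 2 f \<le> B2 * (L2_norm f)\<^sup>2"
    unfolding S_def using w2.loc_op_frame_upper by blast
  \<comment> \<open>The energy available is \<open>a / 2\<close>, of which the difference of the
    windows takes at most \<open>a / 4\<close>. Remainders of \<open>a / 16\<close> for each window
    leave \<open>a / 8\<close>.\<close>
  have e: "0 < a / 16"
    using a by simp
  obtain K1 where K1: "0 < K1" "\<And>f. square_integrable f \<Longrightarrow>
    (\<integral>\<^sup>+z. ennreal (m 1 z * (norm (STFT (\<phi> 1) f z))\<^sup>2) \<partial>lborel) \<le> ennreal (K1 * S 1 f + a / 16 * (L2_norm f)\<^sup>2)"
    unfolding S_def m_def using w1.weighted_energy_le[OF summable(1) e] by blast
  obtain K2 where K2: "0 < K2" "\<And>f. square_integrable f \<Longrightarrow>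
    (\<integral>\<^sup>+z. ennreal (m 2 z * (norm (STFT (\<phi> 2) f z))\<^sup>2) \<partial>lborel) \<le> ennreal (K2 * S 2 f + a / 16 * (L2_norm f)\<^sup>2)"
    unfolding S_def m_def using w2.weighted_energy_le[OF summable(2) e] by blast
  have S_nonneg: "0 \<le> S i f" for i f
    unfolding S_def by (rule infsum_nonneg) simp
  have m_nonneg: "0 \<le> m 1 z" "0 \<le> m 2 z" for z
    unfolding m_def by (rule infsum_nonneg, rule w1.symbol_nonneg w2.symbol_nonneg, assumption)+
  have m_meas: "m 1 \<in> borel_measurable borel" "m 2 \<in> borel_measurable borel"
    unfolding m_def[abs_def]
    by (rule borel_measurable_infsum_countable[OF discrete_set_countable[OF w1.discrete] summable(1) w1.symbol_measurable],
        simp, rule borel_measurable_infsum_countable[OF discrete_set_countable[OF w2.discrete] summable(2) w2.symbol_measurable], simp)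
  let ?d = "\<lambda>t. \<phi> 1 t - \<phi> 2 t"
  have d: "square_integrable ?d"
    by (rule square_integrable_diff[OF assms(1,2)])
  have "(L2_norm ?d)\<^sup>2 \<le> (1 / 2)\<^sup>2"
    using assms(9) by (intro power_mono) auto
  then have d4: "(L2_norm ?d)\<^sup>2 \<le> 1 / 4"
    by (simp add: power2_eq_square)
  have lower: "a / 8 * (L2_norm f)\<^sup>2 \<le> (K1 + K2) * (S 1 f + S 2 f)" if f: "square_integrable f" for f
  proof -
    let ?V1 = "STFT (\<phi> 1) f" and ?V2 = "STFT (\<phi> 2) f" and ?N = "(L2_norm f)\<^sup>2"
    have [measurable]: "?V1 \<in> borel_measurable borel" "?V2 \<in> borel_measurable borel"
      "STFT ?d f \<in> borel_measurable borel"
      using square_integrable_STFT[OF assms(1) f] square_integrable_STFT[OF assms(2) f]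
        square_integrable_STFT[OF d f] by auto
    note [measurable] = m_meas
    have nonneg: "0 \<le> K1 * S 1 f + a / 16 * ?N" "0 \<le> K2 * S 2 f + a / 16 * ?N"
      using a(1) K1(1) K2(1) S_nonneg[of 1 f] S_nonneg[of 2 f] by simp_all
    have "ennreal (a / 2 * ?N) = ennreal (a / 2) * ennreal ?N"
      using a(1) by (intro ennreal_mult) auto
    also have "ennreal ?N = (\<integral>\<^sup>+z. ennreal ((norm (?V1 z))\<^sup>2) \<partial>lborel)"
      using STFT_isometry[OF assms(1) f] assms(3) by simp
    also have "ennreal (a / 2) * \<dots> = (\<integral>\<^sup>+z. ennreal (a / 2) * ennreal ((norm (?V1 z))\<^sup>2) \<partial>lborel)"
      by (rule nn_integral_cmult[symmetric]) measurable
    also have "\<dots> \<le> (\<integral>\<^sup>+z. ennreal (m 1 z * (norm (?V1 z))\<^sup>2) + ennreal (m 2 z * (norm (?V2 z))\<^sup>2)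
        + ennreal a * ennreal ((norm (STFT ?d f z))\<^sup>2) \<partial>lborel)"
    proof (rule nn_integral_mono)
      fix z
      let ?x = "(norm (?V1 z))\<^sup>2" and ?y = "(norm (?V2 z))\<^sup>2" and ?u = "(norm (STFT ?d f z))\<^sup>2"
      have "?V1 z = ?V2 z + STFT ?d f z"
        unfolding STFT_diff_window[OF assms(1,2) f] by simp
      then have xy: "?x / 2 - ?u \<le> ?y"
        using norm_add_squared_le[of "?V2 z" "STFT ?d f z"] by simp
      \<comment> \<open>If the left factor is nonnegative, it is a lower bound for both
        \<open>?x\<close> and \<open>?y\<close>, so the sum \<open>m 1 z + m 2 z\<close> can act on
        it no matter which of the two symbol sums is large at \<open>z\<close>. Otherwise the left
        side is not positive.\<close>
      have "a * (?x / 2 - ?u) \<le> m 1 z * ?x + m 2 z * ?y"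
      proof (cases "0 \<le> ?x / 2 - ?u")
        case True
        have "a * (?x / 2 - ?u) \<le> (m 1 z + m 2 z) * (?x / 2 - ?u)"
          by (intro mult_right_mono a True)
        also have "\<dots> = m 1 z * (?x / 2 - ?u) + m 2 z * (?x / 2 - ?u)"
          by (rule distrib_right)
        also have "\<dots> \<le> m 1 z * ?x + m 2 z * ?y"
        proof (intro add_mono mult_left_mono m_nonneg xy)
          have "0 \<le> ?x" "0 \<le> ?u"
            by simp_all
          then show "?x / 2 - ?u \<le> ?x"
            by linarith
        qed
        finally show ?thesis .
      next
        case False
        then have "a * (?x / 2 - ?u) \<le> 0"
          using a(1) by (intro mult_nonneg_nonpos) auto
        also have "0 \<le> m 1 z * ?x + m 2 z * ?y"
          using m_nonneg[of z] by simp
        finally show ?thesis .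
      qed
      then have "a / 2 * ?x \<le> m 1 z * ?x + m 2 z * ?y + a * ?u"
        by (simp add: algebra_simps)
      then have le: "ennreal (a / 2 * ?x) \<le> ennreal (m 1 z * ?x + m 2 z * ?y + a * ?u)"
        by (rule ennreal_leI)
      have "ennreal (a / 2) * ennreal ?x = ennreal (a / 2 * ?x)"
        using a(1) by (intro ennreal_mult[symmetric]) auto
      also note le
      also have "ennreal (m 1 z * ?x + m 2 z * ?y + a * ?u)
          = ennreal (m 1 z * ?x) + ennreal (m 2 z * ?y) + ennreal a * ennreal ?u"
        using a(1) m_nonneg[of z] by (simp add: ennreal_plus ennreal_mult)
      finally show "ennreal (a / 2) * ennreal ?x
          \<le> ennreal (m 1 z * ?x) + ennreal (m 2 z * ?y) + ennreal a * ennreal ?u" .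
    qed
    also have "\<dots> = (\<integral>\<^sup>+z. ennreal (m 1 z * (norm (?V1 z))\<^sup>2) \<partial>lborel) + (\<integral>\<^sup>+z. ennreal (m 2 z * (norm (?V2 z))\<^sup>2) \<partial>lborel)
        + ennreal a * ennreal (?N * (L2_norm ?d)\<^sup>2)"
    proof -
      let ?E = "\<lambda>z. ennreal (m 1 z * (norm (?V1 z))\<^sup>2) + ennreal (m 2 z * (norm (?V2 z))\<^sup>2)"
      have "(\<integral>\<^sup>+z. ?E z + ennreal a * ennreal ((norm (STFT ?d f z))\<^sup>2) \<partial>lborel)
          = (\<integral>\<^sup>+z. ?E z \<partial>lborel) + (\<integral>\<^sup>+z. ennreal a * ennreal ((norm (STFT ?d f z))\<^sup>2) \<partial>lborel)"
        by (rule nn_integral_add) measurable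
      also have "(\<integral>\<^sup>+z. ?E z \<partial>lborel)
          = (\<integral>\<^sup>+z. ennreal (m 1 z * (norm (?V1 z))\<^sup>2) \<partial>lborel) + (\<integral>\<^sup>+z. ennreal (m 2 z * (norm (?V2 z))\<^sup>2) \<partial>lborel)"
        by (rule nn_integral_add) measurable
      also have "(\<integral>\<^sup>+z. ennreal a * ennreal ((norm (STFT ?d f z))\<^sup>2) \<partial>lborel)
          = ennreal a * (\<integral>\<^sup>+z. ennreal ((norm (STFT ?d f z))\<^sup>2) \<partial>lborel)"
        by (rule nn_integral_cmult) measurable
      finally show ?thesis
        unfolding STFT_isometry[OF d f] .
    qed
    also have "\<dots> \<le> ennreal (K1 * S 1 f + a / 16 * ?N) + ennreal (K2 * S 2 f + a / 16 * ?N)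
        + ennreal a * ennreal (?N * (1 / 4))"
      by (intro add_mono mult_left_mono K1(2) K2(2) f ennreal_leI d4) auto
    also have "\<dots> = ennreal ((K1 * S 1 f + a / 16 * ?N) + (K2 * S 2 f + a / 16 * ?N) + a * (?N * (1 / 4)))"
    proof -
      have "ennreal X + ennreal Y + ennreal a * ennreal W = ennreal (X + Y + a * W)"
        if "0 \<le> X" "0 \<le> Y" "0 \<le> W" for X Y W
        using that a(1) by (simp add: ennreal_plus ennreal_mult)
      then show ?thesis
        using nonneg by simp
    qed
    finally have "a / 2 * ?N \<le> (K1 * S 1 f + a / 16 * ?N) + (K2 * S 2 f + a / 16 * ?N) + a * (?N * (1 / 4))"
      by (subst (asm) ennreal_le_iff) (use a(1) K1(1) K2(1) S_nonneg[of 1 f] S_nonneg[of 2 f] in auto)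
    then have "a / 8 * ?N \<le> K1 * S 1 f + K2 * S 2 f"
      by (simp add: field_simps)
    also have "\<dots> \<le> (K1 + K2) * (S 1 f + S 2 f)"
      using K1(1) K2(1) S_nonneg[of 1 f] S_nonneg[of 2 f] by (simp add: algebra_simps)
    finally show ?thesis .
  qed
  define A where "A = a / 8 / (K1 + K2)"
  \<comment> \<open>Including \<open>A\<close> yields \<open>A \<le> B\<close> directly, without
    comparing the two frame inequalities at a nonzero \<open>f\<close>.\<close>
  define B where "B = A + B1 + B2"
  have "0 < A" "A \<le> B"
    using a(1) K1(1) K2(1) B1(1) B2(1) by (auto simp: A_def B_def)
  moreover have "A * (L2_norm f)\<^sup>2 \<le> S 1 f + S 2 f" if "square_integrable f" for f
    using lower[OF that] K1(1) K2(1) by (simp add: A_def field_simps)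
  moreover have "S 1 f + S 2 f \<le> B * (L2_norm f)\<^sup>2" if "square_integrable f" for f
  proof -
    have "S 1 f + S 2 f \<le> B1 * (L2_norm f)\<^sup>2 + B2 * (L2_norm f)\<^sup>2"
      by (intro add_mono B1(3) B2(3) that)
    also have "\<dots> \<le> B * (L2_norm f)\<^sup>2"
      using \<open>0 < A\<close> by (simp add: B_def algebra_simps)
    finally show ?thesis .
  qed
  moreover have "square_integrable (loc_op (\<eta> i \<gamma>) (\<phi> i) f)"
    if "square_integrable f" "i \<in> {1, 2}" "\<gamma> \<in> \<Gamma> i" for f i \<gamma>
    by (rule square_integrable_loc_op[OF integrable[OF that(2,3)] symbol_family.window[OF family[OF that(2)]] that(1)])
  ultimately show ?thesis
    using B1(2) B2(2) unfolding S_def by (intro exI[of _ A] exI[of _ B]) auto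
qed

end
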